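(* Let $K\subset\mathbb{R}^m$ be a convex body. (a) There exists a continuous map $f_K\colon\mathbb{R}\mathrm{P}^m\longrightarrow S^m$ such that, for every integer $k\geq 2$, if $f_K$ admits a $k$-multiplicity, then there exist $k$ pairwise distinct affine hyperplanes $H_1,\ldots,H_k$ in $\mathbb{R}^m$, each meeting $K$, such that $m(H_1)=\cdots=m(H_k)$. (b) There exists a continuous map $f_K\colon\mathbb{R}\mathrm{P}^m\longrightarrow S^m$ such that, for every integer $k\geq 2$, if $f_K$ admits a $k$-multiplicity, then there exist $k$ pairwise distinct affine hyperplanes $H_1,\ldots,H_k$ in $\mathbb{R}^m$, each meeting $K$, such that $s(H_1)=\cdots=s(H_k)$.
   Context: A convex body in $\mathbb{R}^m$ is a convex compact subset with non-empty interior. For an affine hyperplane $H$ with $H\cap K\neq\emptyset$: $m(H)$ denotes the center of mass of the convex set $K\cap H$ (within $H$; not to be confused with the dimension $m$), and $s(H)$ denotes the Steiner point of $K\cap H$ in $H$, i.e. the center of mass of the Gaussian curvature of the boundary of $K\cap H$ in $H$. Equivalently, identifying $H$ isometrically with $\mathbb{R}^{d}$, $d=m-1$, the Steiner point of a compact convex set $C\subset\mathbb{R}^d$ is $\frac{1}{\kappa_d}\int_{S^{d-1}}h_C(u)\,u\,d\sigma(u)$, where $h_C$ is the support function, $\sigma$ the surface measure on $S^{d-1}$, and $\kappa_d$ the volume of the unit ball of $\mathbb{R}^d$ (and the point itself when $d=0$). A continuous map $f\colon M\to N$ admits a $k$-multiplicity if there exist $k$ pairwise distinct points $x_1,\ldots,x_k\in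 M$ with $f(x_1)=\cdots=f(x_k)$. *)

theory Defs
  imports "HOL-Analysis.Analysis"
begin

section \<open>Real projective space and multiplicities\<close>

definition quotient_topology :: "'a topology \<Rightarrow> ('a \<Rightarrow> 'b) \<Rightarrow> 'b topology" where
  "quotient_topology X q =
     topology (\<lambda>U. U \<subseteq> q ` topspace X \<and> openin X {x \<in> topspace X. q x \<in> U})"

lemma openin_quotient_topology:
  "openin (quotient_topology X q) U \<longleftrightarrow>
     U \<subseteq> q ` topspace X \<and> openin X {x \<in> topspace X. q x \<in> U}"
proof -
  have "istopology (\<lambda>U. U \<subseteq> q ` topspace X \<and> openin X {x \<in> topspace X. q x \<in> U})"
    unfolding istopology_def
  proof (intro conjI allI impI)
    fix S T
    assume S: "S \<subseteq> q ` topspace X \<and> openin X {x \<in> topspace X. q x \<in> S}"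
      and T: "T \<subseteq> q ` topspace X \<and> openin X {x \<in> topspace X. q x \<in> T}"
    then show "S \<inter> T \<subseteq> q ` topspace X" by blast
    have "{x \<in> topspace X. q x \<in> S \<inter> T} =
        {x \<in> topspace X. q x \<in> S} \<inter> {x \<in> topspace X. q x \<in> T}" by blast
    moreover have "openin X ({x \<in> topspace X. q x \<in> S} \<inter> {x \<in> topspace X. q x \<in> T})"
      by (rule openin_Int[OF conjunct2[OF S] conjunct2[OF T]])
    ultimately show "openin X {x \<in> topspace X. q x \<in> S \<inter> T}" by (rule ssubst)
  next
    fix \<K>
    assume K: "\<forall>K\<in>\<K>. K \<subseteq> q ` topspace X \<and> openin X {x \<in> topspace X. q x \<in> K}"
    then show "\<Union>\<K> \<subseteq> q ` topspace X" by blast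
    have "{x \<in> topspace X. q x \<in> \<Union>\<K>} = (\<Union>K\<in>\<K>. {x \<in> topspace X. q x \<in> K})" by blast
    moreover have "openin X (\<Union>K\<in>\<K>. {x \<in> topspace X. q x \<in> K})"
      using K by (intro openin_Union) blast
    ultimately show "openin X {x \<in> topspace X. q x \<in> \<Union>\<K>}" by (rule ssubst)
  qed
  then show ?thesis
    by (simp only: quotient_topology_def topology_inverse')
qed

lemma topspace_quotient_topology: "topspace (quotient_topology X q) = q ` topspace X"
proof
  show "topspace (quotient_topology X q) \<subseteq> q ` topspace X"
    using openin_topspace[of "quotient_topology X q"]
    unfolding openin_quotient_topology by (rule conjunct1)
  have "{x \<in> topspace X. q x \<in> q ` topspace X} = topspace X" by blast
  then show "q ` topspace X \<subseteq> topspace (quotient_topology X q)"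
    by (intro openin_subset) (simp only: openin_quotient_topology openin_topspace subset_refl simp_thms)
qed

lemma quotient_map_quotient_topology: "quotient_map X (quotient_topology X q) q"
  unfolding quotient_map_def topspace_quotient_topology openin_quotient_topology by simp

text \<open>The unit sphere of \<^typ>\<open>'b\<close> with antipodal points identified. Its dimension is
  \<open>DIM('b) - 1\<close>, so \<open>\<real>P\<^sup>m\<close> is obtained from \<open>(real ^ 'n) \<times> real\<close> with \<open>m = CARD('n)\<close>.\<close>

definition real_projective_space :: "'b::euclidean_space set topology" where
  "real_projective_space =
     quotient_topology (top_of_set (sphere (0::'b) 1)) (\<lambda>x. {x, - x})"

definition admits_multiplicity :: "'a topology \<Rightarrow> ('a \<Rightarrow> 'b) \<Rightarrow> nat \<Rightarrow> bool" where
  "admits_multiplicity X f k \<longleftrightarrow>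
     (\<exists>x::nat \<Rightarrow> 'a. x ` {1..k} \<subseteq> topspace X \<and> inj_on x {1..k} \<and>
        (\<forall>i\<in>{1..k}. \<forall>j\<in>{1..k}. f (x i) = f (x j)))"

section \<open>Convex bodies and hyperplanes\<close>

definition convex_body :: "'a::euclidean_space set \<Rightarrow> bool" where
  "convex_body K \<longleftrightarrow> convex K \<and> compact K \<and> interior K \<noteq> {}"

definition affine_hyperplane :: "'a::euclidean_space set \<Rightarrow> bool" where
  "affine_hyperplane H \<longleftrightarrow> (\<exists>a b. a \<noteq> 0 \<and> H = {x. a \<bullet> x = b})"

section \<open>Lebesgue measure on linear and affine subspaces\<close>

definition orthonormal_basis_of :: "'a::euclidean_space set \<Rightarrow> 'a set \<Rightarrow> bool" where
  "orthonormal_basis_of V B \<longleftrightarrow>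
     pairwise orthogonal B \<and> (\<forall>b\<in>B. norm b = 1) \<and> span B = V"

text \<open>Same construction as \<^const>\<open>lborel\<close>, with an orthonormal basis of the linear subspace
  \<open>V\<close> in place of \<^const>\<open>Basis\<close>. The result does not depend on the basis chosen, as Lebesgue measure
  is invariant under linear isometries. For \<open>V = {0}\<close> it is the unit mass at \<open>0\<close>.\<close>

definition subspace_lborel :: "'a::euclidean_space set \<Rightarrow> 'a measure" where
  "subspace_lborel V =
     (let B = (SOME B. orthonormal_basis_of V B)
      in distr (\<Pi>\<^sub>M b\<in>B. lborel) borel (\<lambda>c. \<Sum>b\<in>B. c b *\<^sub>R b))"

definition direction_space :: "'a::euclidean_space set \<Rightarrow> 'a set" where
  "direction_space A = {x - y | x y. x \<in> A \<and> y \<in> A}"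

text \<open>The value does not depend on the base point \<open>p\<close>, by translation invariance.\<close>

definition affine_lborel :: "'a::euclidean_space set \<Rightarrow> 'a measure" where
  "affine_lborel A =
     distr (subspace_lborel (direction_space A)) borel (\<lambda>v. (SOME p. p \<in> A) + v)"

section \<open>Center of mass and Steiner point\<close>

text \<open>The mass of \<open>C\<close> is Lebesgue measure in the dimension of \<open>C\<close> itself. For a hyperplane \<open>H\<close>
  through the interior of \<open>K\<close> this is the measure of \<open>H\<close>; for a supporting hyperplane the face
  \<open>K \<inter> H\<close> may have lower dimension and be a null set of \<open>H\<close>.\<close>

definition center_of_mass :: "'a::euclidean_space set \<Rightarrow> 'a" where
  "center_of_mass C =
     (let \<mu> = affine_lborel (affine hull C)
      in (1 / measure \<mu> C) *\<^sub>R (LINT x:C|\<mu>. x))"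

text \<open>Surface measure on the unit sphere of the \<open>d\<close>-dimensional linear subspace \<open>V\<close>, as a
  cone measure: a set \<open>A\<close> of unit vectors has mass \<open>d \<cdot> \<lambda>\<^sub>V {t u | 0 < t \<le> 1, u \<in> A}\<close>.
  It is counting measure on two points for \<open>d = 1\<close> and zero for \<open>d = 0\<close>.\<close>

definition sphere_measure :: "'a::euclidean_space set \<Rightarrow> 'a measure" where
  "sphere_measure V =
     scale_measure (of_nat (dim V))
       (distr (density (subspace_lborel V) (indicator (cball 0 1))) borel sgn)"

definition support_function :: "'a::euclidean_space set \<Rightarrow> 'a \<Rightarrow> real" where
  "support_function C u = (SUP x\<in>C. x \<bullet> u)"

text \<open>Steiner point of \<open>C \<subseteq> H\<close> in the affine subspace \<open>H\<close>, which is identified with a Euclidean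
  space by taking a point \<open>p\<close> of \<open>H\<close> as origin. The result does not depend on \<open>p\<close>.
  When \<open>H\<close> is a point the integral vanishes and the value is that point.\<close>

definition steiner_point :: "'a::euclidean_space set \<Rightarrow> 'a set \<Rightarrow> 'a" where
  "steiner_point H C =
     (let V = direction_space H; p = (SOME p. p \<in> H)
      in p + (1 / unit_ball_vol (real (dim V))) *\<^sub>R
           (LINT u|sphere_measure V. support_function ((\<lambda>x. x - p) ` C) u *\<^sub>R u))"

end

theory Submission
  imports Defs
begin

text \<open>
  If some boundary point of \<open>K\<close> has two outer unit normals, all normals between them cut out the same
  face, which gives infinitely many hyperplanes with the same section; a constant map then works. (For
  the Steiner point one uses that it lies in the section and does not change under the reflection
  exchanging two of these hyperplanes.)

  If \<open>K\<close> is smooth, a hyperplane \<open>{x. u \<bullet> x = t}\<close> is the point \<open>(u, t)\<close> of projective space. A hyperplane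
  \<open>t \<ge> h u\<close> off the interior of \<open>K\<close>, with \<open>h\<close> the support function, goes injectively to the direction of
  \<open>(u, t - h u)\<close> in the upper half of the sphere. A hyperplane through the interior goes to the image of its
  centre under an embedding of the interior of \<open>K\<close> into the open lower half, which extends to the boundary
  of \<open>K\<close> as the Gauss map. As the hyperplane tends to a supporting one its centre tends to the face with
  normal \<open>u\<close>, so the two definitions fit together, and multiplicities occur only for hyperplanes through
  the interior with equal centres.
\<close>

section \<open>Support functions and smooth convex bodies\<close>

text \<open>Smoothness makes the Gauss map a function on the boundary. On the equator of the sphere
  the value then depends on the normal alone, so a supporting hyperplane and all points of its face
  receive the same value. Hence the gluing is continuous although the centre of a section need not
  converge as the hyperplane becomes supporting: the limiting face may have positive dimension, but
  it is collapsed to one point.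

  Hyperplanes missing \<open>K\<close> have to be kept free of multiplicities, since a multiplicity
  is useful only if all its hyperplanes meet \<open>K\<close>. The projective point of
  \<open>(0, 1)\<close>, which is no hyperplane, is treated in the same way and goes to the pole. In
  the nonsmooth case a multiplicity of the map carries no information, so the conclusion has to hold
  for each \<open>k\<close> outright; this is why infinitely many hyperplanes through one face are
  needed.

  On the analytic side the obstacle is that the measures of different sections live on different
  hyperplanes and spheres. Each integral is therefore pulled back to the whole space before a limit
  is taken.\<close>

lemma tendsto_subseq_compact:
  fixes X :: "nat \<Rightarrow> 'a::metric_space" and f :: "nat \<Rightarrow> 'b::metric_space"
  assumes S: "compact S" and X: "\<And>n. X n \<in> S"
    and lim: "\<And>r l. strict_mono r \<Longrightarrow> l \<in> S \<Longrightarrow> (X \<circ> r) \<longlonglongrightarrow> l \<Longrightarrow> (f \<circ> r) \<longlonglongrightarrow> b"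
  shows "f \<longlonglongrightarrow> b"
proof (rule ccontr)
  assume "\<not> f \<longlonglongrightarrow> b"
  then obtain e where e: "e > 0" "\<not> (\<forall>\<^sub>F n in sequentially. dist (f n) b < e)"
    by (auto simp: tendsto_iff)
  then obtain r :: "nat \<Rightarrow> nat" where r: "strict_mono r" "\<And>n. \<not> dist (f (r n)) b < e"
    using not_eventually_sequentiallyD by blast
  obtain l r' where r': "l \<in> S" "strict_mono r'" "((X \<circ> r) \<circ> r') \<longlonglongrightarrow> l"
    using S X unfolding compact_def by (metis comp_apply)
  have "(f \<circ> (r \<circ> r')) \<longlonglongrightarrow> b"
    using r' r(1) by (intro lim[of "r \<circ> r'" l]) (auto simp: comp_assoc strict_mono_o)
  then obtain n where "dist ((f \<circ> (r \<circ> r')) n) b < e"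
    using e(1) by (metis LIMSEQ_iff_nz dist_norm eventually_sequentially order_refl tendsto_iff)
  then show False using r(2) by simp
qed

text \<open>A sequence of hyperplanes may pass between the cases of a definition infinitely often.
  Equal limits of both branches suffice, whatever the pattern of \<open>P\<close>.\<close>

lemma tendsto_if:
  assumes "(f \<longlongrightarrow> l) F" "(g \<longlongrightarrow> l) F"
  shows "((\<lambda>n. if P n then f n else g n) \<longlongrightarrow> l) F"
proof (rule topological_tendstoI)
  fix S assume "open S" "l \<in> S"
  then have "\<forall>\<^sub>F n in F. f n \<in> S" "\<forall>\<^sub>F n in F. g n \<in> S"
    using assms by (auto simp: tendsto_def)
  then show "\<forall>\<^sub>F n in F. (if P n then f n else g n) \<in> S"
    by eventually_elim auto
qed

lemma
  fixes C :: "'a::euclidean_space set"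
  assumes C: "compact C" "C \<noteq> {}"
  shows support_function_attained: "\<exists>x\<in>C. support_function C u = x \<bullet> u"
    and support_function_ge: "\<And>x. x \<in> C \<Longrightarrow> x \<bullet> u \<le> support_function C u"
proof -
  have "continuous_on C (\<lambda>x. x \<bullet> u)" by (intro continuous_intros)
  then obtain x where x: "x \<in> C" "\<And>y. y \<in> C \<Longrightarrow> y \<bullet> u \<le> x \<bullet> u"
    using continuous_attains_sup[OF C] by blast
  have "support_function C u = x \<bullet> u"
    unfolding support_function_def using x by (intro cSup_eq_maximum) auto
  then show "\<exists>x\<in>C. support_function C u = x \<bullet> u" "\<And>x. x \<in> C \<Longrightarrow> x \<bullet> u \<le> support_function C u"
    using x by auto
qed

context
  fixes C :: "'a::euclidean_space set"
  assumes C: "compact C" "C \<noteq> {}"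
begin

lemma support_function_le: "(\<And>x. x \<in> C \<Longrightarrow> x \<bullet> u \<le> b) \<Longrightarrow> support_function C u \<le> b"
  using support_function_attained[OF C, of u] by auto

lemma support_function_0: "support_function C 0 = 0"
  using support_function_attained[OF C, of 0] by auto

lemma support_function_add: "support_function C (u + v) \<le> support_function C u + support_function C v"
  by (intro support_function_le) (simp add: inner_add_right add_mono support_function_ge[OF C])

lemma support_function_scale:
  assumes "c \<ge> 0" shows "support_function C (c *\<^sub>R u) = c * support_function C u"
proof (rule antisym)
  show "support_function C (c *\<^sub>R u) \<le> c * support_function C u"
    using assms by (intro support_function_le) (simp add: mult_left_mono support_function_ge[OF C])
  obtain x where "x \<in> C" "support_function C u = x \<bullet> u"
    using support_function_attained[OF C] by blast
  then show "c * support_function C u \<le> support_function C (c *\<^sub>R u)"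
    using support_function_ge[OF C, of x "c *\<^sub>R u"] by simp
qed

lemma support_function_le_norm:
  assumes "\<And>x. x \<in> C \<Longrightarrow> norm x \<le> R"
  shows "support_function C u \<le> R * norm u"
proof (rule support_function_le)
  fix x assume "x \<in> C"
  have "x \<bullet> u \<le> norm x * norm u" by (rule norm_cauchy_schwarz)
  also have "\<dots> \<le> R * norm u" using assms[OF \<open>x \<in> C\<close>] by (intro mult_right_mono) auto
  finally show "x \<bullet> u \<le> R * norm u" .
qed

text \<open>Subadditivity reduces the difference to the support function of \<open>u - v\<close>.
  Continuity, measurability and the bounds on the unit sphere rest on this estimate.\<close>

lemma support_function_lipschitz:
  assumes "\<And>x. x \<in> C \<Longrightarrow> norm x \<le> R"
  shows "\<bar>support_function C u - support_function C v\<bar> \<le> R * norm (u - v)"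
proof -
  have "support_function C a \<le> support_function C b + R * norm (a - b)" for a b
  proof -
    have "support_function C (b + (a - b)) \<le> support_function C b + support_function C (a - b)"
      by (rule support_function_add)
    then show ?thesis using support_function_le_norm[OF assms, of "a - b"] by simp
  qed
  from this[of u v] this[of v u] show ?thesis by (simp add: norm_minus_commute abs_le_iff)
qed

lemma continuous_on_support_function: "continuous_on S (support_function C)"
proof -
  obtain R where R: "R > 0" "\<And>x. x \<in> C \<Longrightarrow> norm x \<le> R"
    using C(1) compact_imp_bounded by (metis bounded_pos)
  have "R-lipschitz_on S (support_function C)"
    using R support_function_lipschitz[of R]
    by (intro lipschitz_onI) (auto simp: dist_norm)
  then show ?thesis by (rule lipschitz_on_continuous_on)
qed

lemma borel_measurable_support_function: "support_function C \<in> borel_measurable borel"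
  by (intro borel_measurable_continuous_onI continuous_on_support_function)

lemma tendsto_support_function [tendsto_intros]:
  "(f \<longlongrightarrow> l) F \<Longrightarrow> ((\<lambda>x. support_function C (f x)) \<longlongrightarrow> support_function C l) F"
  using continuous_on_support_function[of UNIV]
  by (rule continuous_on_tendsto_compose) auto

end

section \<open>Gauss map of a smooth body and its extension to the interior\<close>

definition unit_normal :: "'a::euclidean_space set \<Rightarrow> 'a \<Rightarrow> 'a \<Rightarrow> bool" where
  "unit_normal K p u \<longleftrightarrow> norm u = 1 \<and> (\<forall>y\<in>K. u \<bullet> y \<le> u \<bullet> p)"

text \<open>The polar body \<open>D\<close> of \<open>L\<close> has the gauge of \<open>L\<close> as support function \<open>\<gamma>\<close>. For smooth \<open>L\<close> the point
  \<open>N x\<close> of \<open>D\<close> in direction \<open>x\<close> is unique. The map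
  \<open>x \<mapsto> x + \<gamma> x / (1 - \<gamma> x) N x\<close> of the interior is the gradient of a strictly convex function, hence
  injective by monotonicity; in homogeneous coordinates it extends to the boundary by the Gauss map.\<close>

lemma gauss_map_extension_0:
  fixes L :: "'a::euclidean_space set"
  assumes L: "convex L" "compact L" and L0: "0 \<in> interior L"
    and smooth: "\<And>p u v. p \<in> L \<Longrightarrow> unit_normal L p u \<Longrightarrow> unit_normal L p v \<Longrightarrow> u = v"
  obtains \<Psi> :: "'a \<Rightarrow> 'a \<times> real" where "continuous_on L \<Psi>" "\<And>x. x \<in> L \<Longrightarrow> norm (\<Psi> x) = 1"
    "inj_on \<Psi> (interior L)" "\<And>x. x \<in> interior L \<Longrightarrow> snd (\<Psi> x) < 0"
    "\<And>p u. p \<in> L \<Longrightarrow> unit_normal L p u \<Longrightarrow> \<Psi> p = (u, 0)"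
proof -
  obtain \<epsilon> where \<epsilon>: "\<epsilon> > 0" "cball 0 \<epsilon> \<subseteq> L"
    using L0 by (auto simp: mem_interior_cball)
  have "bounded L" using L(2) by (rule compact_imp_bounded)
  then obtain r where r: "r > 0" "\<And>x. x \<in> L \<Longrightarrow> norm x \<le> r" by (metis bounded_pos)
  define D where "D = {n. \<forall>y\<in>L. n \<bullet> y \<le> 1}"
  \<comment> \<open>A ball of radius \<open>\<epsilon>\<close> in \<open>L\<close> confines the
    polar body to the reciprocal radius.\<close>
  define R where "R = 1 / \<epsilon>"
  have D0: "0 \<in> D" by (simp add: D_def)
  have DR: "norm n \<le> R" if "n \<in> D" for n
  proof (cases "n = 0")
    case False
    have "(\<epsilon> / norm n) *\<^sub>R n \<in> L" using \<epsilon> False by (intro set_mp[OF \<epsilon>(2)]) auto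
    then have "n \<bullet> ((\<epsilon> / norm n) *\<^sub>R n) \<le> 1" using that unfolding D_def by blast
    then have "\<epsilon> * norm n \<le> 1" using False by (simp add: dot_square_norm power2_eq_square)
    then show ?thesis using \<epsilon>(1) by (simp add: R_def field_simps)
  qed (use \<epsilon> R_def in simp)
  have "closed D"
  proof -
    have "D = (\<Inter>y\<in>L. {n. y \<bullet> n \<le> 1})" by (auto simp: D_def inner_commute)
    then show ?thesis by (auto intro!: closed_INT closed_halfspace_le)
  qed
  moreover have "bounded D" using DR by (auto simp: bounded_iff)
  ultimately have D: "compact D" "D \<noteq> {}" using D0 by (auto simp: compact_eq_bounded_closed)
  define \<gamma> where "\<gamma> = support_function D"
  define N where "N x = (SOME n. n \<in> D \<and> \<gamma> x = n \<bullet> x)" for x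
  have N: "N x \<in> D" "N x \<bullet> x = \<gamma> x" for x
  proof -
    have "\<exists>n. n \<in> D \<and> \<gamma> x = n \<bullet> x"
      using support_function_attained[OF D, of x] unfolding \<gamma>_def by blast
    then have "N x \<in> D \<and> \<gamma> x = N x \<bullet> x" unfolding N_def by (rule someI_ex)
    then show "N x \<in> D" "N x \<bullet> x = \<gamma> x" by auto
  qed
  have \<gamma>_ge: "n \<bullet> x \<le> \<gamma> x" if "n \<in> D" for n x
    using support_function_ge[OF D that] by (simp add: \<gamma>_def)
  have \<gamma>0: "0 \<le> \<gamma> x" for x using \<gamma>_ge[OF D0, of x] by simp
  have \<gamma>_scale: "\<gamma> (c *\<^sub>R x) = c * \<gamma> x" if "c \<ge> 0" for c x
    using support_function_scale[OF D that] by (simp add: \<gamma>_def)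
  have \<gamma>_L: "\<gamma> x \<le> 1" if "x \<in> L" for x
    using N(1)[of x] N(2)[of x, symmetric] that by (simp add: D_def)
  have L_\<gamma>: "x \<in> L" if "\<gamma> x \<le> 1" for x
  proof (rule ccontr)
    assume "x \<notin> L"
    then obtain a b where ab: "a \<bullet> x < b" "\<And>y. y \<in> L \<Longrightarrow> b < a \<bullet> y"
      using separating_hyperplane_closed_point[of L x] L by (auto simp: compact_imp_closed)
    \<comment> \<open>As \<open>b\<close> is negative, dividing by it reverses the separation:
      \<open>a\<close> divided by \<open>b\<close> is in the polar body and exceeds 1 at
      \<open>x\<close>.\<close>
    have b: "b < 0" using ab(2)[of 0] L0 interior_subset by auto
    have "a /\<^sub>R b \<in> D"
      using ab(2) b by (auto simp: D_def field_simps less_imp_le)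
    then have "(a /\<^sub>R b) \<bullet> x \<le> 1" using \<gamma>_ge[of "a /\<^sub>R b" x] that by simp
    then show False using ab(1) b by (simp add: field_simps)
  qed
  have \<gamma>_int: "\<gamma> x < 1" if "x \<in> interior L" for x
  proof (cases "x = 0")
    case True then show ?thesis using \<gamma>_scale[of 0 0] by simp
  next
    case False
    \<comment> \<open>Room around \<open>x\<close> allows stretching \<open>x\<close> by a factor
      above 1 inside \<open>L\<close>, and \<open>\<gamma>\<close> is stretched by the same
      factor.\<close>
    obtain e where e: "e > 0" "cball x e \<subseteq> L"
      using \<open>x \<in> interior L\<close> unfolding mem_interior_cball by blast
    have "(1 + e / norm x) *\<^sub>R x \<in> L"
      using e False by (intro set_mp[OF e(2)]) (auto simp: dist_norm algebra_simps)
    then have "\<gamma> ((1 + e / norm x) *\<^sub>R x) \<le> 1" by (rule \<gamma>_L)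
    moreover have "0 \<le> 1 + e / norm x" using e(1) by simp
    ultimately have "(1 + e / norm x) * \<gamma> x \<le> 1" by (simp only: \<gamma>_scale)
    moreover have "e / norm x > 0" using e False by simp
    ultimately show ?thesis using \<gamma>0[of x]
      by (smt (verit) mult_less_cancel_right2 mult_cancel_left1 mult_le_cancel_right1)
  qed
  have \<gamma>_pos: "\<gamma> x > 0" if "x \<noteq> 0" for x
  proof -
    \<comment> \<open>\<open>r\<close> bounds \<open>L\<close>, so by Cauchy-Schwarz this multiple
      of \<open>x\<close> belongs to the polar body, and its inner product with \<open>x\<close> is
      positive.\<close>
    define \<delta> where "\<delta> = 1 / (norm x * r)"
    have \<delta>: "\<delta> > 0" using that r by (simp add: \<delta>_def)
    have "\<delta> *\<^sub>R x \<in> D"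
      unfolding D_def
    proof (intro CollectI ballI)
      fix y assume "y \<in> L"
      have "x \<bullet> y \<le> norm x * norm y" by (rule norm_cauchy_schwarz)
      also have "\<dots> \<le> norm x * r" using r \<open>y \<in> L\<close> by (intro mult_left_mono) auto
      finally show "(\<delta> *\<^sub>R x) \<bullet> y \<le> 1" using that r by (simp add: \<delta>_def field_simps)
    qed
    from \<gamma>_ge[OF this, of x] show ?thesis using \<delta> that
      by (metis inner_gt_zero_iff inner_scaleR_left less_le_trans mult_pos_pos)
  qed
  have normal: "unit_normal L p (n /\<^sub>R norm n)" if "n \<in> D" "n \<bullet> p = 1" for n p
    unfolding unit_normal_def
  proof (intro conjI ballI)
    have n: "n \<noteq> 0" using that by auto
    then show "norm (n /\<^sub>R norm n) = 1" by simp
    fix y assume "y \<in> L"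
    then have "n \<bullet> y \<le> n \<bullet> p" using that by (auto simp: D_def)
    then show "(n /\<^sub>R norm n) \<bullet> y \<le> (n /\<^sub>R norm n) \<bullet> p" by (simp add: mult_left_mono)
  qed
  have N_unique: "n = N x" if x: "x \<noteq> 0" and n: "n \<in> D" "n \<bullet> x = \<gamma> x" for n x
  proof -
    \<comment> \<open>At the boundary point \<open>p\<close> on the ray of \<open>x\<close>, both
      \<open>n\<close> and \<open>N x\<close> are normals taking the value 1. Smoothness gives equal
      directions, and the common value 1 gives equal lengths.\<close>
    define p where "p = x /\<^sub>R \<gamma> x"
    have pos: "\<gamma> x > 0" using \<gamma>_pos x by simp
    have "\<gamma> p = 1" using \<gamma>_scale[of "inverse (\<gamma> x)" x] pos by (simp add: p_def)
    then have pL: "p \<in> L" using L_\<gamma> by simp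
    have 1: "n \<bullet> p = 1" "N x \<bullet> p = 1" using n N[of x] pos by (simp_all add: p_def)
    have eq: "n /\<^sub>R norm n = N x /\<^sub>R norm (N x)"
      using smooth[OF pL normal[OF n(1) 1(1)] normal[OF N(1) 1(2)]] .
    have "inverse (norm n) = (n /\<^sub>R norm n) \<bullet> p" using 1 by simp
    also have "\<dots> = inverse (norm (N x))" unfolding eq using 1 by simp
    finally have "norm n = norm (N x)" by simp
    moreover have "norm (N x) \<noteq> 0" using 1 by auto
    ultimately show ?thesis using eq by auto
  qed
  have cont\<gamma>: "continuous_on S \<gamma>" for S
    unfolding \<gamma>_def by (rule continuous_on_support_function[OF D])
  \<comment> \<open>The choice of \<open>N 0\<close> is arbitrary, which \<open>\<gamma>\<close>
    compensates by vanishing at 0. At \<open>a \<noteq> 0\<close> a limit point of the values of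
    \<open>N\<close> attains \<open>\<gamma> a\<close>, hence is \<open>N a\<close> by
    uniqueness.\<close>
  have contN: "continuous_on UNIV (\<lambda>x. \<gamma> x *\<^sub>R N x)"
    unfolding continuous_on_sequentially
  proof (intro allI ballI impI)
    fix x :: "nat \<Rightarrow> 'a" and a :: 'a
    assume "(\<forall>n. x n \<in> UNIV) \<and> x \<longlonglongrightarrow> a"
    then have xa: "x \<longlonglongrightarrow> a" by simp
    then have \<gamma>a: "(\<lambda>n. \<gamma> (x n)) \<longlonglongrightarrow> \<gamma> a"
      unfolding \<gamma>_def by (rule tendsto_support_function[OF D])
    show "((\<lambda>x. \<gamma> x *\<^sub>R N x) \<circ> x) \<longlonglongrightarrow> \<gamma> a *\<^sub>R N a"
    proof (cases "a = 0")
      case True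
      then have "\<gamma> a = 0" using \<gamma>_scale[of 0 0] by simp
      moreover have "(\<lambda>n. \<gamma> (x n) *\<^sub>R N (x n)) \<longlonglongrightarrow> 0"
      proof (rule Lim_null_comparison)
        show "\<forall>\<^sub>F n in sequentially. norm (\<gamma> (x n) *\<^sub>R N (x n)) \<le> \<gamma> (x n) * R"
          using DR N \<gamma>0 by (auto intro!: always_eventually mult_left_mono)
        show "(\<lambda>n. \<gamma> (x n) * R) \<longlonglongrightarrow> 0"
          using tendsto_mult_right[OF \<gamma>a, of R] \<open>\<gamma> a = 0\<close> by simp
      qed
      ultimately show ?thesis by (simp add: comp_def)
    next
      case False
      have "(\<lambda>n. N (x n)) \<longlonglongrightarrow> N a"
      proof (rule tendsto_subseq_compact[OF D(1)])
        show "N (x n) \<in> D" for n by (rule N)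
        fix r :: "nat \<Rightarrow> nat" and l assume r: "strict_mono r" "l \<in> D" "((\<lambda>n. N (x n)) \<circ> r) \<longlonglongrightarrow> l"
        have "(\<lambda>n. N (x (r n)) \<bullet> x (r n)) \<longlonglongrightarrow> l \<bullet> a"
          using r(3) LIMSEQ_subseq_LIMSEQ[OF xa r(1)] by (auto simp: comp_def intro: tendsto_intros)
        moreover have "(\<lambda>n. N (x (r n)) \<bullet> x (r n)) \<longlonglongrightarrow> \<gamma> a"
          using LIMSEQ_subseq_LIMSEQ[OF \<gamma>a r(1)] by (simp add: N comp_def)
        ultimately have "l \<bullet> a = \<gamma> a" by (rule LIMSEQ_unique)
        then have "l = N a" using N_unique[OF False r(2)] by simp
        then show "((\<lambda>n. N (x n)) \<circ> r) \<longlonglongrightarrow> N a" using r(3) by simp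
      qed
      then show ?thesis using \<gamma>a by (auto simp: comp_def intro: tendsto_intros)
    qed
  qed
  \<comment> \<open>The point \<open>x + \<gamma> x / (1 - \<gamma> x) N x\<close> at height -1,
    multiplied by \<open>1 - \<gamma> x\<close>. This removes the pole at the boundary, where only
    \<open>N x\<close>, a multiple of the normal, is left at height 0.\<close>
  define P where "P x = ((1 - \<gamma> x) *\<^sub>R x + \<gamma> x *\<^sub>R N x, \<gamma> x - 1)" for x
  have P0: "P x \<noteq> 0" if "x \<in> L" for x
  proof (cases "\<gamma> x = 1")
    case True
    then have "N x \<noteq> 0" using N(2)[of x] by auto
    then show ?thesis using True by (simp add: P_def zero_prod_def)
  qed (simp add: P_def zero_prod_def)
  show ?thesis
  proof (rule that[of "\<lambda>x. sgn (P x)"])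
    show "continuous_on L (\<lambda>x. sgn (P x))"
    proof (rule continuous_on_sgn)
      have "continuous_on L (\<lambda>x. \<gamma> x *\<^sub>R N x)" using contN by (rule continuous_on_subset) simp
      moreover have "continuous_on L (\<lambda>x. (1 - \<gamma> x) *\<^sub>R x)" "continuous_on L (\<lambda>x. \<gamma> x - 1)"
        by (intro continuous_intros cont\<gamma>)+
      ultimately show "continuous_on L P"
        unfolding P_def by (intro continuous_on_Pair continuous_on_add)
    qed (use P0 in blast)
    show "norm (sgn (P x)) = 1" if "x \<in> L" for x
      using P0[OF that] by (simp add: norm_sgn)
    show "snd (sgn (P x)) < 0" if "x \<in> interior L" for x
      using \<gamma>_int[OF that] P0[of x] that interior_subset
      by (auto simp: sgn_div_norm P_def snd_scaleR mult_less_0_iff)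
    show "sgn (P p) = (u, 0)" if p: "p \<in> L" "unit_normal L p u" for p u
    proof -
      have u: "norm u = 1" "\<And>y. y \<in> L \<Longrightarrow> u \<bullet> y \<le> u \<bullet> p" using p by (auto simp: unit_normal_def)
      have "\<epsilon> *\<^sub>R u \<in> L" using u \<epsilon> by (intro set_mp[OF \<epsilon>(2)]) auto
      then have "\<epsilon> \<le> u \<bullet> p" using u by (metis dot_square_norm inner_scaleR_right mult.right_neutral one_power2)
      then have pos: "u \<bullet> p > 0" using \<epsilon> by simp
      \<comment> \<open>Divided by its positive value at \<open>p\<close>, the normal becomes the
        point of the polar body at which \<open>\<gamma> p\<close> is attained.\<close>
      have n: "u /\<^sub>R (u \<bullet> p) \<in> D" "(u /\<^sub>R (u \<bullet> p)) \<bullet> p = 1"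
        using u pos by (auto simp: D_def field_simps)
      have \<gamma>p: "\<gamma> p = 1" using \<gamma>_ge[OF n(1), of p] n(2) \<gamma>_L[OF p(1)] by simp
      have "p \<noteq> 0" using pos by auto
      then have "u /\<^sub>R (u \<bullet> p) = N p" using N_unique n \<gamma>p by simp
      then have "P p = (u /\<^sub>R (u \<bullet> p), 0)" using \<gamma>p by (simp add: P_def)
      then show ?thesis using u pos by (simp add: sgn_div_norm norm_prod_def)
    qed
    show "inj_on (\<lambda>x. sgn (P x)) (interior L)"
    proof (rule inj_onI)
      fix x y assume xy: "x \<in> interior L" "y \<in> interior L" "sgn (P x) = sgn (P y)"
      \<comment> \<open>Equal directions mean proportional vectors. Comparing heights identifies
        \<open>c\<close>, so the points before rescaling agree.\<close>
      define c where "c = norm (P x) / norm (P y)"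
      have "P x = norm (P x) *\<^sub>R sgn (P x)" by (cases "P x = 0") (simp_all add: sgn_div_norm)
      also have "\<dots> = c *\<^sub>R P y" unfolding xy(3) by (simp add: c_def sgn_div_norm divide_inverse)
      finally have Pc: "P x = c *\<^sub>R P y" .
      define a where "a z = \<gamma> z / (1 - \<gamma> z)" for z
      have g1: "1 - \<gamma> x > 0" "1 - \<gamma> y > 0" using \<gamma>_int xy by auto
      have fst_P: "fst (P z) = (1 - \<gamma> z) *\<^sub>R (z + a z *\<^sub>R N z)" if "1 - \<gamma> z > 0" for z
      proof -
        have "(1 - \<gamma> z) * a z = \<gamma> z" using that by (simp add: a_def)
        then show ?thesis by (simp add: P_def scaleR_add_right)
      qed
      have s: "1 - \<gamma> x = c * (1 - \<gamma> y)" using arg_cong[OF Pc, of snd] by (simp add: P_def algebra_simps)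
      have "(1 - \<gamma> x) *\<^sub>R (x + a x *\<^sub>R N x) = (1 - \<gamma> x) *\<^sub>R (y + a y *\<^sub>R N y)"
        using arg_cong[OF Pc, of fst] fst_P g1 s by simp
      then have G: "x + a x *\<^sub>R N x = y + a y *\<^sub>R N y" using g1 by simp
      have a0: "a x \<ge> 0" "a y \<ge> 0" using g1 \<gamma>0 by (auto simp: a_def)
      \<comment> \<open>\<open>s / (1 - s)\<close> increases for \<open>s < 1\<close>, so
        \<open>a\<close> is an increasing function of \<open>\<gamma>\<close>.\<close>
      have mono: "(a x - a y) * (\<gamma> x - \<gamma> y) \<ge> 0"
      proof -
        have "a z \<le> a w" if "\<gamma> z \<le> \<gamma> w" "1 - \<gamma> w > 0" for z w
          using that \<gamma>0[of z] by (auto simp: a_def intro!: frac_le)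
        then show ?thesis using g1 by (metis diff_ge_0_iff_ge linorder_le_cases mult_nonneg_nonneg mult_nonpos_nonpos diff_le_0_iff_le)
      qed
      \<comment> \<open>Each \<open>N z\<close> is a subgradient of \<open>\<gamma>\<close> at
        \<open>z\<close>. Weighting the two subgradient inequalities by \<open>a\<close> gives
        monotonicity of the field, whereas \<open>G\<close> turns its increment into
        \<open>y - x\<close>.\<close>
      have "0 \<le> (a x - a y) * (\<gamma> x - \<gamma> y)" by (rule mono)
      also have "\<dots> = a x * (\<gamma> x - \<gamma> y) + a y * (\<gamma> y - \<gamma> x)" by (simp add: algebra_simps)
      also have "\<dots> \<le> a x * (\<gamma> x - N x \<bullet> y) + a y * (\<gamma> y - N y \<bullet> x)"
        using a0 \<gamma>_ge[OF N(1)] by (intro add_mono mult_left_mono) auto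
      also have "\<dots> = (a x *\<^sub>R N x - a y *\<^sub>R N y) \<bullet> (x - y)"
        using N(2) by (simp add: inner_diff_left inner_diff_right algebra_simps)
      also have "a x *\<^sub>R N x - a y *\<^sub>R N y = y - x" using G by (simp add: algebra_simps)
      finally have "(x - y) \<bullet> (x - y) \<le> 0"
        by (simp add: inner_diff_left inner_diff_right algebra_simps)
      then show "x = y" by (metis inner_ge_zero inner_eq_zero_iff order_antisym right_minus_eq)
    qed
  qed
qed

lemma gauss_map_extension:
  fixes K :: "'a::euclidean_space set"
  assumes K: "convex_body K"
    and smooth: "\<And>p u v. p \<in> K \<Longrightarrow> unit_normal K p u \<Longrightarrow> unit_normal K p v \<Longrightarrow> u = v"
  obtains \<Psi> :: "'a \<Rightarrow> 'a \<times> real" where "continuous_on K \<Psi>" "\<And>x. x \<in> K \<Longrightarrow> norm (\<Psi> x) = 1"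
    "inj_on \<Psi> (interior K)" "\<And>x. x \<in> interior K \<Longrightarrow> snd (\<Psi> x) < 0"
    "\<And>p u. p \<in> K \<Longrightarrow> unit_normal K p u \<Longrightarrow> \<Psi> p = (u, 0)"
proof -
  obtain a where a: "a \<in> interior K" using K by (auto simp: convex_body_def)
  define L where "L = (\<lambda>x. x - a) ` K"
  have iL: "interior L = (\<lambda>x. x - a) ` interior K"
    unfolding L_def by (rule interior_translation_subtract)
  have un: "unit_normal L (p - a) u \<longleftrightarrow> unit_normal K p u" for p u
    by (auto simp: unit_normal_def L_def inner_diff_right)
  have "convex L" "compact L"
    using K by (auto simp: L_def convex_body_def convex_translation_subtract compact_translation_subtract)
  moreover have "0 \<in> interior L" using a by (auto simp: iL image_iff)
  moreover have "u = v" if "p \<in> L" "unit_normal L p u" "unit_normal L p v" for p u v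
    using that smooth un by (auto simp: L_def)
  ultimately obtain \<Psi> :: "'a \<Rightarrow> 'a \<times> real" where \<Psi>: "continuous_on L \<Psi>" "\<And>x. x \<in> L \<Longrightarrow> norm (\<Psi> x) = 1"
    "inj_on \<Psi> (interior L)" "\<And>x. x \<in> interior L \<Longrightarrow> snd (\<Psi> x) < 0"
    "\<And>p u. p \<in> L \<Longrightarrow> unit_normal L p u \<Longrightarrow> \<Psi> p = (u, 0)"
    by (rule gauss_map_extension_0) blast+
  show ?thesis
  proof (rule that[of "\<lambda>x. \<Psi> (x - a)"])
    show "continuous_on K (\<lambda>x. \<Psi> (x - a))"
      by (rule continuous_on_compose2[OF \<Psi>(1)]) (auto simp: L_def intro: continuous_intros)
    show "inj_on (\<lambda>x. \<Psi> (x - a)) (interior K)"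
      using \<Psi>(3) by (auto simp: inj_on_def iL)
    show "snd (\<Psi> (x - a)) < 0" if "x \<in> interior K" for x
      using that by (intro \<Psi>) (auto simp: iL)
    show "norm (\<Psi> (x - a)) = 1" if "x \<in> K" for x
      using that by (intro \<Psi>) (auto simp: L_def)
    show "\<Psi> (p - a) = (u, 0)" if "p \<in> K" "unit_normal K p u" for p u
      using that by (intro \<Psi>) (auto simp: L_def un[unfolded L_def])
  qed
qed

section \<open>Maps from projective space to the sphere\<close>

lemma parallel_hyperplane_eq:
  fixes u v :: "'a::euclidean_space"
  assumes u: "u \<noteq> 0" and v: "v \<noteq> 0" and eq: "{x. u \<bullet> x = s} = {x. v \<bullet> x = t}"
  obtains c where "c \<noteq> 0" "v = c *\<^sub>R u" "t = c * s"
proof -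
  define x0 where "x0 = (s / (u \<bullet> u)) *\<^sub>R u"
  have x0: "u \<bullet> x0 = s" "v \<bullet> x0 = t"
  proof -
    show "u \<bullet> x0 = s" using u by (simp add: x0_def)
    then show "v \<bullet> x0 = t" using eq by blast
  qed
  define c where "c = (u \<bullet> v) / (u \<bullet> u)"
  \<comment> \<open>Moving the foot \<open>x0\<close> by the part of \<open>v\<close> orthogonal to
    \<open>u\<close> stays in the hyperplane, which forces this part to vanish.\<close>
  define d where "d = v - c *\<^sub>R u"
  have ud: "u \<bullet> d = 0" using u by (simp add: d_def c_def inner_diff_right)
  then have "u \<bullet> (x0 + d) = s" using x0 by (simp add: inner_add_right)
  then have "v \<bullet> (x0 + d) = t" using eq by blast
  then have "v \<bullet> d = 0" using x0 by (simp add: inner_add_right)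
  then have "d \<bullet> d = 0" using ud by (simp add: d_def inner_diff_left)
  then have vc: "v = c *\<^sub>R u" by (simp add: d_def)
  moreover have "t = c * s" using x0 vc by auto
  moreover have "c \<noteq> 0" using v vc by auto
  ultimately show ?thesis using that by blast
qed

text \<open>The interior is dense in the convex set, so the two points may be taken in it; being
  connected, it then meets the hyperplane between them.\<close>

lemma hyperplane_meets_interior:
  fixes K :: "'a::euclidean_space set"
  assumes K: "convex K" "interior K \<noteq> {}" and x: "x \<in> K" "u \<bullet> x < t" and y: "y \<in> K" "t < u \<bullet> y"
  shows "{x. u \<bullet> x = t} \<inter> interior K \<noteq> {}"
proof -
  have cl: "K \<subseteq> closure (interior K)"
    using convex_closure_interior[OF K] closure_subset by auto
  have "{z. u \<bullet> z < t} \<inter> closure (interior K) \<noteq> {}" "{z. u \<bullet> z > t} \<inter> closure (interior K) \<noteq> {}"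
    using cl x y by auto
  then have "{z. u \<bullet> z < t} \<inter> interior K \<noteq> {}" "{z. u \<bullet> z > t} \<inter> interior K \<noteq> {}"
    by (simp_all add: open_Int_closure_eq_empty open_halfspace_lt open_halfspace_gt)
  then obtain x' y' where "x' \<in> interior K" "u \<bullet> x' < t" "y' \<in> interior K" "u \<bullet> y' > t" by auto
  moreover have "connected (interior K)" using K by (intro convex_connected convex_interior)
  ultimately obtain z where "z \<in> interior K" "u \<bullet> z = t"
    using connected_ivt_hyperplane[of "interior K" x' y' u t] by (auto simp: less_imp_le)
  then show ?thesis by auto
qed

lemma not_constant_on_interior:
  fixes K :: "'a::euclidean_space set"
  assumes z: "z \<in> interior K" and u: "u \<noteq> 0"
  obtains y where "y \<in> K" "u \<bullet> y > u \<bullet> z"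
proof -
  obtain e where e: "e > 0" "cball z e \<subseteq> K" using z by (auto simp: mem_interior_cball)
  have "z + (e / norm u) *\<^sub>R u \<in> K" using e u by (intro set_mp[OF e(2)]) (auto simp: dist_norm)
  moreover have "u \<bullet> (z + (e / norm u) *\<^sub>R u) > u \<bullet> z" using e u by (simp add: inner_add_right)
  ultimately show ?thesis using that by blast
qed

text \<open>A proper convex combination of two functionals that are both maximal over
  \<open>K\<close> at \<open>p\<close> is maximal only where both are, so the section does not
  depend on the weights.\<close>

lemma pencil_same_section:
  fixes K :: "'a::euclidean_space set"
  assumes K: "convex_body K" and p: "p \<in> K"
    and u: "unit_normal K p u" and v: "unit_normal K p v" and uv: "u \<noteq> v"
  obtains w :: "nat \<Rightarrow> 'a" where
    "inj (\<lambda>i. {x. w i \<bullet> x = w i \<bullet> p})" "\<And>i. norm (w i) = 1"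
    "\<And>i. K \<inter> {x. w i \<bullet> x = w i \<bullet> p} = {x\<in>K. u \<bullet> x = u \<bullet> p \<and> v \<bullet> x = v \<bullet> p}"
proof -
  obtain z where z: "z \<in> interior K" using K by (auto simp: convex_body_def)
  have nu: "norm u = 1" "norm v = 1" using u v by (auto simp: unit_normal_def)
  have le: "u \<bullet> y \<le> u \<bullet> p" "v \<bullet> y \<le> v \<bullet> p" if "y \<in> K" for y
    using u v that by (auto simp: unit_normal_def)
  have less: "u \<bullet> z < u \<bullet> p" "v \<bullet> z < v \<bullet> p"
    using not_constant_on_interior[OF z, of u] not_constant_on_interior[OF z, of v] nu le
    by (metis norm_zero order.strict_trans2 zero_neq_one)+
  \<comment> \<open>Distinct weights strictly between 0 and 1; the shift by 2 avoids the weight 1 at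
    \<open>i = 0\<close>.\<close>
  define l where "l i = 1 / (real i + 2)" for i
  have l: "0 < l i" "l i < 1" for i by (auto simp: l_def)
  define w0 where "w0 i = (1 - l i) *\<^sub>R u + l i *\<^sub>R v" for i
  have w0z: "w0 i \<bullet> z < w0 i \<bullet> p" for i
    unfolding w0_def inner_add_left inner_scaleR_left
    using less l by (intro add_strict_mono mult_strict_left_mono) auto
  then have w00: "w0 i \<noteq> 0" for i by (metis inner_zero_left less_irrefl)
  define w where "w i = sgn (w0 i)" for i
  have weq: "{x. w i \<bullet> x = w i \<bullet> p} = {x. w0 i \<bullet> x = w0 i \<bullet> p}" for i
    using w00[of i] by (auto simp: w_def sgn_div_norm)
  \<comment> \<open>Dependent unit vectors agree up to sign. Opposite normals at \<open>p\<close>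
    would confine \<open>K\<close> to a hyperplane, against the interior point
    \<open>z\<close>.\<close>
  have indep: "a = 0 \<and> b = 0" if "a *\<^sub>R u = b *\<^sub>R v" for a b
  proof (rule ccontr)
    assume ne: "\<not> (a = 0 \<and> b = 0)"
    have "\<bar>a\<bar> = \<bar>b\<bar>" using arg_cong[OF that, of norm] nu by simp
    then have "a = b \<or> a = - b" by (simp add: abs_eq_iff)
    then have "u = v \<or> u = - v"
    proof
      assume "a = b" then show ?thesis using that ne by simp
    next
      assume ab: "a = - b"
      then have "b *\<^sub>R (u + v) = 0"
        using that by (simp add: scaleR_add_right) (metis add.right_inverse)
      then show ?thesis using ne ab by (simp add: eq_neg_iff_add_eq_0)
    qed
    then have "u = - v" using uv by simp
    then show False using less by simp
  qed
  show ?thesis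
  proof (rule that[of w])
    show "norm (w i) = 1" for i using w00 by (simp add: w_def norm_sgn)
    show "K \<inter> {x. w i \<bullet> x = w i \<bullet> p} = {x\<in>K. u \<bullet> x = u \<bullet> p \<and> v \<bullet> x = v \<bullet> p}" for i
    proof -
      have "w0 i \<bullet> x = w0 i \<bullet> p \<longleftrightarrow> u \<bullet> x = u \<bullet> p \<and> v \<bullet> x = v \<bullet> p" if "x \<in> K" for x
      proof -
        have "w0 i \<bullet> p - w0 i \<bullet> x = (1 - l i) * (u \<bullet> p - u \<bullet> x) + l i * (v \<bullet> p - v \<bullet> x)"
          by (simp add: w0_def inner_add_left algebra_simps)
        moreover have "(1 - l i) * (u \<bullet> p - u \<bullet> x) \<ge> 0" "l i * (v \<bullet> p - v \<bullet> x) \<ge> 0"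
          using l[of i] le[OF that] by auto
        ultimately have "w0 i \<bullet> x = w0 i \<bullet> p \<longleftrightarrow> (1 - l i) * (u \<bullet> p - u \<bullet> x) = 0 \<and> l i * (v \<bullet> p - v \<bullet> x) = 0"
          by linarith
        then show ?thesis using l[of i] by auto
      qed
      then show ?thesis unfolding weq by blast
    qed
    show "inj (\<lambda>i. {x. w i \<bullet> x = w i \<bullet> p})"
    proof (rule injI)
      fix i j assume "{x. w i \<bullet> x = w i \<bullet> p} = {x. w j \<bullet> x = w j \<bullet> p}"
      then have "{x. w0 i \<bullet> x = w0 i \<bullet> p} = {x. w0 j \<bullet> x = w0 j \<bullet> p}" by (simp add: weq)
      then obtain c where c: "w0 j = c *\<^sub>R w0 i"
        using parallel_hyperplane_eq[OF w00 w00] by metis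
      then have "(1 - l j - c * (1 - l i)) *\<^sub>R u = (c * l i - l j) *\<^sub>R v"
        by (simp add: w0_def algebra_simps)
      from indep[OF this] have "l j = c * l i" "1 - l j = c * (1 - l i)" by auto
      \<comment> \<open>In each combination the weights sum to 1, so adding the two equations gives
        \<open>c = 1\<close>.\<close>
      then have "c = 1" by (simp add: algebra_simps)
      then have "l i = l j" using \<open>l j = c * l i\<close> by simp
      then show "i = j" by (simp add: l_def)
    qed
  qed
qed

text \<open>The conditions on \<open>c\<close> are what the two kinds of centre have in common: a
  value inside the section and continuity, both at hyperplanes through the interior only.\<close>

lemma exists_projective_map_smooth:
  fixes K :: "'a::euclidean_space set"
  assumes K: "convex_body K"
    and smooth: "\<And>p u v. p \<in> K \<Longrightarrow> unit_normal K p u \<Longrightarrow> unit_normal K p v \<Longrightarrow> u = v"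
    and c_mem: "\<And>u t. u \<noteq> 0 \<Longrightarrow> {x. u \<bullet> x = t} \<inter> interior K \<noteq> {} \<Longrightarrow>
      c {x. u \<bullet> x = t} \<in> {x. u \<bullet> x = t} \<inter> interior K"
    and c_cont: "\<And>u t un tn. u \<noteq> 0 \<Longrightarrow> {x. u \<bullet> x = t} \<inter> interior K \<noteq> {} \<Longrightarrow> un \<longlonglongrightarrow> u \<Longrightarrow> tn \<longlonglongrightarrow> t \<Longrightarrow>
      (\<lambda>n. c {x. un n \<bullet> x = tn n}) \<longlonglongrightarrow> c {x. u \<bullet> x = t}"
  shows "\<exists>f :: ('a \<times> real) set \<Rightarrow> 'a \<times> real.
        continuous_map real_projective_space (top_of_set (sphere 0 1)) f \<and>
        (\<forall>k::nat. k \<ge> 2 \<longrightarrow> admits_multiplicity real_projective_space f k \<longrightarrow>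
          (\<exists>H :: nat \<Rightarrow> 'a set.
             inj_on H {1..k} \<and>
             (\<forall>i\<in>{1..k}. affine_hyperplane (H i) \<and> H i \<inter> K \<noteq> {}) \<and>
             (\<forall>i\<in>{1..k}. \<forall>j\<in>{1..k}. c (H i) = c (H j))))"
proof -
  have Kc: "convex K" and Kcomp: "compact K" and Kint: "interior K \<noteq> {}" and Kne: "K \<noteq> {}"
    using K interior_subset by (auto simp: convex_body_def)
  obtain \<Psi> :: "'a \<Rightarrow> 'a \<times> real" where \<Psi>: "continuous_on K \<Psi>" "\<And>x. x \<in> K \<Longrightarrow> norm (\<Psi> x) = 1"
    "inj_on \<Psi> (interior K)" "\<And>x. x \<in> interior K \<Longrightarrow> snd (\<Psi> x) < 0"
    "\<And>p u. p \<in> K \<Longrightarrow> unit_normal K p u \<Longrightarrow> \<Psi> p = (u, 0)"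
    using K smooth by (rule gauss_map_extension) blast+
  define h where "h = support_function K"
  have h_ge: "u \<bullet> x \<le> h u" if "x \<in> K" for u x
    using support_function_ge[OF Kcomp Kne that, of u] by (simp add: h_def inner_commute)
  have h_att: "\<exists>x\<in>K. h u = u \<bullet> x" for u
    using support_function_attained[OF Kcomp Kne, of u] by (simp add: h_def inner_commute)
  have h0: "h 0 = 0" using support_function_0[OF Kcomp Kne] by (simp add: h_def)
  have h_scale: "h (a *\<^sub>R u) = a * h u" if "a \<ge> 0" for a u
    using support_function_scale[OF Kcomp Kne that] by (simp add: h_def)
  have h_lim: "(\<lambda>n. h (f n)) \<longlonglongrightarrow> h l" if "f \<longlonglongrightarrow> l" for f :: "nat \<Rightarrow> 'a" and l
    unfolding h_def using that by (rule tendsto_support_function[OF Kcomp Kne])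
  \<comment> \<open>The width of \<open>K\<close> is positive in each direction, so \<open>K\<close>
    is not contained in both closed half-spaces of a hyperplane.\<close>
  have width: "h u + h (- u) > 0" if "u \<noteq> 0" for u
  proof -
    obtain z where z: "z \<in> interior K" using Kint by auto
    obtain y where "y \<in> K" "u \<bullet> y > u \<bullet> z" using not_constant_on_interior[OF z \<open>u \<noteq> 0\<close>] .
    moreover have "- u \<bullet> z \<le> h (- u)" using z interior_subset by (intro h_ge) auto
    ultimately show ?thesis using h_ge[of y u] by simp
  qed
  define S where "S = sphere (0::'a \<times> real) 1"
  \<comment> \<open>The half-space below the hyperplane contains \<open>K\<close>. Since
    \<open>h 0 = 0\<close>, the pole \<open>(0, 1)\<close> belongs to \<open>A\<close> as
    well.\<close>
  define A where "A = {z :: 'a \<times> real. h (fst z) \<le> snd z}"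
  define g1 where "g1 z = sgn (fst z, snd z - h (fst z))" for z :: "'a \<times> real"
  define H where "H z = {x. fst z \<bullet> x = snd z}" for z :: "'a \<times> real"
  \<comment> \<open>On the sphere at most one of \<open>z\<close> and \<open>- z\<close> is in
    \<open>A\<close>. Choosing that representative makes \<open>g\<close> even there, and
    \<open>H\<close> does not see the sign.\<close>
  define g where "g z = (if z \<in> A then g1 z else if - z \<in> A then g1 (- z) else \<Psi> (c (H z)))" for z
  have H_minus: "H (- z) = H z" for z by (auto simp: H_def)
  have S0: "z \<noteq> 0" if "z \<in> S" for z using that by (auto simp: S_def)
  have S_minus: "- z \<in> S \<longleftrightarrow> z \<in> S" for z by (simp add: S_def)
  have A_excl: "- z \<notin> A" if "z \<in> A" "z \<in> S" for z
  proof
    assume "- z \<in> A"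
    then have le: "h (fst z) \<le> snd z" "h (- fst z) \<le> - snd z" using that by (auto simp: A_def)
    then have "fst z = 0" using width[of "fst z"] by force
    moreover from this have "snd z = 0" using le h0 by simp
    ultimately show False using S0[OF that(2)] by (simp add: prod_eq_iff)
  qed
  have g_even: "g (- z) = g z" if "z \<in> S" for z
    using A_excl[OF _ that] by (auto simp: g_def H_minus)
  have inside: "fst z \<noteq> 0" "H z \<inter> interior K \<noteq> {}" if "z \<notin> A" "- z \<notin> A" for z
  proof -
    have lt: "snd z < h (fst z)" "- snd z < h (- fst z)" using that by (auto simp: A_def)
    then show "fst z \<noteq> 0" using h0 by auto
    obtain y where "y \<in> K" "h (fst z) = fst z \<bullet> y" using h_att by blast
    moreover obtain x where "x \<in> K" "h (- fst z) = - fst z \<bullet> x" using h_att by blast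
    ultimately show "H z \<inter> interior K \<noteq> {}"
      unfolding H_def using lt by (intro hyperplane_meets_interior[OF Kc Kint, of x _ _ y]) auto
  qed
  have c_in: "c (H z) \<in> interior K" "c (H z) \<in> K" "c (H z) \<in> H z" if "z \<notin> A" "- z \<notin> A" for z
    using c_mem[OF inside(1)[OF that], of "snd z"] inside(2)[OF that] interior_subset
    by (auto simp: H_def)
  have g1_lim: "(\<lambda>n. g1 (x n)) \<longlonglongrightarrow> g1 a" if "x \<longlonglongrightarrow> a" "a \<in> A" "a \<in> S" for x a
  proof -
    have "(fst a, snd a - h (fst a)) \<noteq> 0"
      using S0[OF that(3)] h0 by (auto simp: zero_prod_def prod_eq_iff)
    then show ?thesis unfolding g1_def
      by (intro tendsto_sgn tendsto_Pair tendsto_diff tendsto_fst tendsto_snd h_lim that)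
  qed
  have lim_A: "(\<lambda>n. g (x n)) \<longlonglongrightarrow> g a" if xS: "\<And>n. x n \<in> S" and xa: "x \<longlonglongrightarrow> a" and aS: "a \<in> S" and aA: "a \<in> A" for x a
  proof -
    have ga: "g a = g1 a" using aA by (simp add: g_def)
    have xf: "(\<lambda>n. fst (x n)) \<longlonglongrightarrow> fst a" and xs: "(\<lambda>n. snd (x n)) \<longlonglongrightarrow> snd a"
      using xa by (auto intro: tendsto_fst tendsto_snd)
    \<comment> \<open>Close to a point of \<open>A\<close> the antipodes are outside
      \<open>A\<close>, so only two of the three clauses of \<open>g\<close> compete.\<close>
    have ev: "\<forall>\<^sub>F n in sequentially. - x n \<notin> A"
    proof -
      have "- a \<notin> A" using A_excl aA aS by blast
      then have "- snd a < h (- fst a)" by (auto simp: A_def)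
      moreover have "(\<lambda>n. h (- fst (x n)) + snd (x n)) \<longlonglongrightarrow> h (- fst a) + snd a"
        by (intro tendsto_add h_lim tendsto_minus xf xs)
      ultimately have "\<forall>\<^sub>F n in sequentially. 0 < h (- fst (x n)) + snd (x n)"
        by (intro order_tendstoD(1)) auto
      then show ?thesis by eventually_elim (auto simp: A_def)
    qed
    show ?thesis
    proof (cases "h (fst a) < snd a")
      case True
      have "(\<lambda>n. snd (x n) - h (fst (x n))) \<longlonglongrightarrow> snd a - h (fst a)"
        by (intro tendsto_diff h_lim xf xs)
      then have "\<forall>\<^sub>F n in sequentially. 0 < snd (x n) - h (fst (x n))"
        using True by (intro order_tendstoD(1)) auto
      then have "\<forall>\<^sub>F n in sequentially. g (x n) = g1 (x n)"
        by eventually_elim (auto simp: g_def A_def)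
      then show ?thesis unfolding ga using g1_lim[OF xa aA aS] by (subst tendsto_cong) auto
    next
      case False
      then have eq: "snd a = h (fst a)" using aA by (auto simp: A_def)
      have u0: "fst a \<noteq> 0" using S0[OF aS] eq h0 by (auto simp: prod_eq_iff)
      \<comment> \<open>All points of the face share the normal direction of \<open>a\<close>, so
        \<open>\<Psi>\<close> collapses the face to \<open>g1 a\<close>.\<close>
      have normal: "\<Psi> p = g1 a" if "p \<in> K" "fst a \<bullet> p = snd a" for p
      proof -
        have "unit_normal K p (sgn (fst a))"
          using h_ge[of _ "fst a"] that eq u0
          by (auto simp: unit_normal_def norm_sgn sgn_div_norm intro!: mult_left_mono)
        then show ?thesis using \<Psi>(5)[OF that(1)] eq u0
          by (simp add: g1_def sgn_div_norm norm_prod_def)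
      qed
      obtain p where p: "p \<in> K" "h (fst a) = fst a \<bullet> p" using h_att by blast
      \<comment> \<open>The point \<open>p\<close> of the face stands in where there is no centre.
        Then \<open>Y\<close> stays in \<open>K\<close>, its limit points lie in the face, and
        \<open>\<Psi> (Y n)\<close> converges even if \<open>Y n\<close> does not.\<close>
      define Y where "Y n = (if x n \<notin> A \<and> - x n \<notin> A then c (H (x n)) else p)" for n
      have YK: "Y n \<in> K" for n using p c_in by (auto simp: Y_def)
      have "(\<lambda>n. if x n \<notin> A \<and> - x n \<notin> A then snd (x n) else fst (x n) \<bullet> p) \<longlonglongrightarrow> snd a"
        by (rule tendsto_if) (use xs tendsto_inner[OF xf tendsto_const, of p] p eq in auto)
      moreover have "(if x n \<notin> A \<and> - x n \<notin> A then snd (x n) else fst (x n) \<bullet> p) = fst (x n) \<bullet> Y n" for n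
        using c_in(3)[of "x n"] by (auto simp: Y_def H_def)
      ultimately have Ylim: "(\<lambda>n. fst (x n) \<bullet> Y n) \<longlonglongrightarrow> snd a" by simp
      have "(\<lambda>n. \<Psi> (Y n)) \<longlonglongrightarrow> g1 a"
      proof (rule tendsto_subseq_compact[OF Kcomp YK])
        fix r l assume r: "strict_mono (r :: nat \<Rightarrow> nat)" "l \<in> K" "(Y \<circ> r) \<longlonglongrightarrow> l"
        have "(\<lambda>n. fst (x (r n)) \<bullet> Y (r n)) \<longlonglongrightarrow> fst a \<bullet> l"
          using LIMSEQ_subseq_LIMSEQ[OF xf r(1)] r(3) by (intro tendsto_inner) (auto simp: comp_def)
        moreover have "(\<lambda>n. fst (x (r n)) \<bullet> Y (r n)) \<longlonglongrightarrow> snd a"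
          using LIMSEQ_subseq_LIMSEQ[OF Ylim r(1)] by (simp add: comp_def)
        ultimately have "fst a \<bullet> l = snd a" by (rule LIMSEQ_unique)
        then have "\<Psi> l = g1 a" using normal r(2) by simp
        moreover have "(\<lambda>n. \<Psi> (Y (r n))) \<longlonglongrightarrow> \<Psi> l"
          using r YK by (intro continuous_on_tendsto_compose[OF \<Psi>(1)]) (auto simp: comp_def)
        ultimately show "((\<lambda>n. \<Psi> (Y n)) \<circ> r) \<longlonglongrightarrow> g1 a" by (simp add: comp_def)
      qed
      then have "(\<lambda>n. if x n \<in> A then g1 (x n) else \<Psi> (Y n)) \<longlonglongrightarrow> g1 a"
        by (intro tendsto_if g1_lim xa aA aS)
      moreover have "\<forall>\<^sub>F n in sequentially. g (x n) = (if x n \<in> A then g1 (x n) else \<Psi> (Y n))"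
        using ev by eventually_elim (auto simp: g_def Y_def)
      ultimately show ?thesis unfolding ga by (subst tendsto_cong) auto
    qed
  qed
  have lim: "(\<lambda>n. g (x n)) \<longlonglongrightarrow> g a" if xS: "\<And>n. x n \<in> S" and xa: "x \<longlonglongrightarrow> a" and aS: "a \<in> S" for x a
  proof -
    consider "a \<in> A" | "- a \<in> A" | "a \<notin> A" "- a \<notin> A" by blast
    then show ?thesis
    proof cases
      case 1 then show ?thesis using lim_A that by blast
    next
      case 2
      have "(\<lambda>n. g (- x n)) \<longlonglongrightarrow> g (- a)"
        by (rule lim_A) (use 2 that in \<open>auto simp: S_minus intro: tendsto_minus\<close>)
      then show ?thesis using g_even xS aS by simp
    next
      case 3
      have xf: "(\<lambda>n. fst (x n)) \<longlonglongrightarrow> fst a" and xs: "(\<lambda>n. snd (x n)) \<longlonglongrightarrow> snd a"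
        using xa by (auto intro: tendsto_fst tendsto_snd)
      have l: "(\<lambda>n. h (fst (x n)) - snd (x n)) \<longlonglongrightarrow> h (fst a) - snd a"
           "(\<lambda>n. h (- fst (x n)) + snd (x n)) \<longlonglongrightarrow> h (- fst a) + snd a"
        by (intro tendsto_diff tendsto_add tendsto_minus h_lim xf xs)+
      have "0 < h (fst a) - snd a" "0 < h (- fst a) + snd a" using 3 by (auto simp: A_def)
      from order_tendstoD(1)[OF l(1) this(1)] order_tendstoD(1)[OF l(2) this(2)]
       have ev: "\<forall>\<^sub>F n in sequentially. x n \<notin> A \<and> - x n \<notin> A"
        by eventually_elim (auto simp: A_def)
      \<comment> \<open>A filler for finitely many exceptional terms, which keeps the whole sequence
        in the domain of \<open>\<Psi>\<close>.\<close>
      obtain q where q: "q \<in> K" using Kne by auto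
      define Y where "Y n = (if x n \<notin> A \<and> - x n \<notin> A then c (H (x n)) else q)" for n
      have YK: "Y n \<in> K" for n using q c_in by (auto simp: Y_def)
      have "(\<lambda>n. c (H (x n))) \<longlonglongrightarrow> c (H a)"
        unfolding H_def using inside[OF 3] by (intro c_cont xf xs) (auto simp: H_def)
      moreover have "\<forall>\<^sub>F n in sequentially. Y n = c (H (x n))"
        using ev by eventually_elim (simp add: Y_def)
      ultimately have "Y \<longlonglongrightarrow> c (H a)" by (subst tendsto_cong)
      then have "(\<lambda>n. \<Psi> (Y n)) \<longlonglongrightarrow> \<Psi> (c (H a))"
        using YK c_in(2)[OF 3] by (intro continuous_on_tendsto_compose[OF \<Psi>(1)]) auto
      moreover have "\<forall>\<^sub>F n in sequentially. g (x n) = \<Psi> (Y n)"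
        using ev by eventually_elim (simp add: g_def Y_def)
      moreover have "g a = \<Psi> (c (H a))" using 3 by (simp add: g_def)
      ultimately show ?thesis by (simp add: tendsto_cong)
    qed
  qed
  have g1_norm: "norm (g1 z) = 1" if "z \<in> S" for z
    using S0[OF that] h0 by (auto simp: g1_def norm_sgn zero_prod_def prod_eq_iff)
  have gS: "g z \<in> sphere 0 1" if "z \<in> S" for z
    using that g1_norm[of z] g1_norm[of "- z"] \<Psi>(2) c_in by (auto simp: g_def S_minus)
  have gcont: "continuous_map (top_of_set S) (top_of_set (sphere 0 1)) g"
    using gS lim by (auto simp: continuous_map_in_subtopology continuous_on_sequentially comp_def)
  have q: "quotient_map (top_of_set S) (real_projective_space :: ('a \<times> real) set topology) (\<lambda>x. {x, - x})"
    unfolding real_projective_space_def S_def by (rule quotient_map_quotient_topology)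
  have topsp: "topspace (real_projective_space :: ('a \<times> real) set topology) = (\<lambda>x. {x, - x}) ` S"
    unfolding real_projective_space_def S_def topspace_quotient_topology by simp
  obtain f where f: "continuous_map real_projective_space (top_of_set (sphere 0 1)) f"
    "\<And>x. x \<in> S \<Longrightarrow> f {x, - x} = g x"
  proof (rule quotient_map_lift_exists[OF q gcont])
    show "g x = g y" if "x \<in> topspace (top_of_set S)" "y \<in> topspace (top_of_set S)" "{x, - x} = {y, - y}" for x y
      using that g_even[of x] g_even[of y] by (auto simp: doubleton_eq_iff)
  qed auto
  \<comment> \<open>\<open>(u, t)\<close> is recovered from \<open>(u, t - h u)\<close> by adding
    \<open>h u\<close>, compatibly with positive scaling; the unit norm then fixes the
    scale.\<close>
  have g1_inj: "z = z'" if z: "z \<in> S" "z' \<in> S" and eq: "g1 z = g1 z'" for z z'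
  proof -
    define G where "G z = (fst z, snd z - h (fst z))" for z :: "'a \<times> real"
    have G0: "G z \<noteq> 0" if "z \<in> S" for z
      using S0[OF that] h0 by (auto simp: G_def zero_prod_def prod_eq_iff)
    define a where "a = norm (G z) / norm (G z')"
    have a: "a > 0" using G0 z by (simp add: a_def)
    have "G z = norm (G z) *\<^sub>R sgn (G z)" by (cases "G z = 0") (simp_all add: sgn_div_norm)
    also have "sgn (G z) = sgn (G z')" using eq by (simp add: g1_def G_def)
    also have "norm (G z) *\<^sub>R sgn (G z') = a *\<^sub>R G z'" by (simp add: a_def sgn_div_norm divide_inverse)
    finally have "G z = a *\<^sub>R G z'" .
    then have f: "fst z = a *\<^sub>R fst z'" and s: "snd z - h (fst z) = a * (snd z' - h (fst z'))"
      by (auto simp: G_def)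
    have "snd z = a * snd z'" using s a unfolding f by (simp add: h_scale algebra_simps)
    then have za: "z = a *\<^sub>R z'" using f by (simp add: prod_eq_iff)
    then have "norm z = a * norm z'" using a by simp
    then have "a = 1" using z by (simp add: S_def)
    then show "z = z'" using za by simp
  qed
  have snd_g1: "snd (g1 z) \<ge> 0" if "z \<in> A" for z
    using that by (simp add: g1_def sgn_div_norm A_def)
  \<comment> \<open>Hyperplanes off the interior have values in the closed upper half, where
    \<open>g1\<close> is injective; those through the interior have values in the open lower
    half.\<close>
  have sep: "g z \<noteq> g z'" if z: "z \<in> S" "z' \<in> S" "z' \<noteq> z" "z' \<noteq> - z" and zA: "z \<in> A" for z z'
  proof
    assume eq: "g z = g z'"
    have gz: "g z = g1 z" using zA by (simp add: g_def)
    consider "z' \<in> A" | "- z' \<in> A" "z' \<notin> A" | "z' \<notin> A" "- z' \<notin> A" by blast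
    then show False
    proof cases
      case 1
      then have "g z' = g1 z'" by (simp add: g_def)
      with eq gz have "g1 z = g1 z'" by simp
      then show False using g1_inj z(1-3) by blast
    next
      case 2
      then have "g z' = g1 (- z')" by (simp add: g_def)
      with eq gz have "g1 z = g1 (- z')" by simp
      then have "z = - z'" using g1_inj z(1,2) S_minus by blast
      then show False using z(4) by simp
    next
      case 3
      then have "g z' = \<Psi> (c (H z'))" by (simp add: g_def)
      then have "snd (g z') < 0" using \<Psi>(4) c_in(1) 3 by metis
      moreover have "snd (g z) \<ge> 0" unfolding gz by (rule snd_g1[OF zA])
      ultimately show False using eq by simp
    qed
  qed
  show ?thesis
  proof (intro exI[of _ f] conjI allI impI f(1))
    fix k :: nat assume k: "k \<ge> 2" and mult: "admits_multiplicity real_projective_space f k"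
    then obtain x :: "nat \<Rightarrow> ('a \<times> real) set" where
      x: "x ` {1..k} \<subseteq> (\<lambda>x. {x, - x}) ` S" "inj_on x {1..k}"
        "\<And>i j. i \<in> {1..k} \<Longrightarrow> j \<in> {1..k} \<Longrightarrow> f (x i) = f (x j)"
      unfolding admits_multiplicity_def topsp by blast
    have "\<forall>i\<in>{1..k}. \<exists>z\<in>S. x i = {z, - z}" using x(1) by blast
    then obtain z where z: "\<And>i. i \<in> {1..k} \<Longrightarrow> z i \<in> S" "\<And>i. i \<in> {1..k} \<Longrightarrow> x i = {z i, - z i}"
      by metis
    have gz: "g (z i) = g (z j)" if "i \<in> {1..k}" "j \<in> {1..k}" for i j
      using x(3)[OF that] z(2)[OF that(1)] z(2)[OF that(2)] f(2)[OF z(1)[OF that(1)]] f(2)[OF z(1)[OF that(2)]]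
      by simp
    have dist: "z j \<noteq> z i" "z j \<noteq> - z i" if "i \<in> {1..k}" "j \<in> {1..k}" "i \<noteq> j" for i j
    proof -
      have "x i \<noteq> x j" using inj_onD[OF x(2) _ that(1,2)] that(3) by blast
      then show "z j \<noteq> z i" "z j \<noteq> - z i" using z(2)[OF that(1)] z(2)[OF that(2)]
        by (auto simp: insert_commute)
    qed
    \<comment> \<open>As \<open>k \<ge> 2\<close>, a second projective point has the same value,
      which \<open>sep\<close> excludes for a hyperplane off the interior.\<close>
    have nA: "z i \<notin> A \<and> - z i \<notin> A" if i: "i \<in> {1..k}" for i
    proof -
      obtain j where j: "j \<in> {1..k}" "j \<noteq> i"
      proof (cases "i = 1")
        case True then show ?thesis using that[of 2] k by auto
      next
        case False then show ?thesis using that[of 1] k by auto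
      qed
      note d = dist[OF i j(1) j(2)[symmetric]]
      have "z i \<notin> A" using sep[OF z(1)[OF i] z(1)[OF j(1)] d] gz[OF i j(1)] by blast
      moreover have "- z i \<notin> A"
        using sep[of "- z i" "z j"] gz[OF i j(1)] d z(1)[OF i] z(1)[OF j(1)] g_even[OF z(1)[OF i]] S_minus
        by (metis minus_minus)
      ultimately show ?thesis ..
    qed
    show "\<exists>H :: nat \<Rightarrow> 'a set. inj_on H {1..k} \<and>
             (\<forall>i\<in>{1..k}. affine_hyperplane (H i) \<and> H i \<inter> K \<noteq> {}) \<and>
             (\<forall>i\<in>{1..k}. \<forall>j\<in>{1..k}. c (H i) = c (H j))"
    proof (intro exI[of _ "\<lambda>i. H (z i)"] conjI ballI inj_onI)
      fix i j assume ij: "i \<in> {1..k}" "j \<in> {1..k}"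
      have "\<Psi> (c (H (z i))) = \<Psi> (c (H (z j)))"
        using gz[OF ij] nA[OF ij(1)] nA[OF ij(2)] by (simp add: g_def)
      then show "c (H (z i)) = c (H (z j))"
        using inj_onD[OF \<Psi>(3)] c_in(1) nA[OF ij(1)] nA[OF ij(2)] by blast
      \<comment> \<open>A hyperplane determines its normalised coordinates up to sign, hence the
        projective point.\<close>
      assume "H (z i) = H (z j)"
      then obtain b where b: "fst (z j) = b *\<^sub>R fst (z i)" "snd (z j) = b * snd (z i)"
        using parallel_hyperplane_eq[of "fst (z i)" "fst (z j)" "snd (z i)" "snd (z j)"]
          inside(1)[of "z i"] inside(1)[of "z j"] nA ij \<open>H (z i) = H (z j)\<close> unfolding H_def by blast
      then have zb: "z j = b *\<^sub>R z i" by (simp add: prod_eq_iff)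
      then have "norm (z j) = \<bar>b\<bar> * norm (z i)" by simp
      then have "\<bar>b\<bar> = 1" using z(1) ij by (simp add: S_def)
      then have "z j = z i \<or> z j = - z i" using zb by (auto simp: abs_if split: if_splits)
      then show "i = j" using dist ij by blast
    next
      fix i assume i: "i \<in> {1..k}"
      show "affine_hyperplane (H (z i))"
        unfolding affine_hyperplane_def H_def using inside(1) nA[OF i] by blast
      show "H (z i) \<inter> K \<noteq> {}" using inside(2) nA[OF i] interior_subset by blast
    qed
  qed
qed

text \<open>Rescaling reduces the smooth case to unit normals, the form in which sections are
  measured later. \<open>c_face\<close> serves the nonsmooth case, where hyperplanes with a common
  section must have a common centre.\<close>

lemma exists_projective_map:
  fixes K :: "'a::euclidean_space set"
  assumes K: "convex_body K"
    and c_mem: "\<And>u t. norm u = 1 \<Longrightarrow> {x. u \<bullet> x = t} \<inter> interior K \<noteq> {} \<Longrightarrow>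
      c {x. u \<bullet> x = t} \<in> {x. u \<bullet> x = t} \<inter> interior K"
    and c_cont: "\<And>u t un tn. norm u = 1 \<Longrightarrow> (\<And>n. norm (un n) = 1) \<Longrightarrow> {x. u \<bullet> x = t} \<inter> interior K \<noteq> {} \<Longrightarrow> un \<longlonglongrightarrow> u \<Longrightarrow> tn \<longlonglongrightarrow> t \<Longrightarrow>
      (\<lambda>n. c {x. un n \<bullet> x = tn n}) \<longlonglongrightarrow> c {x. u \<bullet> x = t}"
    and c_face: "\<And>p v w. \<lbrakk>p \<in> K; norm v = 1; norm w = 1;
      K \<inter> {x. v \<bullet> x = v \<bullet> p} = K \<inter> {x. w \<bullet> x = w \<bullet> p}\<rbrakk> \<Longrightarrow> c {x. v \<bullet> x = v \<bullet> p} = c {x. w \<bullet> x = w \<bullet> p}"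
  shows "\<exists>f :: ('a \<times> real) set \<Rightarrow> 'a \<times> real.
        continuous_map real_projective_space (top_of_set (sphere 0 1)) f \<and>
        (\<forall>k::nat. k \<ge> 2 \<longrightarrow> admits_multiplicity real_projective_space f k \<longrightarrow>
          (\<exists>H :: nat \<Rightarrow> 'a set.
             inj_on H {1..k} \<and>
             (\<forall>i\<in>{1..k}. affine_hyperplane (H i) \<and> H i \<inter> K \<noteq> {}) \<and>
             (\<forall>i\<in>{1..k}. \<forall>j\<in>{1..k}. c (H i) = c (H j))))"
proof (cases "\<forall>p u v. p \<in> K \<longrightarrow> unit_normal K p u \<longrightarrow> unit_normal K p v \<longrightarrow> u = v")
  case True
  have norml: "{x. u \<bullet> x = t} = {x. sgn u \<bullet> x = t / norm u}" if "u \<noteq> 0" for u :: 'a and t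
    using that by (auto simp: sgn_div_norm field_simps)
  have mem: "c {x. u \<bullet> x = t} \<in> {x. u \<bullet> x = t} \<inter> interior K"
    if "u \<noteq> 0" "{x. u \<bullet> x = t} \<inter> interior K \<noteq> {}" for u t
    using c_mem[of "sgn u" "t / norm u"] that(2) that(1) unfolding norml[OF that(1), of t] by (simp add: norm_sgn)
  have cont: "(\<lambda>n. c {x. un n \<bullet> x = tn n}) \<longlonglongrightarrow> c {x. u \<bullet> x = t}"
    if u: "u \<noteq> 0" and meets: "{x. u \<bullet> x = t} \<inter> interior K \<noteq> {}" and un: "un \<longlonglongrightarrow> u" and tn: "tn \<longlonglongrightarrow> t"
    for u t un tn
  proof -
    \<comment> \<open>Finitely many terms with \<open>un n = 0\<close> cannot be normalised; the
      limit direction replaces them.\<close>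
    define vn where "vn n = (if un n = 0 then sgn u else sgn (un n))" for n
    have ev: "\<forall>\<^sub>F n in sequentially. un n \<noteq> 0"
      using un u by (rule tendsto_imp_eventually_ne)
    have "(\<lambda>n. sgn (un n)) \<longlonglongrightarrow> sgn u" using un u by (rule tendsto_sgn)
    then have "vn \<longlonglongrightarrow> sgn u" unfolding vn_def by (intro tendsto_if tendsto_const)
    moreover have "(\<lambda>n. tn n / norm (un n)) \<longlonglongrightarrow> t / norm u"
      using un tn u by (intro tendsto_intros) auto
    moreover have "norm (sgn u) = 1" "norm (vn n) = 1" for n
      using u by (auto simp: vn_def norm_sgn)
    ultimately have "(\<lambda>n. c {x. vn n \<bullet> x = tn n / norm (un n)}) \<longlonglongrightarrow> c {x. sgn u \<bullet> x = t / norm u}"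
      using meets unfolding norml[OF u] by (intro c_cont)
    moreover have "\<forall>\<^sub>F n in sequentially. c {x. un n \<bullet> x = tn n} = c {x. vn n \<bullet> x = tn n / norm (un n)}"
      using ev
    proof eventually_elim
      case (elim n)
      show ?case unfolding norml[OF elim] using elim by (simp add: vn_def)
    qed
    ultimately show ?thesis unfolding norml[OF u] by (subst tendsto_cong)
  qed
  have "u = v" if "p \<in> K" "unit_normal K p u" "unit_normal K p v" for p u v
    using True that by blast
  then show ?thesis by (rule exists_projective_map_smooth[OF K _ mem cont])
next
  case False
  then obtain p u v where p: "p \<in> K" "unit_normal K p u" "unit_normal K p v" "u \<noteq> v" by blast
  obtain w :: "nat \<Rightarrow> 'a" where w: "inj (\<lambda>i. {x. w i \<bullet> x = w i \<bullet> p})" "\<And>i. norm (w i) = 1"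
    "\<And>i. K \<inter> {x. w i \<bullet> x = w i \<bullet> p} = {x\<in>K. u \<bullet> x = u \<bullet> p \<and> v \<bullet> x = v \<bullet> p}"
    by (rule pencil_same_section[OF K p]) blast
  define e :: "'a \<times> real" where "e = (0, 1)"
  have "\<exists>H :: nat \<Rightarrow> 'a set. inj_on H {1..k} \<and>
             (\<forall>i\<in>{1..k}. affine_hyperplane (H i) \<and> H i \<inter> K \<noteq> {}) \<and>
             (\<forall>i\<in>{1..k}. \<forall>j\<in>{1..k}. c (H i) = c (H j))" for k
  proof (intro exI[of _ "\<lambda>i. {x. w i \<bullet> x = w i \<bullet> p}"] conjI ballI)
    show "inj_on (\<lambda>i. {x. w i \<bullet> x = w i \<bullet> p}) {1..k}" using w(1) by (rule inj_on_subset) simp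
    show "affine_hyperplane {x. w i \<bullet> x = w i \<bullet> p}" for i
      using w(2)[of i] unfolding affine_hyperplane_def by (metis norm_zero zero_neq_one)
    show "{x. w i \<bullet> x = w i \<bullet> p} \<inter> K \<noteq> {}" for i using p by auto
    show "c {x. w i \<bullet> x = w i \<bullet> p} = c {x. w j \<bullet> x = w j \<bullet> p}" for i j
      by (rule c_face) (use p w in simp_all)
  qed
  moreover have "continuous_map real_projective_space (top_of_set (sphere 0 1)) (\<lambda>_::('a \<times> real) set. e)"
    by (simp add: e_def norm_prod_def)
  ultimately show ?thesis by blast
qed

section \<open>Lebesgue measure on hyperplanes\<close>

text \<open>Integrate the indicator of \<open>y - T x\<close> lying in a ball over \<open>x\<close> in the preimage of \<open>A\<close> under \<open>T\<close> and all \<open>y\<close>; by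
  translation invariance, exchanging the order of integration moves \<open>T\<close> away from \<open>A\<close>.\<close>

lemma distr_lborel_orthogonal:
  fixes T :: "'a::euclidean_space \<Rightarrow> 'a"
  assumes T: "orthogonal_transformation T"
  shows "distr lborel borel T = lborel"
proof (rule measure_eqI)
  fix A :: "'a set" assume "A \<in> sets (distr lborel borel T)"
  then have A[measurable]: "A \<in> sets borel" by simp
  have lin: "linear T" using T by (rule orthogonal_transformation_linear)
  have [measurable]: "T \<in> borel_measurable borel"
    by (intro borel_measurable_continuous_onI linear_continuous_on linear_conv_bounded_linear[THEN iffD1] lin)
  \<comment> \<open>The ball is invariant under \<open>T\<close> and under negation, and its measure
    is positive and finite, so it can be cancelled at the end.\<close>
  let ?B = "cball (0::'a) 1"
  have [measurable]: "?B \<in> sets borel" by (intro borel_closed closed_cball)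
  have shift: "(\<integral>\<^sup>+x. f (x + c) \<partial>lborel) = (\<integral>\<^sup>+x. f x \<partial>lborel)"
    if [measurable]: "f \<in> borel_measurable borel" for f :: "'a \<Rightarrow> ennreal" and c :: 'a
    by (subst (2) lborel_distr_plus[of c, symmetric]) (simp add: nn_integral_distr add.commute)
  have TA[measurable]: "T -` A \<in> sets borel"
    using measurable_sets[of T borel borel A] by simp
  have "emeasure lborel (T -` A) * emeasure lborel ?B =
      (\<integral>\<^sup>+x. indicator (T -` A) x * emeasure lborel ?B \<partial>lborel)"
    by (subst nn_integral_multc) auto
  also have "\<dots> = (\<integral>\<^sup>+x. indicator A (T x) * emeasure lborel ?B \<partial>lborel)"
    by (simp add: indicator_def)
  also have "\<dots> = (\<integral>\<^sup>+x. \<integral>\<^sup>+y. indicator A (T x) * indicator ?B (y - T x) \<partial>lborel \<partial>lborel)"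
  proof (rule nn_integral_cong)
    fix x
    have "(\<integral>\<^sup>+y. indicator ?B (y + - T x) \<partial>lborel) = (\<integral>\<^sup>+y. indicator ?B y \<partial>lborel)"
      by (rule shift, rule borel_measurable_indicator, rule borel_closed, rule closed_cball)
    then have "(\<integral>\<^sup>+y. indicator ?B (y - T x) \<partial>lborel) = emeasure lborel ?B" by simp
    moreover have "(\<lambda>y. indicator ?B (y - T x) :: ennreal) \<in> borel_measurable lborel" by measurable
    ultimately show "indicator A (T x) * emeasure lborel ?B = (\<integral>\<^sup>+y. indicator A (T x) * indicator ?B (y - T x) \<partial>lborel)"
      by (simp only: nn_integral_cmult)
  qed
  also have "\<dots> = (\<integral>\<^sup>+y. \<integral>\<^sup>+x. indicator A (T x) * indicator ?B (y - T x) \<partial>lborel \<partial>lborel)"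
    by (rule lborel_pair.Fubini') simp
  also have "\<dots> = (\<integral>\<^sup>+y. \<integral>\<^sup>+x. indicator A (T x + y) * indicator ?B x \<partial>lborel \<partial>lborel)"
  proof (rule nn_integral_cong)
    fix y
    \<comment> \<open>Translating \<open>x\<close> by \<open>z\<close> turns \<open>T x\<close> into
      \<open>T x + y\<close> and \<open>y - T x\<close> into \<open>- T x\<close>, whose norm is
      that of \<open>x\<close>.\<close>
    obtain z where z: "T z = y"
      using orthogonal_transformation_surj[OF T] by (metis surj_def)
    have "(\<integral>\<^sup>+x. indicator A (T x) * indicator ?B (y - T x) \<partial>lborel) =
      (\<integral>\<^sup>+x. (indicator A (T (x+z)) * indicator ?B (y - T (x+z)) :: ennreal) \<partial>lborel)"
      by (rule shift[symmetric]) simp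
    also have "\<dots> = (\<integral>\<^sup>+x. indicator A (T x + y) * indicator ?B x \<partial>lborel)"
      using T by (intro nn_integral_cong)
        (auto simp: linear_add[OF lin] z indicator_def orthogonal_transformation_norm)
    finally show "(\<integral>\<^sup>+x. indicator A (T x) * indicator ?B (y - T x) \<partial>lborel) = 
       (\<integral>\<^sup>+x. indicator A (T x + y) * indicator ?B x \<partial>lborel)" .
  qed
  also have "\<dots> = (\<integral>\<^sup>+x. \<integral>\<^sup>+y. indicator A (T x + y) * indicator ?B x \<partial>lborel \<partial>lborel)"
    by (rule lborel_pair.Fubini') simp
  also have "\<dots> = (\<integral>\<^sup>+x. emeasure lborel A * indicator ?B x \<partial>lborel)"
  proof (rule nn_integral_cong)
    fix x
    show "(\<integral>\<^sup>+y. indicator A (T x + y) * indicator ?B x \<partial>lborel) = emeasure lborel A * indicator ?B x"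
      using shift[OF borel_measurable_indicator[OF A], of "T x"] by (simp add: nn_integral_multc add.commute)
  qed
  also have "\<dots> = emeasure lborel A * emeasure lborel ?B"
    by (simp add: nn_integral_cmult)
  finally have "emeasure lborel (T -` A) * emeasure lborel ?B / emeasure lborel ?B =
      emeasure lborel A * emeasure lborel ?B / emeasure lborel ?B"
    by simp
  moreover have "emeasure lborel ?B \<noteq> 0" "emeasure lborel ?B \<noteq> top"
    using unit_ball_vol_pos[of "real DIM('a)"] by (simp_all add: emeasure_cball del: unit_ball_vol_pos)
  ultimately have "emeasure lborel (T -` A) = emeasure lborel A"
    by (metis mult_divide_eq_ennreal)
  then show "emeasure (distr lborel borel T) A = emeasure lborel A"
    by (simp add: emeasure_distr)
qed simp

text \<open>Lebesgue measure is characterised by boxes along \<open>Basis\<close>. The isometry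
  \<open>U\<close> turns coordinates along \<open>B\<close> into coordinates along
  \<open>Basis\<close>; it is undone by \<open>T\<close>, under which the measure is
  invariant.\<close>

lemma distr_PiM_orthonormal_basis:
  fixes B :: "'a::euclidean_space set"
  assumes B: "orthonormal_basis_of UNIV B"
  shows "distr (\<Pi>\<^sub>M b\<in>B. lborel) borel (\<lambda>c. \<Sum>b\<in>B. c b *\<^sub>R b) = lborel"
proof -
  have orth: "pairwise orthogonal B" and norm1: "\<And>b. b \<in> B \<Longrightarrow> norm b = 1" and sp: "span B = UNIV"
    using B by (auto simp: orthonormal_basis_of_def)
  have ind: "independent B"
    using orth norm1 by (intro pairwise_orthogonal_independent) (auto dest: norm1)
  have fin: "finite B" using ind by (rule independent_imp_finite)
  have card: "card B = card (Basis :: 'a set)"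
    using ind sp by (metis basis_card_eq_dim dim_UNIV subset_UNIV)
  obtain \<beta> where \<beta>: "bij_betw \<beta> (Basis :: 'a set) B"
    using card fin by (metis finite_Basis finite_same_card_bij)
  have ip: "b \<bullet> b' = (if b = b' then 1 else 0)" if "b \<in> B" "b' \<in> B" for b b'
    using that orth norm1 by (auto simp: pairwise_def orthogonal_def norm_eq_1)
  define T where "T x = (\<Sum>i\<in>Basis. (x \<bullet> i) *\<^sub>R \<beta> i)" for x :: 'a
  define U where "U x = (\<Sum>i\<in>Basis. (x \<bullet> \<beta> i) *\<^sub>R i)" for x :: 'a
  have \<beta>B: "\<beta> i \<in> B" if "i \<in> Basis" for i using \<beta> that by (auto simp: bij_betw_def)
  have \<beta>inj: "\<beta> i = \<beta> j \<longleftrightarrow> i = j" if "i \<in> Basis" "j \<in> Basis" for i j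
    using \<beta> that by (auto simp: bij_betw_def inj_on_def)
  have T: "orthogonal_transformation T"
    unfolding orthogonal_transformation_def
  proof (intro conjI allI)
    show "linear T"
      unfolding T_def by (auto intro!: linearI simp: inner_add_left scaleR_add_left sum.distrib scaleR_sum_right)
    fix v w
    have "T v \<bullet> T w = (\<Sum>i\<in>Basis. \<Sum>j\<in>Basis. (v \<bullet> i) * (w \<bullet> j) * (\<beta> i \<bullet> \<beta> j))"
      unfolding T_def inner_sum_left inner_sum_right
      by (subst sum.swap) (intro sum.cong refl, simp add: mult_ac inner_commute)
    also have "\<dots> = (\<Sum>i\<in>Basis. \<Sum>j\<in>Basis. if i = j then (v \<bullet> i) * (w \<bullet> j) else 0)"
      by (intro sum.cong refl) (auto simp: ip \<beta>B \<beta>inj)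
    also have "\<dots> = v \<bullet> w" by (simp add: euclidean_inner[of v w])
    finally show "T v \<bullet> T w = v \<bullet> w" .
  qed
  have TU: "T (U x) = x" for x
  proof -
    have "T (U x) = (\<Sum>i\<in>Basis. (x \<bullet> \<beta> i) *\<^sub>R \<beta> i)"
      unfolding T_def U_def
      by (intro sum.cong refl) (simp add: inner_sum_left inner_Basis if_distrib[of "(*) _"] cong: if_cong)
    also have "\<dots> = (\<Sum>b\<in>B. (x \<bullet> b) *\<^sub>R b)"
      using sum.reindex_bij_betw[OF \<beta>, of "\<lambda>b. (x \<bullet> b) *\<^sub>R b"] .
    also have "\<dots> = x"
      by (rule orthonormal_basis_expand) (use orth norm1 sp fin in auto)
    finally show ?thesis .
  qed
  have [measurable]: "T \<in> borel_measurable borel" "U \<in> borel_measurable borel"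
    unfolding T_def U_def by measurable
  interpret product_sigma_finite "\<lambda>_::'a. lborel :: real measure" by standard
  let ?P = "\<Pi>\<^sub>M b\<in>B. (lborel :: real measure)"
  let ?s = "\<lambda>c. \<Sum>b\<in>B. c b *\<^sub>R b"
  have [measurable]: "?s \<in> borel_measurable ?P" by measurable
  have s_ip: "?s c \<bullet> b = c b" if "b \<in> B" for c b
  proof -
    have "?s c \<bullet> b = (\<Sum>b'\<in>B. if b' = b then c b' else 0)"
      unfolding inner_sum_left by (intro sum.cong refl) (use that in \<open>auto simp: ip\<close>)
    then show ?thesis using fin that by simp
  qed
  have eq: "lborel = distr (distr ?P borel ?s) borel U"
  proof (rule lborel_eqI)
    fix l u :: 'a assume le: "\<And>b. b \<in> Basis \<Longrightarrow> l \<bullet> b \<le> u \<bullet> b"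
    define \<gamma> where "\<gamma> = the_inv_into Basis \<beta>"
    have \<gamma>: "bij_betw \<gamma> B Basis" unfolding \<gamma>_def by (rule bij_betw_the_inv_into[OF \<beta>])
    have \<gamma>\<beta>: "\<gamma> (\<beta> i) = i" if "i \<in> Basis" for i
      unfolding \<gamma>_def using \<beta> that by (simp add: bij_betw_def the_inv_into_f_f)
    have \<gamma>B: "\<gamma> b \<in> Basis" if "b \<in> B" for b using \<gamma> that by (auto simp: bij_betw_def)
    have "(\<lambda>c. U (?s c)) -` box l u \<inter> space ?P = (\<Pi>\<^sub>E b\<in>B. {l \<bullet> \<gamma> b <..< u \<bullet> \<gamma> b})"
    proof -
      have "U (?s c) \<in> box l u \<longleftrightarrow> (\<forall>b\<in>B. c b \<in> {l \<bullet> \<gamma> b <..< u \<bullet> \<gamma> b})" for c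
      proof -
        have "U (?s c) \<in> box l u \<longleftrightarrow> (\<forall>i\<in>Basis. c (\<beta> i) \<in> {l \<bullet> i <..< u \<bullet> i})"
          by (simp add: mem_box U_def \<beta>B s_ip)
        also have "\<dots> \<longleftrightarrow> (\<forall>i\<in>Basis. c (\<beta> i) \<in> {l \<bullet> \<gamma> (\<beta> i) <..< u \<bullet> \<gamma> (\<beta> i)})"
          by (simp add: \<gamma>\<beta>)
        also have "\<dots> \<longleftrightarrow> (\<forall>b\<in>B. c b \<in> {l \<bullet> \<gamma> b <..< u \<bullet> \<gamma> b})"
          using \<beta> unfolding bij_betw_def by (metis (no_types, lifting) imageE \<beta>B)
        finally show ?thesis .
      qed
      then show ?thesis by (auto simp: space_PiM PiE_iff simp del: box_def)
    qed
    then have "emeasure (distr (distr ?P borel ?s) borel U) (box l u) =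
        emeasure ?P (\<Pi>\<^sub>E b\<in>B. {l \<bullet> \<gamma> b <..< u \<bullet> \<gamma> b})"
      by (simp add: distr_distr emeasure_distr comp_def)
    also have "\<dots> = (\<Prod>b\<in>B. ennreal ((u - l) \<bullet> \<gamma> b))"
      using fin le \<gamma>B by (simp add: emeasure_PiM inner_diff_left cong: prod.cong)
    also have "\<dots> = (\<Prod>i\<in>Basis. ennreal ((u - l) \<bullet> i))"
      using prod.reindex_bij_betw[OF \<gamma>, of "\<lambda>i. ennreal ((u - l) \<bullet> i)"] .
    also have "\<dots> = (\<Prod>b\<in>Basis. (u - l) \<bullet> b)"
      using le by (subst prod_ennreal) (auto simp: inner_diff_left)
    finally show "emeasure (distr (distr ?P borel ?s) borel U) (box l u) = (\<Prod>b\<in>Basis. (u - l) \<bullet> b)" .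
  qed simp
  have "lborel = distr lborel borel T" using distr_lborel_orthogonal[OF T] by simp
  also have "\<dots> = distr (distr ?P borel ?s) borel (\<lambda>x. x)"
    by (subst eq) (simp add: distr_distr comp_def TU)
  also have "\<dots> = distr ?P borel ?s"
    by (simp add: distr_distr comp_def)
  finally show ?thesis by simp
qed

text \<open>Lebesgue measure on the orthogonal complement of a unit vector \<open>u\<close>, as the projection of a slab of
  width 1. Integrals over all hyperplanes thus become integrals over one space, to which dominated
  convergence applies.\<close>

definition hyp_measure :: "'a::euclidean_space \<Rightarrow> 'a measure" where
  "hyp_measure u = distr (density lborel (indicator {x. 0 \<le> u \<bullet> x \<and> u \<bullet> x \<le> 1})) borel
     (\<lambda>x. x - (u \<bullet> x) *\<^sub>R u)"

lemma sets_hyp_measure [simp, measurable_cong]: "sets (hyp_measure u) = sets borel"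
  by (simp add: hyp_measure_def)

lemma space_hyp_measure [simp]: "space (hyp_measure u) = UNIV"
  by (simp add: hyp_measure_def)

lemma nn_integral_hyp_measure:
  assumes [measurable]: "g \<in> borel_measurable borel"
  shows "(\<integral>\<^sup>+x. g x \<partial>hyp_measure u) =
    (\<integral>\<^sup>+x. indicator {x. 0 \<le> u \<bullet> x \<and> u \<bullet> x \<le> 1} x * g (x - (u \<bullet> x) *\<^sub>R u) \<partial>lborel)"
  unfolding hyp_measure_def by (simp add: nn_integral_distr nn_integral_density)

lemma emeasure_hyp_measure:
  assumes [measurable]: "A \<in> sets borel"
  shows "emeasure (hyp_measure u) A =
    emeasure lborel {x. 0 \<le> u \<bullet> x \<and> u \<bullet> x \<le> 1 \<and> x - (u \<bullet> x) *\<^sub>R u \<in> A}"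
proof -
  have "emeasure (hyp_measure u) A = (\<integral>\<^sup>+x. indicator A x \<partial>hyp_measure u)"
    by simp
  also have "\<dots> = (\<integral>\<^sup>+x. indicator {x. 0 \<le> u \<bullet> x \<and> u \<bullet> x \<le> 1} x * indicator A (x - (u \<bullet> x) *\<^sub>R u) \<partial>lborel)"
    by (rule nn_integral_hyp_measure) simp
  also have "\<dots> = (\<integral>\<^sup>+x. indicator {x. 0 \<le> u \<bullet> x \<and> u \<bullet> x \<le> 1 \<and> x - (u \<bullet> x) *\<^sub>R u \<in> A} x \<partial>lborel)"
    by (intro nn_integral_cong) (simp add: indicator_def del: of_bool_conj)
  also have "\<dots> = emeasure lborel {x. 0 \<le> u \<bullet> x \<and> u \<bullet> x \<le> 1 \<and> x - (u \<bullet> x) *\<^sub>R u \<in> A}"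
    by (rule nn_integral_indicator) measurable
  finally show ?thesis .
qed

lemma integral_hyp_measure:
  fixes g :: "'a::euclidean_space \<Rightarrow> 'b::{banach, second_countable_topology}"
  assumes [measurable]: "g \<in> borel_measurable borel"
  shows "(LINT x|hyp_measure u. g x) =
    (LINT x|lborel. indicat_real {x. 0 \<le> u \<bullet> x \<and> u \<bullet> x \<le> 1} x *\<^sub>R g (x - (u \<bullet> x) *\<^sub>R u))"
proof -
  let ?S = "{x. 0 \<le> u \<bullet> x \<and> u \<bullet> x \<le> 1}"
  have "(LINT x|hyp_measure u. g x) =
    (LINT x|density lborel (\<lambda>x. ennreal (indicat_real ?S x)). g (x - (u \<bullet> x) *\<^sub>R u))"
    unfolding hyp_measure_def by (subst integral_distr) (simp_all add: ennreal_indicator)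
  also have "\<dots> = (LINT x|lborel. indicat_real ?S x *\<^sub>R g (x - (u \<bullet> x) *\<^sub>R u))"
    by (rule integral_density) auto
  finally show ?thesis .
qed

text \<open>Together with \<open>u\<close>, an orthonormal basis of the hyperplane is one of the
  whole space. The coordinate along \<open>u\<close> runs through \<open>{0..1}\<close> and
  integrates to 1.\<close>

lemma subspace_lborel_hyperplane:
  assumes u: "norm u = 1"
  shows "subspace_lborel {x. u \<bullet> x = 0} = hyp_measure u"
proof -
  let ?V = "{x. u \<bullet> x = 0}"
  define B where "B = (SOME B. orthonormal_basis_of ?V B)"
  have "subspace ?V" by (simp add: subspace_hyperplane)
  then obtain B' where "pairwise orthogonal B'" "\<And>x. x \<in> B' \<Longrightarrow> norm x = 1" "span B' = ?V"
    using orthonormal_basis_subspace by metis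
  then have "orthonormal_basis_of ?V B'" by (auto simp: orthonormal_basis_of_def)
  then have B: "orthonormal_basis_of ?V B" unfolding B_def by (rule someI)
  then have orth: "pairwise orthogonal B" and norm1: "\<And>b. b \<in> B \<Longrightarrow> norm b = 1" and sp: "span B = ?V"
    by (auto simp: orthonormal_basis_of_def)
  have "independent B"
    using orth norm1 by (intro pairwise_orthogonal_independent) (auto dest: norm1)
  then have fin: "finite B" by (rule independent_imp_finite)
  have ub: "u \<bullet> b = 0" if "b \<in> B" for b using sp span_base[OF that] by auto
  have uu: "u \<bullet> u = 1" using u by (simp add: norm_eq_1)
  have uB: "u \<notin> B" using ub uu by auto
  have "orthonormal_basis_of UNIV (insert u B)"
    unfolding orthonormal_basis_of_def
  proof (intro conjI ballI)
    show "pairwise orthogonal (insert u B)"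
      using orth ub by (auto simp: pairwise_insert orthogonal_def inner_commute)
    show "span (insert u B) = UNIV"
    proof -
      have "x \<in> span (insert u B)" for x
      proof -
        have "x - (u \<bullet> x) *\<^sub>R u \<in> span B" using sp by (simp add: inner_diff_right uu)
        then show ?thesis by (auto simp: span_insert)
      qed
      then show ?thesis by auto
    qed
  qed (use norm1 u in auto)
  note L = distr_PiM_orthonormal_basis[OF this]
  interpret product_sigma_finite "\<lambda>_::'a. lborel :: real measure" by standard
  let ?P = "\<lambda>B. \<Pi>\<^sub>M b\<in>B. (lborel :: real measure)"
  let ?s = "\<lambda>c. \<Sum>b\<in>B. c b *\<^sub>R b"
  have us: "u \<bullet> ?s c = 0" for c by (simp add: inner_sum_right ub)
  have "distr (?P B) borel ?s = hyp_measure u"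
  proof (rule measure_eqI)
    fix A assume "A \<in> sets (distr (?P B) borel ?s)"
    then have [measurable]: "A \<in> sets borel" by simp
    have "emeasure (hyp_measure u) A = (\<integral>\<^sup>+x. indicator A x \<partial>hyp_measure u)"
      by simp
    also have "\<dots> = (\<integral>\<^sup>+x. indicator {x. 0 \<le> u \<bullet> x \<and> u \<bullet> x \<le> 1} x * indicator A (x - (u \<bullet> x) *\<^sub>R u) \<partial>lborel)"
      by (rule nn_integral_hyp_measure) simp
    also have "\<dots> = (\<integral>\<^sup>+c. indicator {0..1} (c u) * indicator A (?s c) \<partial>?P (insert u B))"
      apply (subst L[symmetric])
      apply (subst nn_integral_distr)
        apply measurable
      apply (intro nn_integral_cong)
      using fin uB by (simp add: inner_add_right us uu indicator_def)
    also have "\<dots> = (\<integral>\<^sup>+y. \<integral>\<^sup>+c. indicator {0..1} ((c(u := y)) u) * indicator A (?s (c(u := y))) \<partial>?P B \<partial>lborel)"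
      using fin uB by (intro product_nn_integral_insert_rev) measurable
    also have "\<dots> = (\<integral>\<^sup>+(y::real). \<integral>\<^sup>+c. indicator {0..1} y * indicator A (?s c) \<partial>?P B \<partial>lborel)"
    proof (intro nn_integral_cong)
      fix y c
      have "?s (c(u := y)) = ?s c" using uB by (intro sum.cong) auto
      then show "indicator {0..1} ((c(u := y)) u) * indicator A (?s (c(u := y))) =
         (indicator {0..1} y * indicator A (?s c) :: ennreal)" by simp
    qed
    also have "\<dots> = (\<integral>\<^sup>+(y::real). indicator {0..1} y * (\<integral>\<^sup>+c. indicator A (?s c) \<partial>?P B) \<partial>lborel)"
      by (simp add: nn_integral_cmult)
    also have "\<dots> = (\<integral>\<^sup>+c. indicator A (?s c) \<partial>?P B)"
      by (simp add: nn_integral_multc)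
    also have "\<dots> = (\<integral>\<^sup>+x. indicator A x \<partial>distr (?P B) borel ?s)"
      by (subst nn_integral_distr) auto
    also have "\<dots> = emeasure (distr (?P B) borel ?s) A" by simp
    finally show "emeasure (distr (?P B) borel ?s) A = emeasure (hyp_measure u) A" ..
  qed simp
  then show ?thesis by (simp add: subspace_lborel_def B_def Let_def)
qed

lemma distr_hyp_measure_orthogonal:
  fixes T :: "'a::euclidean_space \<Rightarrow> 'a"
  assumes T: "orthogonal_transformation T"
  shows "distr (hyp_measure u) borel T = hyp_measure (T u)"
proof (rule measure_eqI)
  fix A assume "A \<in> sets (distr (hyp_measure u) borel T)"
  then have [measurable]: "A \<in> sets borel" by simp
  have lin: "linear T" using T by (rule orthogonal_transformation_linear)
  have Tm[measurable]: "T \<in> borel_measurable borel"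
    by (intro borel_measurable_continuous_onI linear_continuous_on linear_conv_bounded_linear[THEN iffD1] lin)
  have ip: "T a \<bullet> T b = a \<bullet> b" for a b using T by (simp add: orthogonal_transformation_def)
  have "emeasure (hyp_measure (T u)) A = (\<integral>\<^sup>+x. indicator A x \<partial>hyp_measure (T u))" by simp
  also have "\<dots> = (\<integral>\<^sup>+x. indicator {x. 0 \<le> T u \<bullet> x \<and> T u \<bullet> x \<le> 1} x * indicator A (x - (T u \<bullet> x) *\<^sub>R T u) \<partial>lborel)"
    by (rule nn_integral_hyp_measure) simp
  also have "\<dots> = (\<integral>\<^sup>+x. indicator {x. 0 \<le> u \<bullet> x \<and> u \<bullet> x \<le> 1} x * indicator A (T (x - (u \<bullet> x) *\<^sub>R u)) \<partial>lborel)"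
    apply (subst distr_lborel_orthogonal[OF T, symmetric])
    apply (subst nn_integral_distr)
      apply measurable
    by (intro nn_integral_cong) (simp add: indicator_def ip linear_diff[OF lin] linear_scale[OF lin])
  also have "\<dots> = (\<integral>\<^sup>+x. indicator A (T x) \<partial>hyp_measure u)"
    by (rule nn_integral_hyp_measure[symmetric]) simp
  also have "\<dots> = (\<integral>\<^sup>+x. indicator A x \<partial>distr (hyp_measure u) borel T)"
    by (subst nn_integral_distr) auto
  also have "\<dots> = emeasure (distr (hyp_measure u) borel T) A" by simp
  finally show "emeasure (distr (hyp_measure u) borel T) A = emeasure (hyp_measure (T u)) A" ..
qed simp

lemma distr_hyp_measure_plus:
  assumes w: "u \<bullet> w = 0"
  shows "distr (hyp_measure u) borel ((+) w) = hyp_measure u"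
proof (rule measure_eqI)
  fix A assume "A \<in> sets (distr (hyp_measure u) borel ((+) w))"
  then have [measurable]: "A \<in> sets borel" by simp
  have "emeasure (hyp_measure u) A = (\<integral>\<^sup>+x. indicator A x \<partial>hyp_measure u)" by simp
  also have "\<dots> = (\<integral>\<^sup>+x. indicator {x. 0 \<le> u \<bullet> x \<and> u \<bullet> x \<le> 1} x * indicator A (x - (u \<bullet> x) *\<^sub>R u) \<partial>lborel)"
    by (rule nn_integral_hyp_measure) simp
  also have "\<dots> = (\<integral>\<^sup>+x. indicator {x. 0 \<le> u \<bullet> x \<and> u \<bullet> x \<le> 1} x * indicator A (w + (x - (u \<bullet> x) *\<^sub>R u)) \<partial>lborel)"
    apply (subst lborel_distr_plus[of w, symmetric])
    apply (subst nn_integral_distr)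
      apply measurable
    by (intro nn_integral_cong) (simp add: indicator_def inner_add_right w add_diff_eq)
  also have "\<dots> = (\<integral>\<^sup>+x. indicator A (w + x) \<partial>hyp_measure u)"
    by (rule nn_integral_hyp_measure[symmetric]) simp
  also have "\<dots> = (\<integral>\<^sup>+x. indicator A x \<partial>distr (hyp_measure u) borel ((+) w))"
    by (subst nn_integral_distr) auto
  also have "\<dots> = emeasure (distr (hyp_measure u) borel ((+) w)) A" by simp
  finally show "emeasure (distr (hyp_measure u) borel ((+) w)) A = emeasure (hyp_measure u) A" ..
qed simp

lemma emeasure_hyp_measure_bounded:
  assumes u: "norm u = 1" and A: "A \<in> sets borel" "bounded A"
  shows "emeasure (hyp_measure u) A < \<infinity>"
proof -
  obtain r where r: "\<And>x. x \<in> A \<Longrightarrow> norm x \<le> r"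
    using A(2) by (auto simp: bounded_iff)
  have "{x. 0 \<le> u \<bullet> x \<and> u \<bullet> x \<le> 1 \<and> x - (u \<bullet> x) *\<^sub>R u \<in> A} \<subseteq> cball 0 (r + 1)"
  proof
    fix x assume x: "x \<in> {x. 0 \<le> u \<bullet> x \<and> u \<bullet> x \<le> 1 \<and> x - (u \<bullet> x) *\<^sub>R u \<in> A}"
    have "norm x \<le> norm (x - (u \<bullet> x) *\<^sub>R u) + norm ((u \<bullet> x) *\<^sub>R u)"
      by (metis diff_add_cancel norm_triangle_ineq)
    also have "\<dots> \<le> r + 1" using x u by (intro add_mono r) auto
    finally show "x \<in> cball 0 (r + 1)" by simp
  qed
  then have "emeasure (hyp_measure u) A \<le> emeasure lborel (cball (0::'a) (r + 1))"
    using A(1) by (subst emeasure_hyp_measure) (auto intro!: emeasure_mono)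
  also have "\<dots> < \<infinity>" using emeasure_lborel_cball_finite by (simp add: less_top)
  finally show ?thesis .
qed

lemma AE_hyp_measure_orthogonal:
  assumes u: "norm u = 1"
  shows "AE x in hyp_measure u. u \<bullet> x = 0"
proof -
  have "u \<bullet> u = 1" using u by (simp add: norm_eq_1)
  then have "u \<bullet> (x - (u \<bullet> x) *\<^sub>R u) = 0" for x by (simp add: inner_diff_right)
  then show ?thesis unfolding hyp_measure_def by (subst AE_distr_iff) auto
qed

lemma dim_hyperplane_0:
  fixes u :: "'a::euclidean_space"
  assumes "norm u = 1"
  shows "dim {x. u \<bullet> x = 0} = DIM('a) - 1"
  using assms by (intro dim_hyperplane) auto

lemma emeasure_hyp_measure_cball:
  fixes u :: "'a::euclidean_space"
  assumes u: "norm u = 1"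
  shows "emeasure (hyp_measure u) (cball 0 1) = ennreal (unit_ball_vol (real (DIM('a) - 1)))"
proof -
  let ?V = "{x. u \<bullet> x = 0}"
  define B where "B = (SOME B. orthonormal_basis_of ?V B)"
  have "subspace ?V" by (simp add: subspace_hyperplane)
  then obtain B' where "pairwise orthogonal B'" "\<And>x. x \<in> B' \<Longrightarrow> norm x = 1" "span B' = ?V"
    using orthonormal_basis_subspace by metis
  then have "orthonormal_basis_of ?V B'" by (auto simp: orthonormal_basis_of_def)
  then have B: "orthonormal_basis_of ?V B" unfolding B_def by (rule someI)
  then have orth: "pairwise orthogonal B" and norm1: "\<And>b. b \<in> B \<Longrightarrow> norm b = 1" and sp: "span B = ?V"
    by (auto simp: orthonormal_basis_of_def)
  have ind: "independent B"
    using orth norm1 by (intro pairwise_orthogonal_independent) (auto dest: norm1)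
  then have fin: "finite B" by (rule independent_imp_finite)
  have card: "card B = DIM('a) - 1"
    using ind sp dim_hyperplane_0[OF u] dim_span_eq_card_independent[OF ind] by simp
  have ip: "b \<bullet> b' = (if b = b' then 1 else 0)" if "b \<in> B" "b' \<in> B" for b b'
    using that orth norm1 by (auto simp: pairwise_def orthogonal_def norm_eq_1)
  let ?P = "\<Pi>\<^sub>M b\<in>B. (lborel :: real measure)"
  let ?s = "\<lambda>c. \<Sum>b\<in>B. c b *\<^sub>R b"
  have [measurable]: "?s \<in> borel_measurable ?P" by measurable
  have nm: "norm (?s c) = sqrt (\<Sum>b\<in>B. (c b)\<^sup>2)" for c
  proof -
    have "?s c \<bullet> ?s c = (\<Sum>b\<in>B. \<Sum>b'\<in>B. if b = b' then (c b)\<^sup>2 else 0)"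
      unfolding inner_sum_left inner_sum_right
      by (intro sum.cong refl) (simp add: ip power2_eq_square)
    then show ?thesis using fin by (simp add: norm_eq_sqrt_inner)
  qed
  have "hyp_measure u = distr ?P borel ?s"
    using subspace_lborel_hyperplane[OF u] by (simp add: subspace_lborel_def B_def Let_def)
  then have "emeasure (hyp_measure u) (cball 0 1) = emeasure ?P (?s -` cball 0 1 \<inter> space ?P)"
    by (simp add: emeasure_distr)
  also have "?s -` cball 0 1 \<inter> space ?P = {f. sqrt (\<Sum>i\<in>B. (f i)\<^sup>2) \<le> 1} \<inter> space ?P"
    by (auto simp: nm simp del: real_sqrt_le_1_iff)
  also have "emeasure ?P \<dots> = ennreal (unit_ball_vol (real (DIM('a) - 1)))"
    using emeasure_cball_aux[OF fin, of 1] card by simp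
  finally show ?thesis .
qed

section \<open>Surface measure and Steiner points\<close>

text \<open>For \<open>a = 0\<close> this is the identity, so that swapping two vectors of equal
  norm includes the case that they coincide.\<close>

definition reflection :: "'a::real_inner \<Rightarrow> 'a \<Rightarrow> 'a" where
  "reflection a x = x - (2 * (a \<bullet> x) / (a \<bullet> a)) *\<^sub>R a"

lemma orthogonal_transformation_reflection: "orthogonal_transformation (reflection a)"
proof -
  have "linear (reflection a)"
    by (auto intro!: linearI simp: reflection_def inner_add_right algebra_simps add_divide_distrib)
  moreover have "reflection a v \<bullet> reflection a w = v \<bullet> w" for v w
    by (cases "a = 0")
      (simp_all add: reflection_def inner_diff_left inner_diff_right inner_commute field_simps)
  ultimately show ?thesis by (simp add: orthogonal_transformation_def)
qed

lemma reflection_orthogonal: "a \<bullet> x = 0 \<Longrightarrow> reflection a x = x"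
  by (simp add: reflection_def)

lemma reflection_self: "reflection a a = - a"
  by (cases "a = 0") (simp_all add: reflection_def algebra_simps flip: scaleR_2)

lemma reflection_swap:
  assumes "norm a = norm b"
  shows "reflection (a - b) a = b"
proof (cases "a = b")
  case False
  have "a \<bullet> a = b \<bullet> b" using assms by (simp add: dot_square_norm)
  then have "(a - b) \<bullet> (a - b) = 2 * ((a - b) \<bullet> a)"
    by (simp add: inner_diff_left inner_diff_right inner_commute)
  moreover have "(a - b) \<bullet> (a - b) \<noteq> 0" using False by simp
  ultimately show ?thesis by (simp add: reflection_def)
qed (simp add: reflection_def)

lemma inner_reflection_left: "reflection a x \<bullet> y = x \<bullet> reflection a y"
  by (simp add: reflection_def inner_diff_left inner_diff_right inner_commute)

text \<open>On this line the projection along \<open>u\<close> vanishes and \<open>sgn\<close> is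
  discontinuous. In dimension one the line is everything, but there the surface measure is
  zero.\<close>

lemma negligible_line:
  fixes u :: "'a::euclidean_space"
  assumes "DIM('a) \<noteq> 1"
  shows "negligible (span {u})"
proof -
  have "dim {u} \<le> 1" using dim_le_card[of "{u}" "{u}"] by (auto simp: span_base)
  then have "dim (span {u}) \<le> 1" by (simp only: dim_span)
  then have "dim (span {u}) < DIM('a)" using assms DIM_positive[where 'a='a] by linarith
  then show ?thesis by (rule negligible_lowdim)
qed

lemma sets_sphere_measure [simp, measurable_cong]: "sets (sphere_measure V) = sets borel"
  by (simp add: sphere_measure_def)

lemma space_sphere_measure [simp]: "space (sphere_measure V) = UNIV"
  by (simp add: sphere_measure_def space_scale_measure)

context
  fixes u :: "'a::euclidean_space"
  assumes u: "norm u = 1"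
begin

lemma emeasure_sphere_measure:
  assumes [measurable]: "A \<in> sets borel"
  shows "emeasure (sphere_measure {x. u \<bullet> x = 0}) A =
    of_nat (DIM('a) - 1) * emeasure (hyp_measure u) {x. norm x \<le> 1 \<and> sgn x \<in> A}"
proof -
  have [measurable]: "cball (0::'a) 1 \<in> sets borel" by (intro borel_closed closed_cball)
  have [measurable]: "(sgn :: 'a \<Rightarrow> 'a) \<in> borel_measurable borel"
    unfolding sgn_div_norm[abs_def] by measurable
  have "emeasure (distr (density (hyp_measure u) (indicator (cball 0 1))) borel sgn) A =
     emeasure (density (hyp_measure u) (indicator (cball 0 1))) (sgn -` A)"
    by (subst emeasure_distr) simp_all
  also have "\<dots> = (\<integral>\<^sup>+x. indicator (cball 0 1) x * indicator (sgn -` A) x \<partial>hyp_measure u)"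
    using measurable_sets[of sgn borel borel A] by (intro emeasure_density) simp_all
  also have "\<dots> = (\<integral>\<^sup>+x. indicator {x. norm x \<le> 1 \<and> sgn x \<in> A} x \<partial>hyp_measure u)"
    by (intro nn_integral_cong) (auto simp: indicator_def)
  also have "\<dots> = emeasure (hyp_measure u) {x. norm x \<le> 1 \<and> sgn x \<in> A}"
    by (intro nn_integral_indicator) measurable
  finally show ?thesis
    by (simp add: sphere_measure_def subspace_lborel_hyperplane[OF u] dim_hyperplane_0[OF u])
qed

lemma integral_sphere_measure:
  fixes g :: "'a \<Rightarrow> 'b::{banach, second_countable_topology}"
  assumes [measurable]: "g \<in> borel_measurable borel"
  shows "(LINT v|sphere_measure {x. u \<bullet> x = 0}. g v) =
    real (DIM('a) - 1) *\<^sub>R (LINT x|hyp_measure u. indicat_real (cball 0 1) x *\<^sub>R g (sgn x))"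
proof -
  have [measurable]: "cball (0::'a) 1 \<in> sets borel" by (intro borel_closed closed_cball)
  have [measurable]: "(sgn :: 'a \<Rightarrow> 'a) \<in> borel_measurable borel"
    unfolding sgn_div_norm[abs_def] by measurable
  let ?D = "distr (density (hyp_measure u) (indicator (cball 0 1))) borel sgn"
  have "sphere_measure {x. u \<bullet> x = 0} = density ?D (\<lambda>_. ennreal (real (DIM('a) - 1)))"
    by (rule measure_eqI)
      (simp_all add: sphere_measure_def subspace_lborel_hyperplane[OF u] dim_hyperplane_0[OF u]
        emeasure_density nn_integral_cmult_indicator ennreal_of_nat_eq_real_of_nat)
  then have "(LINT v|sphere_measure {x. u \<bullet> x = 0}. g v) = real (DIM('a) - 1) *\<^sub>R (LINT v|?D. g v)"
    by (simp add: integral_density)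
  also have "(LINT v|?D. g v) = (LINT x|density (hyp_measure u) (\<lambda>x. ennreal (indicat_real (cball 0 1) x)). g (sgn x))"
    by (subst integral_distr) (simp_all add: ennreal_indicator)
  also have "\<dots> = (LINT x|hyp_measure u. indicat_real (cball 0 1) x *\<^sub>R g (sgn x))"
    by (rule integral_density) auto
  finally show ?thesis .
qed

end

text \<open>\<open>T\<close> commutes with \<open>sgn\<close> and preserves the unit ball, so it
  carries the cone construction along.\<close>

lemma distr_sphere_measure_orthogonal:
  fixes T :: "'a::euclidean_space \<Rightarrow> 'a"
  assumes u: "norm u = 1" and T: "orthogonal_transformation T"
  shows "distr (sphere_measure {x. u \<bullet> x = 0}) borel T = sphere_measure {x. T u \<bullet> x = 0}"
proof (rule measure_eqI)
  fix A assume "A \<in> sets (distr (sphere_measure {x. u \<bullet> x = 0}) borel T)"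
  then have [measurable]: "A \<in> sets borel" by simp
  have lin: "linear T" using T by (rule orthogonal_transformation_linear)
  have [measurable]: "T \<in> borel_measurable borel"
    by (intro borel_measurable_continuous_onI linear_continuous_on linear_conv_bounded_linear[THEN iffD1] lin)
  have nT: "norm (T x) = norm x" for x using T by (rule orthogonal_transformation_norm)
  have sT: "sgn (T x) = T (sgn x)" for x by (simp add: sgn_div_norm nT linear_scale[OF lin])
  have [measurable]: "(sgn :: 'a \<Rightarrow> 'a) \<in> borel_measurable borel"
    unfolding sgn_div_norm[abs_def] by measurable
  have [measurable]: "T -` A \<in> sets borel"
    using measurable_sets[of T borel borel A] by simp
  have Tu: "norm (T u) = 1" using u nT by simp
  have "emeasure (hyp_measure (T u)) {x. norm x \<le> 1 \<and> sgn x \<in> A} =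
      emeasure (hyp_measure u) {x. norm x \<le> 1 \<and> sgn x \<in> T -` A}"
    by (subst distr_hyp_measure_orthogonal[OF T, symmetric], subst emeasure_distr)
      (simp_all add: vimage_def nT sT)
  then show "emeasure (distr (sphere_measure {x. u \<bullet> x = 0}) borel T) A = emeasure (sphere_measure {x. T u \<bullet> x = 0}) A"
    using emeasure_sphere_measure[OF u, of "T -` A"] emeasure_sphere_measure[OF Tu, of A]
    by (simp add: emeasure_distr)
qed simp


context
  fixes u :: "'a::euclidean_space"
  assumes u: "norm u = 1"
begin


lemma emeasure_sphere_measure_UNIV: "emeasure (sphere_measure {x. u \<bullet> x = 0}) UNIV = ennreal (real (DIM('a) - 1) * unit_ball_vol (real (DIM('a) - 1)))"
proof -
  have "emeasure (sphere_measure {x. u \<bullet> x = 0}) UNIV = of_nat (DIM('a) - 1) * emeasure (hyp_measure u) (cball 0 1)"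
    by (subst emeasure_sphere_measure[OF u]) (auto intro!: arg_cong2[where f="(*)"] arg_cong2[where f=emeasure])
  then show ?thesis
    by (simp add: emeasure_hyp_measure_cball[OF u] ennreal_of_nat_eq_real_of_nat ennreal_mult)
qed

lemma finite_measure_sphere_measure: "finite_measure (sphere_measure {x. u \<bullet> x = 0})"
  by (rule finite_measureI) (simp add: emeasure_sphere_measure_UNIV)

lemma AE_sphere_measure_orthogonal: "AE v in sphere_measure {x. u \<bullet> x = 0}. u \<bullet> v = 0"
proof (rule AE_I')
  have "AE x in hyp_measure u. \<not> (norm x \<le> 1 \<and> u \<bullet> sgn x \<noteq> 0)"
    using AE_hyp_measure_orthogonal[OF u] by eventually_elim (simp add: sgn_div_norm)
  moreover have [measurable]: "(sgn :: 'a \<Rightarrow> 'a) \<in> borel_measurable borel"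
    unfolding sgn_div_norm[abs_def] by measurable
  moreover have "{x. norm x \<le> 1 \<and> sgn x \<in> {v. u \<bullet> v \<noteq> 0}} \<in> sets (hyp_measure u)" by measurable
  ultimately have "emeasure (hyp_measure u) {x. norm x \<le> 1 \<and> sgn x \<in> {v. u \<bullet> v \<noteq> 0}} = 0"
    by (subst (asm) AE_iff_measurable) auto
  then show "{v. u \<bullet> v \<noteq> 0} \<in> null_sets (sphere_measure {x. u \<bullet> x = 0})"
    by (intro null_setsI) (simp_all add: emeasure_sphere_measure[OF u])
qed auto

lemma emeasure_hyp_measure_singleton_0:
  assumes "DIM('a) \<noteq> 1"
  shows "emeasure (hyp_measure u) {0} = 0"
proof -
  have "negligible (span {u})" using assms by (rule negligible_line)
  then have "span {u} \<in> null_sets lborel"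
    by (simp add: negligible_iff_null_sets null_sets_completion_iff closed_span)
  moreover have "{x. 0 \<le> u \<bullet> x \<and> u \<bullet> x \<le> 1 \<and> x - (u \<bullet> x) *\<^sub>R u \<in> {0}} \<subseteq> span {u}"
    by (auto simp: span_singleton)
  moreover have "{x. 0 \<le> u \<bullet> x \<and> u \<bullet> x \<le> 1 \<and> x - (u \<bullet> x) *\<^sub>R u \<in> {0}} \<in> sets lborel"
    by measurable
  ultimately have "{x. 0 \<le> u \<bullet> x \<and> u \<bullet> x \<le> 1 \<and> x - (u \<bullet> x) *\<^sub>R u \<in> {0}} \<in> null_sets lborel"
    by (blast intro: null_sets_subset)
  then show ?thesis by (subst emeasure_hyp_measure) auto
qed

text \<open>The only value of \<open>sgn\<close> off the unit sphere is 0, taken at 0, where the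
  projected slab has no mass. In dimension one it has mass there, but the factor
  \<open>DIM('a) - 1\<close> is zero.\<close>

lemma AE_sphere_measure_norm: "AE v in sphere_measure {x. u \<bullet> x = 0}. norm v = 1"
proof (rule AE_I')
  have "emeasure (sphere_measure {x. u \<bullet> x = 0}) {v. norm v \<noteq> 1} = 0"
  proof (cases "DIM('a) = 1")
    case False
    have "{x. norm x \<le> 1 \<and> sgn x \<in> {v::'a. norm v \<noteq> 1}} = {0}"
      by (auto simp: norm_sgn split: if_splits)
    then show ?thesis
      by (subst emeasure_sphere_measure[OF u]) (auto simp: emeasure_hyp_measure_singleton_0[OF False])
  qed (subst emeasure_sphere_measure[OF u], auto)
  then show "{v. norm v \<noteq> 1} \<in> null_sets (sphere_measure {x. u \<bullet> x = 0})" by (intro null_setsI) auto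
qed auto

lemma emeasure_hyp_measure_open_pos:
  assumes U: "open U" and x: "x \<in> U" "u \<bullet> x = 0"
  shows "emeasure (hyp_measure u) U \<noteq> 0"
proof -
  define W where "W = {x. 0 < u \<bullet> x} \<inter> {x. u \<bullet> x < 1} \<inter> (\<lambda>x. x - (u \<bullet> x) *\<^sub>R u) -` U"
  have "open ((\<lambda>x. x - (u \<bullet> x) *\<^sub>R u) -` U)"
    using U by (intro open_vimage continuous_intros)
  then have "open W" unfolding W_def
    by (intro open_Int open_halfspace_gt open_halfspace_lt)
  \<comment> \<open>Halfway up the slab, strictly between its two faces.\<close>
  moreover have "x + (1/2) *\<^sub>R u \<in> W"
    using x u by (simp add: W_def inner_add_right norm_eq_1 dot_square_norm)
  ultimately have "W \<notin> null_sets lborel"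
    using open_not_negligible[of W] by (auto simp: negligible_iff_null_sets null_sets_completion_iff)
  moreover have "W \<in> sets lborel" using \<open>open W\<close> by simp
  ultimately have "emeasure lborel W \<noteq> 0" by auto
  moreover have "emeasure lborel W \<le> emeasure (hyp_measure u) U"
  proof -
    have [measurable]: "U \<in> sets borel" using U by simp
    have "{x. 0 \<le> u \<bullet> x \<and> u \<bullet> x \<le> 1 \<and> x - (u \<bullet> x) *\<^sub>R u \<in> U} \<in> sets lborel" by measurable
    then show ?thesis by (subst emeasure_hyp_measure) (auto intro!: emeasure_mono simp: W_def)
  qed
  ultimately show ?thesis by auto
qed

lemma emeasure_sphere_measure_open_pos:
  assumes U: "open U" and x: "x \<in> U" "u \<bullet> x = 0" "norm x = 1"
  shows "emeasure (sphere_measure {x. u \<bullet> x = 0}) U \<noteq> 0"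
proof -
  define W where "W = ball 0 1 \<inter> (sgn -` U \<inter> (- {0::'a}))"
  have "continuous_on (- {0::'a}) sgn" by (intro continuous_on_sgn continuous_on_id) auto
  then have "open (sgn -` U \<inter> - {0::'a})"
    using U by (rule continuous_on_open_vimage[THEN iffD1, rule_format, rotated]) auto
  then have "open W" unfolding W_def by auto
  \<comment> \<open>Inside the open unit ball and away from the discontinuity of \<open>sgn\<close>
    at 0.\<close>
  moreover have "(1/2) *\<^sub>R x \<in> W" using x by (auto simp: W_def sgn_div_norm)
  moreover have "u \<bullet> ((1/2) *\<^sub>R x) = 0" using x by simp
  ultimately have "emeasure (hyp_measure u) W \<noteq> 0"
    by (rule emeasure_hyp_measure_open_pos)
  moreover have [measurable]: "(sgn :: 'a \<Rightarrow> 'a) \<in> borel_measurable borel"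
    unfolding sgn_div_norm[abs_def] by measurable
  have [measurable]: "U \<in> sets borel" using U by simp
  have "{x. norm x \<le> 1 \<and> sgn x \<in> U} \<in> sets borel" by measurable
  then have "emeasure (hyp_measure u) W \<le> emeasure (hyp_measure u) {x. norm x \<le> 1 \<and> sgn x \<in> U}"
    by (intro emeasure_mono) (auto simp: W_def)
  moreover have "DIM('a) \<noteq> 1"
  proof
    assume "DIM('a) = 1"
    then have "dim {x. u \<bullet> x = 0} = 0" using dim_hyperplane_0[OF u] by simp
    then have "x = 0" using x by (auto simp: dim_eq_0)
    then show False using x by simp
  qed
  then have "DIM('a) - 1 \<noteq> 0" using DIM_positive[where 'a='a] by linarith
  ultimately show ?thesis
    using U by (subst emeasure_sphere_measure[OF u]) (auto simp del: diff_is_0_eq)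
qed

end

lemma integrable_sphere_measure:
  fixes g :: "'a::euclidean_space \<Rightarrow> 'b::{banach, second_countable_topology}"
  assumes u: "norm u = 1" and [measurable]: "g \<in> borel_measurable borel"
    and B: "\<And>v. norm v = 1 \<Longrightarrow> norm (g v) \<le> B"
  shows "integrable (sphere_measure {x. u \<bullet> x = 0}) g"
proof -
  interpret finite_measure "sphere_measure {x. u \<bullet> x = 0}"
    by (rule finite_measure_sphere_measure[OF u])
  have "AE v in sphere_measure {x. u \<bullet> x = 0}. norm (g v) \<le> B"
    using AE_sphere_measure_norm[OF u] by eventually_elim (rule B)
  then show ?thesis by (rule integrable_const_bound) simp
qed

lemma integral_sphere_measure_orthogonal:
  fixes T :: "'a::euclidean_space \<Rightarrow> 'a" and g :: "'a \<Rightarrow> 'b::{banach, second_countable_topology}"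
  assumes u: "norm u = 1" and T: "orthogonal_transformation T" and [measurable]: "g \<in> borel_measurable borel"
  shows "(LINT v|sphere_measure {x. T u \<bullet> x = 0}. g v) = (LINT v|sphere_measure {x. u \<bullet> x = 0}. g (T v))"
proof -
  have "linear T" using T by (rule orthogonal_transformation_linear)
  then have [measurable]: "T \<in> borel_measurable borel"
    by (intro borel_measurable_continuous_onI linear_continuous_on linear_conv_bounded_linear[THEN iffD1])
  show ?thesis
    unfolding distr_sphere_measure_orthogonal[OF u T, symmetric] by (rule integral_distr) simp_all
qed

section \<open>Steiner points in a fixed hyperplane\<close>

lemma direction_space_hyperplane:
  fixes u :: "'a::euclidean_space"
  assumes u: "norm u = 1"
  shows "direction_space {x. u \<bullet> x = t} = {x. u \<bullet> x = 0}"
proof -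
  have uu: "u \<bullet> u = 1" using u by (simp add: norm_eq_1)
  have "x \<in> direction_space {x. u \<bullet> x = t}" if "u \<bullet> x = 0" for x
    unfolding direction_space_def
    by (rule CollectI, rule exI[of _ "t *\<^sub>R u + x"], rule exI[of _ "t *\<^sub>R u"])
       (simp add: that uu inner_add_right)
  then show ?thesis by (auto simp: direction_space_def inner_diff_right)
qed

lemma ex_orthonormal_basis_hyperplane:
  fixes u :: "'a::euclidean_space"
  assumes u: "norm u = 1"
  obtains B where "finite B" "card B = DIM('a) - 1" "span B = {x. u \<bullet> x = 0}"
    "\<And>b b'. b \<in> B \<Longrightarrow> b' \<in> B \<Longrightarrow> b \<bullet> b' = (if b = b' then 1 else 0)"
    "\<And>x. u \<bullet> x = 0 \<Longrightarrow> (\<Sum>b\<in>B. (x \<bullet> b) *\<^sub>R b) = x"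
proof -
  have "subspace {x. u \<bullet> x = 0}" by (simp add: subspace_hyperplane)
  then obtain B where B: "pairwise orthogonal B" "\<And>x. x \<in> B \<Longrightarrow> norm x = 1"
    "independent B" "card B = dim {x. u \<bullet> x = 0}" "span B = {x. u \<bullet> x = 0}"
    using orthonormal_basis_subspace by metis
  have fin: "finite B" using B by (simp add: independent_imp_finite)
  show ?thesis
  proof (rule that[of B])
    show "b \<bullet> b' = (if b = b' then 1 else 0)" if "b \<in> B" "b' \<in> B" for b b'
      using that B by (auto simp: pairwise_def orthogonal_def norm_eq_1)
    show "(\<Sum>b\<in>B. (x \<bullet> b) *\<^sub>R b) = x" if "u \<bullet> x = 0" for x
      using that B fin by (intro orthonormal_basis_expand) auto
  qed (use B fin dim_hyperplane_0[OF u] in auto)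
qed

context
  fixes u :: "'a::euclidean_space"
  assumes u: "norm u = 1"
begin

text \<open>On the hyperplane the form \<open>J\<close> is invariant under reflections, hence a
  multiple of the inner product. Its trace is the surface area, which is the dimension times the
  volume of the unit ball, so the factor is that volume.\<close>

lemma integral_sphere_measure_inner_inner:
  assumes w: "u \<bullet> w = 0"
  shows "(LINT v|sphere_measure {x. u \<bullet> x = 0}. (w \<bullet> v) *\<^sub>R v) = unit_ball_vol (real (DIM('a) - 1)) *\<^sub>R w"
proof -
  let ?\<sigma> = "sphere_measure {x. u \<bullet> x = 0}" and ?k = "unit_ball_vol (real (DIM('a) - 1))"
  define J where "J a b = (LINT v|?\<sigma>. (a \<bullet> v) * (b \<bullet> v))" for a b
  have int: "integrable ?\<sigma> (\<lambda>v. (a \<bullet> v) * (b \<bullet> v))" for a b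
  proof (rule integrable_sphere_measure[OF u])
    fix v :: 'a assume "norm v = 1"
    then have "\<bar>a \<bullet> v\<bar> * \<bar>b \<bullet> v\<bar> \<le> norm a * norm b"
      using Cauchy_Schwarz_ineq2[of a v] Cauchy_Schwarz_ineq2[of b v] by (intro mult_mono) auto
    then show "norm ((a \<bullet> v) * (b \<bullet> v)) \<le> norm a * norm b" by (simp add: abs_mult)
  qed measurable
  have J_refl: "J (reflection c a) (reflection c b) = J a b" if "u \<bullet> c = 0" for a b c
  proof -
    have "reflection c u = u" using that by (intro reflection_orthogonal) (simp add: inner_commute)
    then show ?thesis
      unfolding J_def
      using integral_sphere_measure_orthogonal[OF u orthogonal_transformation_reflection[of c], of "\<lambda>v. (a \<bullet> v) * (b \<bullet> v)"]
      by (simp add: inner_reflection_left)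
  qed
  obtain B where B: "finite B" "card B = DIM('a) - 1" "span B = {x. u \<bullet> x = 0}"
    and ip: "\<And>b b'. b \<in> B \<Longrightarrow> b' \<in> B \<Longrightarrow> b \<bullet> b' = (if b = b' then 1 else 0)"
    and ex: "\<And>x. u \<bullet> x = 0 \<Longrightarrow> (\<Sum>b\<in>B. (x \<bullet> b) *\<^sub>R b) = x"
    by (rule ex_orthonormal_basis_hyperplane[OF u]) blast
  have uB: "u \<bullet> b = 0" if "b \<in> B" for b using span_base[OF that] B(3) by auto
  \<comment> \<open>Reflecting in \<open>b\<close> changes the sign of \<open>b\<close> and fixes
    \<open>b'\<close>.\<close>
  have J0: "J b b' = 0" if "b \<in> B" "b' \<in> B" "b \<noteq> b'" for b b'
  proof -
    have "J (reflection b b) (reflection b b') = J b b'" using that uB by (intro J_refl)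
    moreover have "reflection b b' = b'" using that ip by (intro reflection_orthogonal) auto
    moreover have "J (- b) b' = - J b b'" by (simp add: J_def)
    ultimately show ?thesis by (simp add: reflection_self)
  qed
  have J_eq: "J b b = J b' b'" if "b \<in> B" "b' \<in> B" for b b'
  proof -
    have "J (reflection (b - b') b) (reflection (b - b') b) = J b b"
      using that uB by (intro J_refl) (simp add: inner_diff_right)
    moreover have "reflection (b - b') b = b'"
      using that ip by (intro reflection_swap) (simp add: norm_eq_sqrt_inner)
    ultimately show ?thesis by simp
  qed
  \<comment> \<open>By Parseval the diagonal integrands add up to 1 on unit vectors of the
    hyperplane, so their common integral is the total mass divided by the dimension.\<close>
  have J1: "J b b = ?k" if "b \<in> B" for b
  proof -
    have "real (DIM('a) - 1) * J b b = (\<Sum>b'\<in>B. J b b)" unfolding B(2)[symmetric] by simp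
    also have "\<dots> = (\<Sum>b'\<in>B. J b' b')" by (intro sum.cong refl J_eq that)
    also have "\<dots> = (LINT v|?\<sigma>. (\<Sum>b'\<in>B. (b' \<bullet> v) * (b' \<bullet> v)))"
      unfolding J_def using int by (simp add: Bochner_Integration.integral_sum)
    also have "\<dots> = (LINT v|?\<sigma>. 1)"
    proof (rule integral_cong_AE)
      show "AE v in ?\<sigma>. (\<Sum>b'\<in>B. (b' \<bullet> v) * (b' \<bullet> v)) = 1"
        using AE_sphere_measure_norm[OF u] AE_sphere_measure_orthogonal[OF u]
      proof eventually_elim
        case (elim v)
        have "v \<bullet> v = (\<Sum>b\<in>B. (v \<bullet> b) *\<^sub>R b) \<bullet> v" using ex[of v] elim by simp
        also have "\<dots> = (\<Sum>b'\<in>B. (b' \<bullet> v) * (b' \<bullet> v))"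
          unfolding inner_sum_left inner_scaleR_left by (intro sum.cong refl) (simp add: inner_commute)
        finally show ?case using elim by (simp add: dot_square_norm)
      qed
    qed measurable
    also have "\<dots> = measure ?\<sigma> UNIV" by simp
    also have "\<dots> = real (DIM('a) - 1) * ?k"
      using emeasure_sphere_measure_UNIV[OF u] by (simp add: measure_def)
    finally have "real (DIM('a) - 1) * J b b = real (DIM('a) - 1) * ?k" .
    moreover have "DIM('a) - 1 \<noteq> 0" using B(1,2) that by (metis card_0_eq empty_iff)
    ultimately show ?thesis by (metis mult_cancel_left of_nat_eq_0_iff)
  qed
  have intv: "integrable ?\<sigma> (\<lambda>v. (w \<bullet> v) *\<^sub>R v)"
  proof (rule integrable_sphere_measure[OF u])
    fix v :: 'a assume "norm v = 1"
    then show "norm ((w \<bullet> v) *\<^sub>R v) \<le> norm w"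
      using Cauchy_Schwarz_ineq2[of w v] by simp
  qed measurable
  define z where "z = (LINT v|?\<sigma>. (w \<bullet> v) *\<^sub>R v)"
  have z: "z \<bullet> b = J w b" for b
  proof -
    have "b \<bullet> z = (LINT v|?\<sigma>. b \<bullet> ((w \<bullet> v) *\<^sub>R v))"
      unfolding z_def by (rule integral_inner_right[symmetric]) (rule intv)
    then show ?thesis by (simp add: J_def inner_commute[of z b])
  qed
  \<comment> \<open>The integral stays in the hyperplane, so it can be expanded in
    \<open>B\<close>.\<close>
  have "J w u = 0"
  proof -
    have "J w u = (LINT v|?\<sigma>. 0)" unfolding J_def
      using AE_sphere_measure_orthogonal[OF u] by (intro integral_cong_AE) (auto elim: eventually_mono)
    then show ?thesis by simp
  qed
  then have "u \<bullet> z = 0" using z[of u] by (simp add: inner_commute)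
  then have "z = (\<Sum>b\<in>B. (z \<bullet> b) *\<^sub>R b)" using ex by simp
  also have "\<dots> = (\<Sum>b\<in>B. (?k * (w \<bullet> b)) *\<^sub>R b)"
  proof (rule sum.cong[OF refl])
    fix b assume b: "b \<in> B"
    have "J w b = J (\<Sum>b'\<in>B. (w \<bullet> b') *\<^sub>R b') b" using ex[OF w] by simp
    also have "\<dots> = (LINT v|?\<sigma>. (\<Sum>b'\<in>B. (w \<bullet> b') * ((b' \<bullet> v) * (b \<bullet> v))))"
      unfolding J_def by (simp add: inner_sum_left sum_distrib_right mult.assoc)
    also have "\<dots> = (\<Sum>b'\<in>B. (w \<bullet> b') * J b' b)"
      unfolding J_def using int by (subst Bochner_Integration.integral_sum) auto
    also have "\<dots> = (\<Sum>b'\<in>B. if b' = b then (w \<bullet> b) * ?k else 0)"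
      by (intro sum.cong refl) (use b J0 J1 in auto)
    also have "\<dots> = ?k * (w \<bullet> b)" using B b by simp
    finally show "(z \<bullet> b) *\<^sub>R b = (?k * (w \<bullet> b)) *\<^sub>R b" by (simp add: z)
  qed
  also have "\<dots> = ?k *\<^sub>R w" using ex[OF w] by (simp flip: scaleR_sum_right scaleR_scaleR)
  finally show ?thesis by (simp add: z_def)
qed

context
  fixes C :: "'a set"
  assumes C: "compact C" "C \<noteq> {}"
begin

lemmas [measurable] = borel_measurable_support_function[OF C]

lemma support_function_bounded:
  obtains R where "R \<ge> 0" "\<And>v. \<bar>support_function C v\<bar> \<le> R * norm v"
proof -
  obtain R where R: "R > 0" "\<And>x. x \<in> C \<Longrightarrow> norm x \<le> R"
    using C(1) compact_imp_bounded by (metis bounded_pos)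
  show ?thesis
    using support_function_lipschitz[OF C R(2), of _ 0] R(1) support_function_0[OF C] by (intro that[of R]) auto
qed

lemma integrable_support_function:
  "integrable (sphere_measure {x. u \<bullet> x = 0}) (\<lambda>v. support_function C v *\<^sub>R v)"
proof -
  obtain R where "R \<ge> 0" "\<And>v. \<bar>support_function C v\<bar> \<le> R * norm v"
    by (rule support_function_bounded) blast
  then show ?thesis
    by (intro integrable_sphere_measure[OF u, where B=R]) (auto, metis mult.right_neutral)
qed

text \<open>By the moment identity the dependence on the origin cancels.\<close>

lemma steiner_point_change_origin:
  assumes p: "u \<bullet> p = t"
  shows "p + (1 / unit_ball_vol (real (DIM('a) - 1))) *\<^sub>R
      (LINT v|sphere_measure {x. u \<bullet> x = 0}. support_function ((\<lambda>x. x - p) ` C) v *\<^sub>R v) =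
    t *\<^sub>R u + (1 / unit_ball_vol (real (DIM('a) - 1))) *\<^sub>R
      (LINT v|sphere_measure {x. u \<bullet> x = 0}. support_function C v *\<^sub>R v)"
proof -
  let ?\<sigma> = "sphere_measure {x. u \<bullet> x = 0}" and ?k = "unit_ball_vol (real (DIM('a) - 1))"
  have uu: "u \<bullet> u = 1" using u by (simp add: norm_eq_1)
  \<comment> \<open>The surface measure sees \<open>p\<close> only through its component along the
    hyperplane; the rest of \<open>p\<close> is \<open>t *\<^sub>R u\<close>.\<close>
  define w where "w = p - t *\<^sub>R u"
  have w: "u \<bullet> w = 0" using p by (simp add: w_def inner_diff_right uu)
  have sf: "support_function ((\<lambda>x. x - p) ` C) v = support_function C v - p \<bullet> v" for v
  proof -
    have c: "compact ((\<lambda>x. x - p) ` C)" "(\<lambda>x. x - p) ` C \<noteq> {}"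
      using C by (auto simp: compact_translation_subtract)
    have "support_function ((\<lambda>x. x - p) ` C) v \<le> support_function C v - p \<bullet> v"
      using support_function_ge[OF C, of _ v] by (intro support_function_le[OF c]) (auto simp: inner_diff_left)
    moreover have "support_function C v \<le> support_function ((\<lambda>x. x - p) ` C) v + p \<bullet> v"
    proof (rule support_function_le[OF C])
      fix x assume "x \<in> C"
      then show "x \<bullet> v \<le> support_function ((\<lambda>x. x - p) ` C) v + p \<bullet> v"
        using support_function_ge[OF c, of "x - p" v] by (auto simp: inner_diff_left)
    qed
    ultimately show ?thesis by simp
  qed
  have intw: "integrable ?\<sigma> (\<lambda>v. (w \<bullet> v) *\<^sub>R v)"
  proof (rule integrable_sphere_measure[OF u])
    fix v :: 'a assume "norm v = 1"
    then show "norm ((w \<bullet> v) *\<^sub>R v) \<le> norm w"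
      using Cauchy_Schwarz_ineq2[of w v] by simp
  qed measurable
  have "(LINT v|?\<sigma>. support_function ((\<lambda>x. x - p) ` C) v *\<^sub>R v) =
     (LINT v|?\<sigma>. support_function C v *\<^sub>R v - (w \<bullet> v) *\<^sub>R v)"
  proof (rule integral_cong_AE)
    show "AE v in ?\<sigma>. support_function ((\<lambda>x. x - p) ` C) v *\<^sub>R v =
       support_function C v *\<^sub>R v - (w \<bullet> v) *\<^sub>R v"
      using AE_sphere_measure_orthogonal[OF u]
      by eventually_elim (simp add: sf w_def inner_diff_left scaleR_diff_left)
  qed (simp_all add: sf)
  also have "\<dots> = (LINT v|?\<sigma>. support_function C v *\<^sub>R v) - ?k *\<^sub>R w"
    using integrable_support_function intw integral_sphere_measure_inner_inner[OF w] by simp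
  finally have I: "(LINT v|?\<sigma>. support_function ((\<lambda>x. x - p) ` C) v *\<^sub>R v) =
    (LINT v|?\<sigma>. support_function C v *\<^sub>R v) - ?k *\<^sub>R w" .
  have k: "(1 / k) *\<^sub>R (y - k *\<^sub>R w) = (1 / k) *\<^sub>R y - w" if "k > 0" for k y
    using that by (simp add: scaleR_diff_right)
  have "p + (1 / ?k) *\<^sub>R (LINT v|?\<sigma>. support_function ((\<lambda>x. x - p) ` C) v *\<^sub>R v) =
      p - w + (1 / ?k) *\<^sub>R (LINT v|?\<sigma>. support_function C v *\<^sub>R v)"
    unfolding I by (subst k) simp_all
  then show ?thesis by (simp add: w_def)
qed

lemma steiner_point_hyperplane:
  assumes p: "u \<bullet> p = t"
  shows "steiner_point {x. u \<bullet> x = t} C = p + (1 / unit_ball_vol (real (DIM('a) - 1))) *\<^sub>R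
    (LINT v|sphere_measure {x. u \<bullet> x = 0}. support_function ((\<lambda>x. x - p) ` C) v *\<^sub>R v)"
proof -
  define p' where "p' = (SOME p. p \<in> {x. u \<bullet> x = t})"
  have "p \<in> {x. u \<bullet> x = t}" using p by simp
  then have "p' \<in> {x. u \<bullet> x = t}" unfolding p'_def by (rule someI)
  then have p': "u \<bullet> p' = t" by simp
  have "steiner_point {x. u \<bullet> x = t} C = p' + (1 / unit_ball_vol (real (DIM('a) - 1))) *\<^sub>R
    (LINT v|sphere_measure {x. u \<bullet> x = 0}. support_function ((\<lambda>x. x - p') ` C) v *\<^sub>R v)"
    unfolding steiner_point_def Let_def direction_space_hyperplane[OF u] dim_hyperplane_0[OF u] p'_def
    by (rule refl)
  then show ?thesis
    unfolding steiner_point_change_origin[OF p] steiner_point_change_origin[OF p'] .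
qed

text \<open>No choice of base point remains in this form and \<open>u\<close> and \<open>t\<close>
  enter explicitly, as limits along moving hyperplanes require.\<close>

lemma steiner_point_hyperplane_0:
  "steiner_point {x. u \<bullet> x = t} C = t *\<^sub>R u + (1 / unit_ball_vol (real (DIM('a) - 1))) *\<^sub>R
    (LINT v|sphere_measure {x. u \<bullet> x = 0}. support_function C v *\<^sub>R v)"
proof -
  have p: "u \<bullet> (t *\<^sub>R u) = t" using u by (simp add: dot_square_norm)
  show ?thesis unfolding steiner_point_hyperplane[OF p] by (rule steiner_point_change_origin[OF p])
qed

text \<open>Pair each \<open>v\<close> with its mirror image \<open>v'\<close> in \<open>e\<close>; since \<open>v - v'\<close> is a multiple of \<open>e\<close>,
  subadditivity of the support function bounds the contribution of the pair.\<close>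

lemma inner_steiner_point:
  assumes e: "u \<bullet> e = 0" "e \<noteq> 0"
  shows "e \<bullet> steiner_point {x. u \<bullet> x = t} C \<le> support_function C e"
    and "0 < support_function C e + support_function C (- e) \<Longrightarrow>
      e \<bullet> steiner_point {x. u \<bullet> x = t} C < support_function C e"
proof -
  let ?\<sigma> = "sphere_measure {x. u \<bullet> x = 0}" and ?k = "unit_ball_vol (real (DIM('a) - 1))"
  define h where "h = support_function C"
  define T where "T = reflection e"
  have T: "orthogonal_transformation T" unfolding T_def by (rule orthogonal_transformation_reflection)
  have Tu: "T u = u" unfolding T_def using e by (intro reflection_orthogonal) (simp add: inner_commute)
  have Tv: "T v = v - (2 * (e \<bullet> v) / (e \<bullet> e)) *\<^sub>R e" for v by (simp add: T_def reflection_def)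
  have eT: "e \<bullet> T v = - (e \<bullet> v)" for v using e by (simp add: Tv inner_diff_right)
  have ee: "e \<bullet> e > 0" using e by simp
  have hm[measurable]: "h \<in> borel_measurable borel" unfolding h_def by measurable
  have Tm[measurable]: "T \<in> borel_measurable borel" unfolding Tv[abs_def] by measurable
  have Tc: "continuous_on UNIV T" unfolding Tv[abs_def] by (intro continuous_intros) (use e in auto)
  have hc: "continuous_on S h" for S unfolding h_def by (rule continuous_on_support_function[OF C])
  obtain R where R: "R \<ge> 0" "\<And>v. \<bar>h v\<bar> \<le> R * norm v"
    unfolding h_def by (rule support_function_bounded) blast
  have ev: "\<bar>e \<bullet> v\<bar> \<le> norm e" if "norm v = 1" for v using Cauchy_Schwarz_ineq2[of e v] that by simp
  have int1: "integrable ?\<sigma> (\<lambda>v. h v * (e \<bullet> v))"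
  proof (rule integrable_sphere_measure[OF u, where B="R * norm e"])
    fix v :: 'a assume "norm v = 1"
    then show "norm (h v * (e \<bullet> v)) \<le> R * norm e"
      using R(2)[of v] ev[of v] R(1) by (auto simp: abs_mult intro!: mult_mono)
  qed measurable
  have int2: "integrable ?\<sigma> (\<lambda>v. h (T v) * (e \<bullet> v))"
  proof (rule integrable_sphere_measure[OF u, where B="R * norm e"])
    fix v :: 'a assume "norm v = 1"
    then show "norm (h (T v) * (e \<bullet> v)) \<le> R * norm e"
      using R(2)[of "T v"] ev[of v] R(1) orthogonal_transformation_norm[OF T, of v]
      by (auto simp: abs_mult intro!: mult_mono)
  qed measurable
  have int3: "integrable ?\<sigma> (\<lambda>v. (e \<bullet> v) * (e \<bullet> v))"
  proof (rule integrable_sphere_measure[OF u, where B="norm e * norm e"])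
    fix v :: 'a assume "norm v = 1"
    then show "norm ((e \<bullet> v) * (e \<bullet> v)) \<le> norm e * norm e"
      using ev[of v] unfolding real_norm_def abs_mult by (intro mult_mono) auto
  qed measurable
  define I where "I = (LINT v|?\<sigma>. h v *\<^sub>R v)"
  have eI: "e \<bullet> I = (LINT v|?\<sigma>. h v * (e \<bullet> v))"
    unfolding I_def h_def using integrable_support_function by (simp flip: integral_inner_right)
  have "(LINT v|?\<sigma>. h v * (e \<bullet> v)) = (LINT v|?\<sigma>. h (T v) * (e \<bullet> T v))"
    using integral_sphere_measure_orthogonal[OF u T, of "\<lambda>v. h v * (e \<bullet> v)"] by (simp add: Tu)
  then have eI2: "e \<bullet> I = - (LINT v|?\<sigma>. h (T v) * (e \<bullet> v))" by (simp add: eI eT)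
  have J: "(LINT v|?\<sigma>. (e \<bullet> v) * (e \<bullet> v)) = ?k * (e \<bullet> e)"
  proof -
    have "integrable ?\<sigma> (\<lambda>v. (e \<bullet> v) *\<^sub>R v)"
    proof (rule integrable_sphere_measure[OF u, where B="norm e"])
      fix v :: 'a assume "norm v = 1"
      then show "norm ((e \<bullet> v) *\<^sub>R v) \<le> norm e" using ev[of v] by simp
    qed measurable
    then have "(LINT v|?\<sigma>. (e \<bullet> v) * (e \<bullet> v)) = e \<bullet> (LINT v|?\<sigma>. (e \<bullet> v) *\<^sub>R v)"
      by (simp flip: integral_inner_right)
    then show ?thesis using integral_sphere_measure_inner_inner[OF e(1)] by simp
  qed
  \<comment> \<open>The moment identity evaluates the integral of the first term. Each of the other
    two terms contributes \<open>- (e \<bullet> I)\<close>, the second of them because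
    \<open>T\<close> preserves the surface measure and reverses
    \<open>e \<bullet> v\<close>.\<close>
  define G where "G v = 2 * h e / (e \<bullet> e) * ((e \<bullet> v) * (e \<bullet> v)) - (h v * (e \<bullet> v) - h (T v) * (e \<bullet> v))" for v
  have intG: "integrable ?\<sigma> G" unfolding G_def using int1 int2 int3 by auto
  have G: "(LINT v|?\<sigma>. G v) = 2 * (?k * h e - e \<bullet> I)"
    unfolding G_def using int1 int2 int3 J eI eI2 ee by simp
  have h_diff: "h a - h b \<le> h (a - b)" for a b
    using support_function_add[OF C, of b "a - b"] by (simp add: h_def)
  have h_scale: "h (a *\<^sub>R v) = a * h v" if "a \<ge> 0" for a v
    using support_function_scale[OF C that] by (simp add: h_def)
  have G0: "G v \<ge> 0" for v
  proof (cases "e \<bullet> v \<ge> 0")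
    case True
    have "h v - h (T v) \<le> h (v - T v)" by (rule h_diff)
    also have "\<dots> = 2 * (e \<bullet> v) / (e \<bullet> e) * h e" using True ee by (simp add: Tv h_scale)
    finally have "(h v - h (T v)) * (e \<bullet> v) \<le> (2 * (e \<bullet> v) / (e \<bullet> e) * h e) * (e \<bullet> v)"
      using True by (rule mult_right_mono)
    then show ?thesis by (simp add: G_def algebra_simps)
  next
    case False
    have "h (T v) - h v \<le> h (T v - v)" by (rule h_diff)
    also have "T v - v = (2 * (- (e \<bullet> v)) / (e \<bullet> e)) *\<^sub>R e" by (simp add: Tv)
    also have "h \<dots> = 2 * (- (e \<bullet> v)) / (e \<bullet> e) * h e" using False ee by (intro h_scale divide_nonneg_nonneg) auto
    finally have "(h (T v) - h v) * (- (e \<bullet> v)) \<le> (2 * (- (e \<bullet> v)) / (e \<bullet> e) * h e) * (- (e \<bullet> v))"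
      using False by (intro mult_right_mono) auto
    then show ?thesis by (simp add: G_def algebra_simps)
  qed
  have "(LINT v|?\<sigma>. G v) \<ge> 0" using G0 by (intro integral_nonneg_AE) auto
  then have le: "e \<bullet> I \<le> ?k * h e" using G by simp
  have s: "e \<bullet> steiner_point {x. u \<bullet> x = t} C = e \<bullet> I / ?k"
  proof -
    have "e \<bullet> u = 0" using e by (simp add: inner_commute)
    then show ?thesis by (simp add: steiner_point_hyperplane_0 inner_add_right I_def h_def)
  qed
  have k: "?k > 0" by simp
  show "e \<bullet> steiner_point {x. u \<bullet> x = t} C \<le> support_function C e"
    using le k by (simp add: s h_def pos_divide_le_eq mult.commute)
  assume pos: "0 < support_function C e + support_function C (- e)"
  have "e \<bullet> I \<noteq> ?k * h e"
  proof
    assume "e \<bullet> I = ?k * h e"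
    then have "(LINT v|?\<sigma>. G v) = 0" using G by simp
    then have "AE v in ?\<sigma>. G v = 0"
      using integral_nonneg_eq_0_iff_AE[OF intG] G0 by simp
    then have ae: "emeasure ?\<sigma> {v. G v > 0} = 0"
    proof -
      have [measurable]: "G \<in> borel_measurable borel" unfolding G_def by measurable
      have "AE v in ?\<sigma>. \<not> (G v > 0)" using \<open>AE v in ?\<sigma>. G v = 0\<close> by eventually_elim simp
      moreover have "{v. G v > 0} \<in> sets ?\<sigma>" by measurable
      ultimately show ?thesis by (subst (asm) AE_iff_measurable) auto
    qed
    have "continuous_on UNIV G" unfolding G_def
      by (intro continuous_intros hc continuous_on_compose2[OF hc Tc]) auto
    then have "open {v. G v > 0}" by (intro open_Collect_less continuous_intros)
    \<comment> \<open>In the direction of \<open>e\<close> the value of \<open>G\<close> is the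
      width \<open>h e + h (- e)\<close>. Equality would make \<open>G\<close> vanish almost
      everywhere, but a neighbourhood of \<open>v0\<close> has positive surface measure.\<close>
    moreover define v0 where "v0 = e /\<^sub>R norm e"
    have "G v0 > 0"
    proof -
      have "T v0 = (1 / norm e) *\<^sub>R T e"
        using linear_scale[OF orthogonal_transformation_linear[OF T], of "1 / norm e" e]
        by (simp add: v0_def divide_inverse)
      then have "T v0 = (1 / norm e) *\<^sub>R (- e)" by (simp only: T_def reflection_self)
      then have "h (T v0) = (1 / norm e) * h (- e)" using h_scale[of "1 / norm e" "- e"] by simp
      moreover have "h v0 = (1 / norm e) * h e" by (simp add: v0_def h_scale divide_inverse)
      moreover have "e \<bullet> v0 = norm e" using e by (simp add: v0_def dot_square_norm power2_eq_square)
      ultimately have "G v0 = h e + h (- e)" using e by (simp add: G_def dot_square_norm power2_eq_square field_simps)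
      then show ?thesis using pos by (simp add: h_def)
    qed
    ultimately have "emeasure ?\<sigma> {v. G v > 0} \<noteq> 0"
      using e by (intro emeasure_sphere_measure_open_pos[OF u, of _ v0]) (auto simp: v0_def)
    then show False using ae by simp
  qed
  then show "e \<bullet> steiner_point {x. u \<bullet> x = t} C < support_function C e"
    using le k by (simp add: s h_def pos_divide_less_eq mult.commute)
qed

lemma steiner_point_on_hyperplane: "u \<bullet> steiner_point {x. u \<bullet> x = t} C = t"
proof -
  let ?\<sigma> = "sphere_measure {x. u \<bullet> x = 0}"
  have "u \<bullet> (LINT v|?\<sigma>. support_function C v *\<^sub>R v) = (LINT v|?\<sigma>. support_function C v * (u \<bullet> v))"
    using integrable_support_function by (simp flip: integral_inner_right)
  also have "\<dots> = (LINT v|?\<sigma>. 0)"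
    using AE_sphere_measure_orthogonal[OF u] by (intro integral_cong_AE) (auto elim: eventually_mono)
  finally show ?thesis using u by (simp add: steiner_point_hyperplane_0 inner_add_right dot_square_norm)
qed

end

end

section \<open>Sections through the interior\<close>

text \<open>Otherwise some \<open>a\<close> separates \<open>s\<close> from the interior. Its
  component \<open>e\<close> along the hyperplane contradicts \<open>out\<close> unless it vanishes;
  then \<open>a\<close> is constant on the hyperplane and would be maximal over \<open>K\<close> at
  the interior point \<open>z\<close>.\<close>

lemma interior_section_criterion:
  fixes K :: "'a::euclidean_space set"
  assumes K: "convex K" and z: "z \<in> interior K" "u \<bullet> z = t" and s: "u \<bullet> s = t" and u: "norm u = 1"
    and out: "\<And>e. e \<noteq> 0 \<Longrightarrow> u \<bullet> e = 0 \<Longrightarrow> \<exists>y\<in>K. u \<bullet> y = t \<and> e \<bullet> s < e \<bullet> y"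
  shows "s \<in> interior K"
proof (rule ccontr)
  assume "s \<notin> interior K"
  moreover have "convex (interior K)" using K by (rule convex_interior)
  ultimately obtain a b where a: "a \<noteq> 0" "a \<bullet> s \<ge> b" "\<And>y. y \<in> interior K \<Longrightarrow> a \<bullet> y \<le> b"
    using separating_hyperplane_sets[of "interior K" "{s}"] z by auto
  have aK: "a \<bullet> y \<le> b" if "y \<in> K" for y
  proof -
    have "closed {y. a \<bullet> y \<le> b}" by (rule closed_halfspace_le)
    moreover have "interior K \<subseteq> {y. a \<bullet> y \<le> b}" using a by auto
    ultimately have "closure (interior K) \<subseteq> {y. a \<bullet> y \<le> b}" by (rule closure_minimal[rotated])
    then show ?thesis using that convex_closure_interior[OF K] z closure_subset[of K] by blast
  qed
  define e where "e = a - (a \<bullet> u) *\<^sub>R u"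
  have uu: "u \<bullet> u = 1" using u by (simp add: norm_eq_1)
  have ue: "u \<bullet> e = 0" by (simp add: e_def inner_diff_right uu inner_commute)
  have ae: "a \<bullet> y = e \<bullet> y + (a \<bullet> u) * (u \<bullet> y)" for y
    by (simp add: e_def inner_diff_left)
  show False
  proof (cases "e = 0")
    case False
    then obtain y where "y \<in> K" "u \<bullet> y = t" "e \<bullet> s < e \<bullet> y" using out ue by blast
    then show False using aK[of y] a(2) ae[of y] ae[of s] s by simp
  next
    case True
    then have as: "a \<bullet> s = a \<bullet> z" using ae[of s] ae[of z] s z by simp
    obtain r where r: "r > 0" "cball z r \<subseteq> K" using z by (auto simp: mem_interior_cball)
    have "z + (r / norm a) *\<^sub>R a \<in> K" using r a by (intro set_mp[OF r(2)]) (auto simp: dist_norm)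
    then have "a \<bullet> (z + (r / norm a) *\<^sub>R a) \<le> b" by (rule aK)
    moreover have "(r / norm a) * (a \<bullet> a) > 0" using r a by simp
    ultimately show False using as a(2) by (simp add: inner_add_right)
  qed
qed

section \<open>Measure and center of mass of a section\<close>

context
  fixes u :: "'a::euclidean_space" and t :: real
  assumes u: "norm u = 1"
begin

text \<open>The chosen base point differs from \<open>t *\<^sub>R u\<close> by a vector of the
  direction space, and translation by it preserves the measure.\<close>

lemma affine_lborel_hyperplane:
  "affine_lborel {x. u \<bullet> x = t} = distr (hyp_measure u) borel ((+) (t *\<^sub>R u))"
proof -
  have uu: "u \<bullet> u = 1" using u by (simp add: norm_eq_1)
  define p where "p = (SOME p. p \<in> {x. u \<bullet> x = t})"
  have "t *\<^sub>R u \<in> {x. u \<bullet> x = t}" by (simp add: uu)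
  then have "p \<in> {x. u \<bullet> x = t}" unfolding p_def by (rule someI)
  then have "u \<bullet> (p - t *\<^sub>R u) = 0" by (simp add: inner_diff_right uu)
  note w = distr_hyp_measure_plus[OF this]
  have "affine_lborel {x. u \<bullet> x = t} = distr (hyp_measure u) borel (\<lambda>v. p + v)"
    unfolding affine_lborel_def direction_space_hyperplane[OF u] subspace_lborel_hyperplane[OF u] p_def
    by (rule refl)
  also have "\<dots> = distr (distr (hyp_measure u) borel ((+) (p - t *\<^sub>R u))) borel ((+) (t *\<^sub>R u))"
    by (subst distr_distr) (simp_all add: comp_def)
  finally show ?thesis unfolding w .
qed

lemma sets_affine_lborel_hyperplane: "sets (affine_lborel {x. u \<bullet> x = t}) = sets borel"
  by (simp add: affine_lborel_hyperplane)

lemma space_affine_lborel_hyperplane: "space (affine_lborel {x. u \<bullet> x = t}) = UNIV"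
  by (simp add: affine_lborel_hyperplane)

lemma integral_affine_lborel_hyperplane:
  fixes g :: "'a \<Rightarrow> 'b::{banach, second_countable_topology}"
  assumes [measurable]: "g \<in> borel_measurable borel"
  shows "(LINT x|affine_lborel {x. u \<bullet> x = t}. g x) =
    (LINT x|lborel. indicat_real {0..1} (u \<bullet> x) *\<^sub>R g (t *\<^sub>R u + (x - (u \<bullet> x) *\<^sub>R u)))"
proof -
  have "(LINT x|affine_lborel {x. u \<bullet> x = t}. g x) = (LINT x|hyp_measure u. g (t *\<^sub>R u + x))"
    by (simp add: affine_lborel_hyperplane integral_distr)
  also have "\<dots> = (LINT x|lborel. indicat_real {0..1} (u \<bullet> x) *\<^sub>R g (t *\<^sub>R u + (x - (u \<bullet> x) *\<^sub>R u)))"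
    by (subst integral_hyp_measure) (auto intro!: Bochner_Integration.integral_cong simp: indicator_def)
  finally show ?thesis .
qed

lemma emeasure_affine_lborel_bounded:
  assumes A: "A \<in> sets borel" "bounded A"
  shows "emeasure (affine_lborel {x. u \<bullet> x = t}) A < \<infinity>"
proof -
  have "bounded ((+) (t *\<^sub>R u) -` A)"
  proof -
    have "(+) (t *\<^sub>R u) -` A = (\<lambda>x. - (t *\<^sub>R u) + x) ` A"
      by (auto simp: image_iff algebra_simps)
    then show ?thesis using A(2) by (simp only: bounded_translation)
  qed
  moreover have "(+) (t *\<^sub>R u) -` A \<in> sets borel"
    using A(1) measurable_sets[of "(+) (t *\<^sub>R u)" borel borel A] by simp
  ultimately show ?thesis
    using A(1) emeasure_hyp_measure_bounded[OF u] by (simp add: affine_lborel_hyperplane emeasure_distr)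
qed

lemma emeasure_affine_lborel_open_pos:
  assumes U: "open U" and x: "x \<in> U" "u \<bullet> x = t"
  shows "emeasure (affine_lborel {x. u \<bullet> x = t}) U \<noteq> 0"
proof -
  have uu: "u \<bullet> u = 1" using u by (simp add: norm_eq_1)
  have "open ((+) (t *\<^sub>R u) -` U)" using U by (intro open_vimage continuous_intros)
  then have "emeasure (hyp_measure u) ((+) (t *\<^sub>R u) -` U) \<noteq> 0"
    using x by (intro emeasure_hyp_measure_open_pos[OF u, of _ "x - t *\<^sub>R u"]) (auto simp: inner_diff_right uu)
  then show ?thesis using U by (simp add: affine_lborel_hyperplane emeasure_distr)
qed

lemma AE_affine_lborel_hyperplane: "AE x in affine_lborel {x. u \<bullet> x = t}. u \<bullet> x = t"
proof -
  have uu: "u \<bullet> u = 1" using u by (simp add: norm_eq_1)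
  have "AE x in hyp_measure u. u \<bullet> (t *\<^sub>R u + x) = t"
    using AE_hyp_measure_orthogonal[OF u] by eventually_elim (simp add: inner_add_right uu)
  then show ?thesis unfolding affine_lborel_hyperplane by (subst AE_distr_iff) auto
qed

context
  fixes K :: "'a set" and z :: 'a
  assumes K: "convex K" "compact K" and z: "z \<in> interior K" "u \<bullet> z = t"
begin

text \<open>Since the hyperplane meets the interior, the section spans it, and mass is measured in
  the hyperplane. The measure is concentrated there, so \<open>K\<close> can replace the section in
  the integrals.\<close>

lemma center_of_mass_section:
  "center_of_mass (K \<inter> {x. u \<bullet> x = t}) =
    (1 / (LINT x|affine_lborel {x. u \<bullet> x = t}. indicat_real K x)) *\<^sub>R
      (LINT x|affine_lborel {x. u \<bullet> x = t}. indicat_real K x *\<^sub>R x)"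
proof -
  let ?H = "{x. u \<bullet> x = t}" and ?\<mu> = "affine_lborel {x. u \<bullet> x = t}"
  have [measurable]: "K \<in> sets borel" using K by (simp add: borel_compact)
  have "affine hull (?H \<inter> K) = affine hull ?H"
    using z by (intro affine_hull_affine_Int_nonempty_interior affine_hyperplane) auto
  then have hull: "affine hull (K \<inter> ?H) = ?H"
    by (simp add: Int_commute affine_hyperplane)
  note [measurable_cong] = sets_affine_lborel_hyperplane
  have 1: "measure ?\<mu> (K \<inter> ?H) = (LINT x|?\<mu>. indicat_real K x)"
  proof -
    have "measure ?\<mu> (K \<inter> ?H) = measure ?\<mu> K"
      using AE_affine_lborel_hyperplane
      by (intro measure_eq_AE) (auto elim: eventually_mono simp: sets_affine_lborel_hyperplane)
    then show ?thesis by (simp add: space_affine_lborel_hyperplane)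
  qed
  have 2: "(LINT x:K \<inter> ?H|?\<mu>. x) = (LINT x|?\<mu>. indicat_real K x *\<^sub>R x)"
    unfolding set_lebesgue_integral_def
    using AE_affine_lborel_hyperplane
    by (intro integral_cong_AE) (auto elim!: eventually_mono simp: indicator_def)
  show ?thesis by (simp add: center_of_mass_def Let_def hull 1 2)
qed

lemma integrable_section:
  fixes g :: "'a \<Rightarrow> 'b::{banach, second_countable_topology}"
  assumes "continuous_on UNIV g"
  shows "integrable (affine_lborel {x. u \<bullet> x = t}) (\<lambda>x. indicat_real K x *\<^sub>R g x)"
proof -
  have "bounded (g ` K)"
    using K assms by (intro compact_imp_bounded compact_continuous_image) (auto intro: continuous_on_subset)
  then obtain B where B: "\<And>x. x \<in> K \<Longrightarrow> norm (g x) \<le> B" by (auto simp: bounded_iff)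
  have "K \<in> sets borel" "bounded K" using K by (auto simp: borel_compact compact_imp_bounded)
  moreover have "g \<in> borel_measurable borel" using assms by (rule borel_measurable_continuous_onI)
  ultimately show ?thesis
    using B emeasure_affine_lborel_bounded[of K]
    by (intro integrableI_bounded_set_indicator[of _ _ _ B])
      (auto simp: sets_affine_lborel_hyperplane cong: measurable_cong_sets)
qed

lemma section_measure_pos: "0 < (LINT x|affine_lborel {x. u \<bullet> x = t}. indicat_real K x)"
proof -
  let ?\<mu> = "affine_lborel {x. u \<bullet> x = t}"
  have Kb: "K \<in> sets borel" "bounded K" using K by (auto simp: borel_compact compact_imp_bounded)
  have "emeasure ?\<mu> (interior K) \<noteq> 0"
    using z by (intro emeasure_affine_lborel_open_pos) auto
  moreover have "emeasure ?\<mu> (interior K) \<le> emeasure ?\<mu> K"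
    using Kb by (intro emeasure_mono interior_subset) (simp add: sets_affine_lborel_hyperplane)
  ultimately have "emeasure ?\<mu> K \<noteq> 0" by auto
  moreover have "emeasure ?\<mu> K < \<infinity>" using Kb by (rule emeasure_affine_lborel_bounded)
  ultimately have "measure ?\<mu> K > 0"
    by (simp add: measure_def enn2real_positive_iff zero_less_iff_neq_zero less_top)
  then show ?thesis by (simp add: space_affine_lborel_hyperplane)
qed

text \<open>If the functional \<open>e\<close> never exceeded its mean on the section, it would
  equal the mean almost everywhere there. But it is smaller on a relatively open part around
  \<open>z\<close>, which has positive measure.\<close>

lemma center_of_mass_in_section:
  "center_of_mass (K \<inter> {x. u \<bullet> x = t}) \<in> {x. u \<bullet> x = t} \<inter> interior K"
proof -
  let ?\<mu> = "affine_lborel {x. u \<bullet> x = t}"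
  define A where "A = (LINT x|?\<mu>. indicat_real K x)"
  define I where "I = (LINT x|?\<mu>. indicat_real K x *\<^sub>R x)"
  define s where "s = center_of_mass (K \<inter> {x. u \<bullet> x = t})"
  have s: "s = (1 / A) *\<^sub>R I" unfolding s_def A_def I_def by (rule center_of_mass_section)
  have A: "A > 0" unfolding A_def by (rule section_measure_pos)
  have [measurable]: "K \<in> sets borel" using K by (simp add: borel_compact)
  note [measurable_cong] = sets_affine_lborel_hyperplane
  have intI: "integrable ?\<mu> (\<lambda>x. indicat_real K x *\<^sub>R x)" by (rule integrable_section) (intro continuous_intros)
  have intA: "integrable ?\<mu> (\<lambda>x. indicat_real K x)"
    using integrable_section[of "\<lambda>_. 1::real"] by simp
  have eI: "e \<bullet> I = (LINT x|?\<mu>. indicat_real K x * (e \<bullet> x))" for e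
    unfolding I_def using intI by (simp flip: integral_inner_right)
  have "u \<bullet> I = (LINT x|?\<mu>. indicat_real K x * t)"
    unfolding eI using AE_affine_lborel_hyperplane
    by (intro integral_cong_AE) (auto elim!: eventually_mono)
  then have us: "u \<bullet> s = t" using A by (simp add: s A_def)
  have "\<exists>y\<in>K. u \<bullet> y = t \<and> e \<bullet> s < e \<bullet> y" if e: "e \<noteq> 0" "u \<bullet> e = 0" for e
  proof (rule ccontr)
    assume "\<not> ?thesis"
    then have le: "e \<bullet> y \<le> e \<bullet> s" if "y \<in> K" "u \<bullet> y = t" for y using that by force
    have int: "integrable ?\<mu> (\<lambda>x. indicat_real K x * (e \<bullet> s - e \<bullet> x))"
      using integrable_section[of "\<lambda>x. e \<bullet> s - e \<bullet> x"] by (simp add: continuous_intros)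
    have "(LINT x|?\<mu>. indicat_real K x * (e \<bullet> s - e \<bullet> x)) =
      (LINT x|?\<mu>. indicat_real K x * (e \<bullet> s) - indicat_real K x * (e \<bullet> x))"
      by (simp add: right_diff_distrib)
    also have "\<dots> = A * (e \<bullet> s) - e \<bullet> I"
      using intA integrable_section[of "\<lambda>x. e \<bullet> x"]
      by (subst Bochner_Integration.integral_diff) (simp_all add: A_def eI continuous_intros)
    also have "\<dots> = 0" using A by (simp add: s)
    finally have 0: "(LINT x|?\<mu>. indicat_real K x * (e \<bullet> s - e \<bullet> x)) = 0" .
    have "AE x in ?\<mu>. 0 \<le> indicat_real K x * (e \<bullet> s - e \<bullet> x)"
      using AE_affine_lborel_hyperplane by eventually_elim (use le in \<open>auto simp: indicator_def\<close>)
    then have "AE x in ?\<mu>. indicat_real K x * (e \<bullet> s - e \<bullet> x) = 0"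
      using integral_nonneg_eq_0_iff_AE[OF int] 0 by blast
    then have ae: "AE x in ?\<mu>. \<not> (x \<in> interior K \<inter> {x. e \<bullet> x < e \<bullet> s})"
      by eventually_elim (use interior_subset[of K] in \<open>auto simp: indicator_def split: if_splits\<close>)
    obtain r where r: "r > 0" "cball z r \<subseteq> K" using z by (auto simp: mem_interior_cball)
    have "z + (r / norm e) *\<^sub>R e \<in> K" using r e by (intro set_mp[OF r(2)]) (auto simp: dist_norm)
    moreover have "u \<bullet> (z + (r / norm e) *\<^sub>R e) = t" using z e by (simp add: inner_add_right)
    ultimately have "e \<bullet> (z + (r / norm e) *\<^sub>R e) \<le> e \<bullet> s" by (rule le)
    moreover have "(r / norm e) * (e \<bullet> e) > 0" using r e by simp
    ultimately have "z \<in> interior K \<inter> {x. e \<bullet> x < e \<bullet> s}" using z by (simp add: inner_add_right)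
    moreover have op: "open (interior K \<inter> {x. e \<bullet> x < e \<bullet> s})" by (intro open_Int open_interior open_halfspace_lt)
    ultimately have "emeasure ?\<mu> (interior K \<inter> {x. e \<bullet> x < e \<bullet> s}) \<noteq> 0"
      using z by (intro emeasure_affine_lborel_open_pos) auto
    moreover have "emeasure ?\<mu> (interior K \<inter> {x. e \<bullet> x < e \<bullet> s}) = 0"
      using ae op by (subst (asm) AE_iff_measurable[of "interior K \<inter> {x. e \<bullet> x < e \<bullet> s}"])
        (auto simp: sets_affine_lborel_hyperplane space_affine_lborel_hyperplane)
    ultimately show False by simp
  qed
  then have "s \<in> interior K"
    by (intro interior_section_criterion[OF K(1) z us u]) auto
  then show ?thesis using us by (simp add: s_def)
qed

text \<open>The preimage \<open>P\<close> of \<open>K\<close> under the projection \<open>q\<close>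
  is convex, so its frontier is null. If \<open>x\<close> is interior to \<open>P\<close>, the
  segment from \<open>z\<close> to \<open>q x\<close> can be prolonged within \<open>K\<close>, and
  then \<open>q x\<close> is interior to \<open>K\<close>.\<close>

lemma null_sets_section_frontier:
  "{x. t *\<^sub>R u + (x - (u \<bullet> x) *\<^sub>R u) \<in> frontier K} \<in> null_sets lborel"
proof -
  define q where "q x = t *\<^sub>R u + (x - (u \<bullet> x) *\<^sub>R u)" for x
  define P where "P = q -` K"
  have uu: "u \<bullet> u = 1" using u by (simp add: norm_eq_1)
  have uq: "u \<bullet> q x = t" for x by (simp add: q_def inner_add_right inner_diff_right uu)
  have qc: "continuous_on UNIV q" unfolding q_def by (intro continuous_intros)
  have clK: "closed K" using K by (simp add: compact_imp_closed)
  have clP: "closed P" unfolding P_def using clK qc by (rule closed_vimage)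
  have "convex P"
  proof (rule convexI)
    fix x y a b assume "x \<in> P" "y \<in> P" and ab: "0 \<le> a" "0 \<le> b" "a + b = (1::real)"
    then have "a *\<^sub>R q x + b *\<^sub>R q y \<in> K" using K by (auto simp: P_def intro: convexD)
    moreover have "t = a * t + b * t" using ab by (simp flip: distrib_right)
    then have "a *\<^sub>R q x + b *\<^sub>R q y = q (a *\<^sub>R x + b *\<^sub>R y)"
      by (simp add: q_def inner_add_right algebra_simps) (metis scaleR_add_left add.commute)
    ultimately show "a *\<^sub>R x + b *\<^sub>R y \<in> P" by (simp add: P_def)
  qed
  then have neg: "negligible (frontier P)" by (rule negligible_convex_frontier)
  have "{x. q x \<in> frontier K} \<subseteq> frontier P"
  proof clarify
    fix x assume x: "q x \<in> frontier K"
    have "q x \<in> K" "q x \<notin> interior K" using x clK by (auto simp: frontier_def)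
    have "x \<notin> interior P"
    proof
      assume "x \<in> interior P"
      then obtain r where r: "r > 0" "cball x r \<subseteq> P" by (auto simp: mem_interior_cball)
      define y where "y = q x"
      \<comment> \<open>Small enough for the displacement to stay within \<open>r\<close>; the added
        1 covers \<open>y = z\<close>.\<close>
      define d where "d = r / (1 + norm (y - z))"
      have d: "d > 0" using r by (simp add: d_def add_pos_nonneg)
      have "d * norm (y - z) \<le> d * (1 + norm (y - z))" using d by (intro mult_left_mono) auto
      also have "\<dots> = r" by (simp add: d_def add_nonneg_eq_0_iff)
      finally have "x + d *\<^sub>R (y - z) \<in> P" using d by (intro set_mp[OF r(2)]) (auto simp: dist_norm)
      moreover have "u \<bullet> (y - z) = 0" using uq[of x] z by (simp add: y_def inner_diff_right)
      then have "q (x + d *\<^sub>R (y - z)) = y + d *\<^sub>R (y - z)"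
        by (simp add: q_def y_def inner_add_right)
      ultimately have y': "y + d *\<^sub>R (y - z) \<in> K" by (simp add: P_def)
      \<comment> \<open>With this ratio, shrinking the prolonged segment towards \<open>z\<close>
        returns exactly to \<open>y\<close>.\<close>
      define e where "e = d / (1 + d)"
      have "(y + d *\<^sub>R (y - z)) - e *\<^sub>R ((y + d *\<^sub>R (y - z)) - z) \<in> interior K"
        using d by (intro mem_interior_convex_shrink[OF K(1) z(1) y']) (auto simp: e_def)
      moreover have "e *\<^sub>R ((y + d *\<^sub>R (y - z)) - z) = d *\<^sub>R (y - z)"
      proof -
        have "(y + d *\<^sub>R (y - z)) - z = (1 + d) *\<^sub>R (y - z)" by (simp add: algebra_simps)
        then show ?thesis using d by (simp add: e_def)
      qed
      ultimately show False using \<open>q x \<notin> interior K\<close> by (simp add: y_def)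
    qed
    then show "x \<in> frontier P"
      using \<open>q x \<in> K\<close> clP by (simp add: frontier_def P_def)
  qed
  with neg have "negligible {x. q x \<in> frontier K}" by (rule negligible_subset)
  moreover have "{x. q x \<in> frontier K} \<in> sets borel"
  proof -
    have "closed (q -` frontier K)" using qc by (intro closed_vimage) auto
    then show ?thesis by (simp add: vimage_def)
  qed
  ultimately show ?thesis by (simp add: q_def negligible_iff_null_sets null_sets_completion_iff)
qed

end

end

section \<open>Limits of sections along moving hyperplanes\<close>

lemma tendsto_indicator_frontier:
  assumes y: "(y \<longlongrightarrow> l) F" and l: "l \<notin> frontier S"
  shows "((\<lambda>n. indicat_real S (y n)) \<longlongrightarrow> indicat_real S l) F"
proof (cases "l \<in> interior S")
  case True
  then have "\<forall>\<^sub>F n in F. y n \<in> interior S" using y by (intro topological_tendstoD) auto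
  then have "\<forall>\<^sub>F n in F. indicat_real S (y n) = 1"
    by eventually_elim (auto simp: indicator_def dest: subsetD[OF interior_subset])
  moreover have "l \<in> S" using True interior_subset by auto
  ultimately show ?thesis by (simp add: tendsto_eventually)
next
  case False
  then have l: "l \<in> - closure S" using l by (simp add: frontier_def)
  then have "\<forall>\<^sub>F n in F. y n \<in> - closure S" using y by (intro topological_tendstoD) auto
  then have "\<forall>\<^sub>F n in F. indicat_real S (y n) = 0"
    by eventually_elim (auto simp: indicator_def dest: subsetD[OF closure_subset])
  moreover have "l \<notin> S" using l closure_subset by auto
  ultimately show ?thesis by (simp add: tendsto_eventually)
qed

lemma null_sets_hyperplane:
  fixes u :: "'a::euclidean_space"
  assumes "u \<noteq> 0"
  shows "{x. u \<bullet> x = a} \<in> null_sets lborel"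
  using negligible_hyperplane[of u a] assms
  by (simp add: negligible_iff_null_sets null_sets_completion_iff)

lemma tendsto_project_hyperplane:
  fixes y :: "'a::real_inner"
  assumes "un \<longlonglongrightarrow> u" "tn \<longlonglongrightarrow> t" "u \<bullet> y = t"
  shows "(\<lambda>n. y - (un n \<bullet> y - tn n) *\<^sub>R un n) \<longlonglongrightarrow> y"
proof -
  have "(\<lambda>n. y - (un n \<bullet> y - tn n) *\<^sub>R un n) \<longlonglongrightarrow> y - (u \<bullet> y - t) *\<^sub>R u"
    by (intro tendsto_intros assms)
  then show ?thesis using assms by simp
qed

lemma inner_project_hyperplane:
  "norm u = 1 \<Longrightarrow> u \<bullet> (y - (u \<bullet> y - t) *\<^sub>R u) = t"
  by (simp add: inner_diff_right dot_square_norm)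

context
  fixes K :: "'a::euclidean_space set" and u z :: 'a and t :: real and un :: "nat \<Rightarrow> 'a" and tn :: "nat \<Rightarrow> real"
  assumes K: "convex K" "compact K" and z: "z \<in> interior K" "u \<bullet> z = t"
    and u: "norm u = 1" and un: "\<And>n. norm (un n) = 1"
    and lim_u: "un \<longlonglongrightarrow> u" and lim_t: "tn \<longlonglongrightarrow> t"
begin

lemma eventually_section_interior:
  "\<forall>\<^sub>F n in sequentially. \<exists>z'. z' \<in> interior K \<and> un n \<bullet> z' = tn n"
proof -
  have "\<forall>\<^sub>F n in sequentially. z - (un n \<bullet> z - tn n) *\<^sub>R un n \<in> interior K"
    using tendsto_project_hyperplane[OF lim_u lim_t z(2)] z(1) by (intro topological_tendstoD) auto
  then show ?thesis using inner_project_hyperplane[OF un] by (auto elim!: eventually_mono)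
qed

lemma tendsto_section_integral:
  fixes g :: "'a \<Rightarrow> 'b::{banach, second_countable_topology}"
  assumes g: "continuous_on UNIV g"
  shows "(\<lambda>n. LINT x|affine_lborel {x. un n \<bullet> x = tn n}. indicat_real K x *\<^sub>R g x) \<longlonglongrightarrow>
    (LINT x|affine_lborel {x. u \<bullet> x = t}. indicat_real K x *\<^sub>R g x)"
proof -
  have [measurable]: "g \<in> borel_measurable borel" using g by (rule borel_measurable_continuous_onI)
  have [measurable]: "K \<in> sets borel" using K by (simp add: borel_compact)
  define q where "q u t x = t *\<^sub>R u + (x - (u \<bullet> x) *\<^sub>R u)" for u x :: 'a and t
  have [measurable]: "q u t \<in> borel_measurable borel" for u t unfolding q_def by measurable
  have "bounded (g ` K)" "bounded K"
    using K g by (auto intro!: compact_imp_bounded compact_continuous_image intro: continuous_on_subset)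
  then obtain B R where B: "\<And>x. x \<in> K \<Longrightarrow> norm (g x) \<le> B" and R: "\<And>x. x \<in> K \<Longrightarrow> norm x \<le> R"
    unfolding bounded_iff by auto
  have "B \<ge> 0" using B[of z] z interior_subset by (metis norm_ge_zero order_trans subsetD)
  obtain T where T: "\<And>n. \<bar>tn n\<bar> \<le> T"
    using lim_t by (metis convergentI convergent_imp_Bseq BseqE real_norm_def)
  have "(\<lambda>n. LINT x|lborel. indicat_real {0..1} (un n \<bullet> x) *\<^sub>R
        (indicat_real K (q (un n) (tn n) x) *\<^sub>R g (q (un n) (tn n) x))) \<longlonglongrightarrow>
     (LINT x|lborel. indicat_real {0..1} (u \<bullet> x) *\<^sub>R (indicat_real K (q u t x) *\<^sub>R g (q u t x)))"
  \<comment> \<open>\<open>R\<close> bounds \<open>K\<close>, \<open>T\<close> the offsets and 1 the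
    height of the slab, so one ball contains the supports of all integrands.\<close>
  proof (rule integral_dominated_convergence[where w="\<lambda>x. B * indicat_real (cball 0 (R + T + 1)) x"])
    show "integrable lborel (\<lambda>x::'a. B * indicat_real (cball 0 (R + T + 1)) x)"
      using emeasure_lborel_cball_finite by (intro integrable_mult_right integrable_real_indicator) auto
    show "AE x in lborel. norm (indicat_real {0..1} (un n \<bullet> x) *\<^sub>R
        (indicat_real K (q (un n) (tn n) x) *\<^sub>R g (q (un n) (tn n) x))) \<le> B * indicat_real (cball 0 (R + T + 1)) x" for n
    proof (rule AE_I2)
      fix x
      have "norm x \<le> R + T + 1" if "0 \<le> un n \<bullet> x" "un n \<bullet> x \<le> 1" "q (un n) (tn n) x \<in> K"
      proof -
        have "x = q (un n) (tn n) x - tn n *\<^sub>R un n + (un n \<bullet> x) *\<^sub>R un n" by (simp add: q_def)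
        then have "norm x \<le> norm (q (un n) (tn n) x - tn n *\<^sub>R un n) + norm ((un n \<bullet> x) *\<^sub>R un n)"
          by (metis norm_triangle_ineq)
        also have "norm (q (un n) (tn n) x - tn n *\<^sub>R un n) \<le> norm (q (un n) (tn n) x) + norm (tn n *\<^sub>R un n)"
          by (rule norm_triangle_ineq4)
        finally show ?thesis using R[OF that(3)] T[of n] that un[of n] by simp
      qed
      then show "norm (indicat_real {0..1} (un n \<bullet> x) *\<^sub>R
        (indicat_real K (q (un n) (tn n) x) *\<^sub>R g (q (un n) (tn n) x))) \<le> B * indicat_real (cball 0 (R + T + 1)) x"
        using \<open>B \<ge> 0\<close> B by (auto simp: indicator_def)
    qed
    \<comment> \<open>Convergence may fail only on the two faces of the slab and over the frontier
      of \<open>K\<close>, which are null.\<close>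
    have "u \<noteq> 0" using u by auto
    then have "AE x in lborel. u \<bullet> x \<noteq> 0" "AE x in lborel. u \<bullet> x \<noteq> 1"
      using null_sets_hyperplane[of u] by (auto intro: AE_not_in[THEN eventually_mono])
    moreover have "AE x in lborel. q u t x \<notin> frontier K"
      using AE_not_in[OF null_sets_section_frontier[OF u K z]] by (auto simp: q_def elim: eventually_mono)
    ultimately show "AE x in lborel. (\<lambda>n. indicat_real {0..1} (un n \<bullet> x) *\<^sub>R
        (indicat_real K (q (un n) (tn n) x) *\<^sub>R g (q (un n) (tn n) x))) \<longlonglongrightarrow>
        indicat_real {0..1} (u \<bullet> x) *\<^sub>R (indicat_real K (q u t x) *\<^sub>R g (q u t x))"
    proof eventually_elim
      case (elim x)
      have "(\<lambda>n. un n \<bullet> x) \<longlonglongrightarrow> u \<bullet> x" by (intro tendsto_intros lim_u)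
      moreover have "u \<bullet> x \<notin> frontier {0..1}" using elim by (auto simp: frontier_def)
      ultimately have 1: "(\<lambda>n. indicat_real {0..1} (un n \<bullet> x)) \<longlonglongrightarrow> indicat_real {0..1} (u \<bullet> x)"
        by (rule tendsto_indicator_frontier)
      have q: "(\<lambda>n. q (un n) (tn n) x) \<longlonglongrightarrow> q u t x"
        unfolding q_def by (intro tendsto_intros lim_u lim_t)
      have 2: "(\<lambda>n. indicat_real K (q (un n) (tn n) x)) \<longlonglongrightarrow> indicat_real K (q u t x)"
        using q elim by (intro tendsto_indicator_frontier)
      have 3: "(\<lambda>n. g (q (un n) (tn n) x)) \<longlonglongrightarrow> g (q u t x)"
        using q by (intro continuous_on_tendsto_compose[OF g]) auto
      show ?case by (intro tendsto_scaleR 1 2 3)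
    qed
  qed measurable
  then show ?thesis
    by (simp add: integral_affine_lborel_hyperplane u un q_def)
qed

lemma tendsto_center_of_mass_section:
  "(\<lambda>n. center_of_mass (K \<inter> {x. un n \<bullet> x = tn n})) \<longlonglongrightarrow> center_of_mass (K \<inter> {x. u \<bullet> x = t})"
proof -
  define A where "A u t = (LINT x|affine_lborel {x. u \<bullet> x = t}. indicat_real K x)" for u t
  define I where "I u t = (LINT x|affine_lborel {x. u \<bullet> x = t}. indicat_real K x *\<^sub>R x)" for u t
  have "(\<lambda>n. A (un n) (tn n)) \<longlonglongrightarrow> A u t"
    using tendsto_section_integral[of "\<lambda>_. 1::real"] by (simp add: A_def)
  moreover have "(\<lambda>n. I (un n) (tn n)) \<longlonglongrightarrow> I u t"
    unfolding I_def by (rule tendsto_section_integral) (intro continuous_intros)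
  moreover have "A u t \<noteq> 0" unfolding A_def using section_measure_pos[OF u K z] by simp
  ultimately have "(\<lambda>n. (1 / A (un n) (tn n)) *\<^sub>R I (un n) (tn n)) \<longlonglongrightarrow> (1 / A u t) *\<^sub>R I u t"
    by (intro tendsto_intros)
  moreover have "\<forall>\<^sub>F n in sequentially. center_of_mass (K \<inter> {x. un n \<bullet> x = tn n}) =
      (1 / A (un n) (tn n)) *\<^sub>R I (un n) (tn n)"
    using eventually_section_interior
  proof eventually_elim
    case (elim n)
    then obtain z' where "z' \<in> interior K" "un n \<bullet> z' = tn n" by blast
    then show ?case unfolding A_def I_def by (rule center_of_mass_section[OF un K])
  qed
  moreover have "center_of_mass (K \<inter> {x. u \<bullet> x = t}) = (1 / A u t) *\<^sub>R I u t"
    unfolding A_def I_def by (rule center_of_mass_section[OF u K z])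
  ultimately show ?thesis by (simp add: tendsto_cong)
qed

lemma compact_section: "compact (K \<inter> {x. v \<bullet> x = s})"
  using K closed_hyperplane by (rule_tac compact_Int_closed) auto

text \<open>Limit points of maximisers lie in the limit section, which bounds the limit from above.
  For the lower bound, interior points of the limit section are approximated from the moving
  sections, and they are dense in it by shrinking towards \<open>z\<close>.\<close>

lemma tendsto_support_function_section:
  assumes ne: "\<And>n. K \<inter> {x. un n \<bullet> x = tn n} \<noteq> {}" and w: "wn \<longlonglongrightarrow> w"
  shows "(\<lambda>n. support_function (K \<inter> {x. un n \<bullet> x = tn n}) (wn n)) \<longlonglongrightarrow>
    support_function (K \<inter> {x. u \<bullet> x = t}) w"
proof -
  define C where "C n = K \<inter> {x. un n \<bullet> x = tn n}" for n
  have C: "compact (C n)" "C n \<noteq> {}" for n using ne by (auto simp: C_def compact_section)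
  have C0: "compact (K \<inter> {x. u \<bullet> x = t})" "K \<inter> {x. u \<bullet> x = t} \<noteq> {}"
    using compact_section z subsetD[OF interior_subset z(1)] by auto
  have "\<forall>n. \<exists>x\<in>C n. support_function (C n) (wn n) = x \<bullet> wn n"
    using support_function_attained[OF C] by blast
  then obtain X where X: "\<And>n. X n \<in> C n" "\<And>n. support_function (C n) (wn n) = X n \<bullet> wn n" by metis
  have "(\<lambda>n. support_function (C n) (wn n)) \<longlonglongrightarrow> support_function (K \<inter> {x. u \<bullet> x = t}) w"
  proof (rule tendsto_subseq_compact[OF K(2), of X])
    show "X n \<in> K" for n using X(1)[of n] by (simp add: C_def)
    fix r l assume r: "strict_mono (r :: nat \<Rightarrow> nat)" "l \<in> K" "(X \<circ> r) \<longlonglongrightarrow> l"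
    note sub = LIMSEQ_subseq_LIMSEQ[OF _ r(1), unfolded comp_def]
    have Xr: "(\<lambda>n. X (r n)) \<longlonglongrightarrow> l" using r(3) by (simp add: comp_def)
    have "(\<lambda>n. un (r n) \<bullet> X (r n)) \<longlonglongrightarrow> u \<bullet> l" by (intro tendsto_inner sub[OF lim_u] Xr)
    moreover have "(\<lambda>n. un (r n) \<bullet> X (r n)) \<longlonglongrightarrow> t" using sub[OF lim_t] X(1) by (simp add: C_def)
    ultimately have l: "u \<bullet> l = t" by (rule LIMSEQ_unique)
    have lim: "(\<lambda>n. support_function (C (r n)) (wn (r n))) \<longlonglongrightarrow> l \<bullet> w"
      unfolding X(2) by (intro tendsto_inner sub[OF w] Xr)
    have int_le: "y \<bullet> w \<le> l \<bullet> w" if y: "y \<in> interior K" "u \<bullet> y = t" for y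
    proof -
      define Y where "Y n = y - (un n \<bullet> y - tn n) *\<^sub>R un n" for n
      have Y: "Y \<longlonglongrightarrow> y" unfolding Y_def by (rule tendsto_project_hyperplane[OF lim_u lim_t y(2)])
      have "\<forall>\<^sub>F n in sequentially. Y (r n) \<in> interior K"
        using sub[OF Y] y(1) by (intro topological_tendstoD) auto
      then have "\<forall>\<^sub>F n in sequentially. Y (r n) \<bullet> wn (r n) \<le> support_function (C (r n)) (wn (r n))"
      proof eventually_elim
        case (elim n)
        have "un (r n) \<bullet> Y (r n) = tn (r n)" unfolding Y_def by (rule inner_project_hyperplane[OF un])
        then show ?case using elim interior_subset by (intro support_function_ge[OF C]) (auto simp: C_def)
      qed
      moreover have "(\<lambda>n. Y (r n) \<bullet> wn (r n)) \<longlonglongrightarrow> y \<bullet> w" by (intro tendsto_inner sub[OF w] sub[OF Y])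
      ultimately show ?thesis by (intro tendsto_le[OF _ lim]) auto
    qed
    have "support_function (K \<inter> {x. u \<bullet> x = t}) w \<le> l \<bullet> w"
    proof (rule support_function_le[OF C0])
      fix y assume y: "y \<in> K \<inter> {x. u \<bullet> x = t}"
      have "((\<lambda>d. (y - d *\<^sub>R (y - z)) \<bullet> w) \<longlongrightarrow> (y - 0 *\<^sub>R (y - z)) \<bullet> w) (at_right (0::real))"
        by (intro tendsto_intros)
      moreover have "\<forall>\<^sub>F d in at_right (0::real). (y - d *\<^sub>R (y - z)) \<bullet> w \<le> l \<bullet> w"
      proof -
        have "\<forall>\<^sub>F d in at_right (0::real). d \<in> {0<..<1}" by (rule eventually_at_right_real) simp
        then show ?thesis
        proof eventually_elim
          case (elim d)
          have "y - d *\<^sub>R (y - z) \<in> interior K"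
            using elim y by (intro mem_interior_convex_shrink K z) auto
          moreover have "u \<bullet> (y - d *\<^sub>R (y - z)) = t" using y z by (simp add: inner_diff_right)
          ultimately show ?case by (rule int_le)
        qed
      qed
      ultimately show "y \<bullet> w \<le> l \<bullet> w" by (intro tendsto_upperbound) auto
    qed
    moreover have "l \<bullet> w \<le> support_function (K \<inter> {x. u \<bullet> x = t}) w"
      using r(2) l by (intro support_function_ge[OF C0]) auto
    ultimately have "support_function (K \<inter> {x. u \<bullet> x = t}) w = l \<bullet> w" by simp
    then show "((\<lambda>n. support_function (C n) (wn n)) \<circ> r) \<longlonglongrightarrow> support_function (K \<inter> {x. u \<bullet> x = t}) w"
      using lim by (simp add: comp_def)
  qed
  then show ?thesis by (simp add: C_def)
qed

lemma tendsto_steiner_point_section_nonempty: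
  assumes ne: "\<And>n. K \<inter> {x. un n \<bullet> x = tn n} \<noteq> {}"
  shows "(\<lambda>n. steiner_point {x. un n \<bullet> x = tn n} (K \<inter> {x. un n \<bullet> x = tn n})) \<longlonglongrightarrow>
    steiner_point {x. u \<bullet> x = t} (K \<inter> {x. u \<bullet> x = t})"
proof -
  define h where "h u t = support_function (K \<inter> {x. u \<bullet> x = t})" for u t
  define q where "q u x = x - (u \<bullet> x) *\<^sub>R u" for u x :: 'a
  have C: "compact (K \<inter> {x. un n \<bullet> x = tn n})" "K \<inter> {x. un n \<bullet> x = tn n} \<noteq> {}" for n
    using ne compact_section by auto
  have C0: "compact (K \<inter> {x. u \<bullet> x = t})" "K \<inter> {x. u \<bullet> x = t} \<noteq> {}"
    using compact_section z subsetD[OF interior_subset z(1)] by auto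
  have hn[measurable]: "h (un n) (tn n) \<in> borel_measurable borel" for n
    unfolding h_def by (rule borel_measurable_support_function[OF C])
  have h0[measurable]: "h u t \<in> borel_measurable borel"
    unfolding h_def by (rule borel_measurable_support_function[OF C0])
  have [measurable]: "q u \<in> borel_measurable borel" for u unfolding q_def by measurable
  have [measurable]: "cball (0::'a) 1 \<in> sets borel" by (intro borel_closed closed_cball)
  have [measurable]: "(sgn :: 'a \<Rightarrow> 'a) \<in> borel_measurable borel"
    unfolding sgn_div_norm[abs_def] by measurable
  \<comment> \<open>The surface integral as an integral over the whole space: the slab, the unit
    ball of the hyperplane and radial projection are now part of the integrand.\<close>
  define J where "J u t x = indicat_real {0..1} (u \<bullet> x) *\<^sub>R (indicat_real (cball 0 1) (q u x) *\<^sub>R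
    (h u t (sgn (q u x)) *\<^sub>R sgn (q u x)))" for u x and t
  have int_J: "(LINT v|sphere_measure {x. u \<bullet> x = 0}. h u t v *\<^sub>R v) = real (DIM('a) - 1) *\<^sub>R (LINT x|lborel. J u t x)"
    if "norm u = 1" "h u t \<in> borel_measurable borel" for u t
  proof -
    note [measurable] = that(2)
    have "(LINT v|sphere_measure {x. u \<bullet> x = 0}. h u t v *\<^sub>R v) =
      real (DIM('a) - 1) *\<^sub>R (LINT x|hyp_measure u. indicat_real (cball 0 1) x *\<^sub>R (h u t (sgn x) *\<^sub>R sgn x))"
      by (rule integral_sphere_measure[OF that(1)]) measurable
    also have "(LINT x|hyp_measure u. indicat_real (cball 0 1) x *\<^sub>R (h u t (sgn x) *\<^sub>R sgn x)) = (LINT x|lborel. J u t x)"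
      unfolding J_def q_def
      by (subst integral_hyp_measure) (measurable, auto intro!: Bochner_Integration.integral_cong simp: indicator_def)
    finally show ?thesis .
  qed
  have lim_J: "(\<lambda>n. LINT x|lborel. J (un n) (tn n) x) \<longlonglongrightarrow> (LINT x|lborel. J u t x)" if dim: "DIM('a) \<noteq> 1"
  proof -
    have "bounded K" using K by (simp add: compact_imp_bounded)
    then obtain R where R: "\<And>x. x \<in> K \<Longrightarrow> norm x \<le> R" unfolding bounded_iff by auto
    have R0: "R \<ge> 0" using R[OF subsetD[OF interior_subset z(1)]] norm_ge_zero order_trans by blast
    show ?thesis
    \<comment> \<open>On unit vectors the support functions are at most \<open>R\<close> in absolute
      value, and the part of the slab over the unit ball has points of norm at most 2.\<close>
    proof (rule integral_dominated_convergence[where w="\<lambda>x. R * indicat_real (cball 0 2) x"])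
      show "J u t \<in> borel_measurable lborel" "J (un n) (tn n) \<in> borel_measurable lborel" for n
        unfolding J_def by measurable
      show "integrable lborel (\<lambda>x::'a. R * indicat_real (cball 0 2) x)"
        using emeasure_lborel_cball_finite by (intro integrable_mult_right integrable_real_indicator) auto
      show "AE x in lborel. norm (J (un n) (tn n) x) \<le> R * indicat_real (cball 0 2) x" for n
      proof (rule AE_I2)
        fix x
        have 1: "norm x \<le> 2" if "0 \<le> un n \<bullet> x" "un n \<bullet> x \<le> 1" "norm (q (un n) x) \<le> 1"
        proof -
          have "norm x \<le> norm (q (un n) x) + norm ((un n \<bullet> x) *\<^sub>R un n)"
            unfolding q_def by (metis diff_add_cancel norm_triangle_ineq)
          then show ?thesis using that un[of n] by simp
        qed
        have "\<bar>h (un n) (tn n) v\<bar> \<le> R * norm v" for v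
          using support_function_lipschitz[OF C[of n], where R=R and u=v and v=0] support_function_0[OF C[of n]] R
          by (simp add: h_def)
        moreover have "R * norm v \<le> R" if "norm v \<le> 1" for v :: 'a
          using R0 that by (simp add: mult_left_le)
        moreover have sg: "norm (sgn v) \<le> 1" for v :: 'a by (simp add: norm_sgn)
        ultimately have "\<bar>h (un n) (tn n) (sgn v)\<bar> \<le> R" for v by (meson order_trans)
        then have "\<bar>h (un n) (tn n) (sgn v)\<bar> * norm (sgn v) \<le> R * 1" for v
          using sg R0 by (intro mult_mono) auto
        then show "norm (J (un n) (tn n) x) \<le> R * indicat_real (cball 0 2) x"
          using 1 R0 by (auto simp: J_def indicator_def)
      qed
      have "u \<noteq> 0" using u by auto
      then have "AE x in lborel. u \<bullet> x \<noteq> 0" "AE x in lborel. u \<bullet> x \<noteq> 1"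
        using null_sets_hyperplane[of u] by (auto intro: AE_not_in[THEN eventually_mono])
      \<comment> \<open>The frontier lemma for sections, applied to the unit ball and the hyperplane
        through its centre.\<close>
      moreover have "AE x in lborel. q u x \<notin> frontier (cball 0 1)"
        using AE_not_in[OF null_sets_section_frontier[OF u convex_cball compact_cball, of 0 0 1 0]]
        by (auto simp: q_def elim: eventually_mono)
      moreover have "AE x in lborel. q u x \<noteq> 0"
      proof (rule AE_I')
        show "span {u} \<in> null_sets lborel"
          using negligible_line[OF dim] by (simp add: negligible_iff_null_sets null_sets_completion_iff closed_span)
        show "{x \<in> space lborel. \<not> q u x \<noteq> 0} \<subseteq> span {u}" by (auto simp: q_def span_singleton)
      qed
      ultimately show "AE x in lborel. (\<lambda>n. J (un n) (tn n) x) \<longlonglongrightarrow> J u t x"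
      proof eventually_elim
        case (elim x)
        have "(\<lambda>n. un n \<bullet> x) \<longlonglongrightarrow> u \<bullet> x" by (intro tendsto_intros lim_u)
        moreover have "u \<bullet> x \<notin> frontier {0..1}" using elim by (auto simp: frontier_def)
        ultimately have 1: "(\<lambda>n. indicat_real {0..1} (un n \<bullet> x)) \<longlonglongrightarrow> indicat_real {0..1} (u \<bullet> x)"
          by (rule tendsto_indicator_frontier)
        have q: "(\<lambda>n. q (un n) x) \<longlonglongrightarrow> q u x"
          unfolding q_def by (intro tendsto_intros lim_u)
        have 2: "(\<lambda>n. indicat_real (cball 0 1) (q (un n) x)) \<longlonglongrightarrow> indicat_real (cball 0 1) (q u x)"
          using q elim by (intro tendsto_indicator_frontier)
        have 3: "(\<lambda>n. sgn (q (un n) x)) \<longlonglongrightarrow> sgn (q u x)"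
          using q elim by (intro tendsto_sgn)
        have 4: "(\<lambda>n. h (un n) (tn n) (sgn (q (un n) x))) \<longlonglongrightarrow> h u t (sgn (q u x))"
          unfolding h_def by (rule tendsto_support_function_section[OF ne 3])
        show ?case unfolding J_def by (intro tendsto_scaleR 1 2 3 4)
      qed
    qed
  qed
  have "(\<lambda>n. LINT v|sphere_measure {x. un n \<bullet> x = 0}. h (un n) (tn n) v *\<^sub>R v) \<longlonglongrightarrow>
    (LINT v|sphere_measure {x. u \<bullet> x = 0}. h u t v *\<^sub>R v)"
  proof (cases "DIM('a) = 1")
    case True then show ?thesis by (simp add: int_J[OF un hn] int_J[OF u h0])
  next
    case False then show ?thesis
      unfolding int_J[OF un hn] int_J[OF u h0] by (intro tendsto_intros lim_J)
  qed
  then have "(\<lambda>n. tn n *\<^sub>R un n + (1 / unit_ball_vol (real (DIM('a) - 1))) *\<^sub>R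
       (LINT v|sphere_measure {x. un n \<bullet> x = 0}. h (un n) (tn n) v *\<^sub>R v)) \<longlonglongrightarrow>
      t *\<^sub>R u + (1 / unit_ball_vol (real (DIM('a) - 1))) *\<^sub>R
       (LINT v|sphere_measure {x. u \<bullet> x = 0}. h u t v *\<^sub>R v)"
    by (intro tendsto_add tendsto_scaleR tendsto_const lim_u lim_t)
  then show ?thesis
    unfolding h_def by (simp only: steiner_point_hyperplane_0[OF un C] steiner_point_hyperplane_0[OF u C0])
qed

end

text \<open>Empty sections have no meaningful support function. They occur finitely often, and there
  the limit hyperplane is substituted.\<close>

lemma tendsto_steiner_point_section:
  fixes K :: "'a::euclidean_space set"
  assumes K: "convex K" "compact K" and z: "z \<in> interior K" "u \<bullet> z = t"
    and u: "norm u = 1" and un: "\<And>n. norm (un n) = 1"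
    and lim_u: "un \<longlonglongrightarrow> u" and lim_t: "tn \<longlonglongrightarrow> t"
  shows "(\<lambda>n. steiner_point {x. un n \<bullet> x = tn n} (K \<inter> {x. un n \<bullet> x = tn n})) \<longlonglongrightarrow>
    steiner_point {x. u \<bullet> x = t} (K \<inter> {x. u \<bullet> x = t})"
proof -
  define S where "S n \<longleftrightarrow> K \<inter> {x. un n \<bullet> x = tn n} \<noteq> {}" for n
  define vn where "vn n = (if S n then un n else u)" for n
  define sn where "sn n = (if S n then tn n else t)" for n
  have zK: "z \<in> K" using z interior_subset by blast
  have lims: "vn \<longlonglongrightarrow> u" "sn \<longlonglongrightarrow> t"
    unfolding vn_def sn_def by (intro tendsto_if lim_u lim_t tendsto_const)+
  have nv: "norm (vn n) = 1" for n using u un by (simp add: vn_def)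
  have ne: "K \<inter> {x. vn n \<bullet> x = sn n} \<noteq> {}" for n
    using zK z by (auto simp: vn_def sn_def S_def)
  have "(\<lambda>n. steiner_point {x. vn n \<bullet> x = sn n} (K \<inter> {x. vn n \<bullet> x = sn n})) \<longlonglongrightarrow>
      steiner_point {x. u \<bullet> x = t} (K \<inter> {x. u \<bullet> x = t})"
    by (rule tendsto_steiner_point_section_nonempty[OF K z u nv lims ne])
  moreover have "\<forall>\<^sub>F n in sequentially. S n"
    using eventually_section_interior[OF K z u un lim_u lim_t]
    by eventually_elim (auto simp: S_def dest: subsetD[OF interior_subset])
  then have "\<forall>\<^sub>F n in sequentially. steiner_point {x. un n \<bullet> x = tn n} (K \<inter> {x. un n \<bullet> x = tn n}) =
     steiner_point {x. vn n \<bullet> x = sn n} (K \<inter> {x. vn n \<bullet> x = sn n})"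
    by eventually_elim (simp add: vn_def sn_def)
  ultimately show ?thesis by (subst tendsto_cong)
qed

section \<open>Location of the Steiner point and independence of the hyperplane\<close>

lemma steiner_point_in_section:
  fixes K :: "'a::euclidean_space set"
  assumes K: "convex K" "compact K" and z: "z \<in> interior K" "u \<bullet> z = t" and u: "norm u = 1"
  shows "steiner_point {x. u \<bullet> x = t} (K \<inter> {x. u \<bullet> x = t}) \<in> {x. u \<bullet> x = t} \<inter> interior K"
proof -
  define C where "C = K \<inter> {x. u \<bullet> x = t}"
  define s where "s = steiner_point {x. u \<bullet> x = t} C"
  have zK: "z \<in> K" using z interior_subset by blast
  have C: "compact C" "C \<noteq> {}"
    using K zK z closed_hyperplane by (auto simp: C_def intro!: compact_Int_closed)
  have us: "u \<bullet> s = t" unfolding s_def by (rule steiner_point_on_hyperplane[OF u C])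
  have "\<exists>y\<in>K. u \<bullet> y = t \<and> e \<bullet> s < e \<bullet> y" if e: "e \<noteq> 0" "u \<bullet> e = 0" for e
  proof -
    \<comment> \<open>Together with \<open>z\<close>, a point displaced along \<open>e\<close> shows
      that the section has positive width in this direction, which makes the bound on the Steiner
      point strict.\<close>
    obtain r where r: "r > 0" "cball z r \<subseteq> K" using z by (auto simp: mem_interior_cball)
    have "z + (r / norm e) *\<^sub>R e \<in> K" using r e by (intro set_mp[OF r(2)]) (auto simp: dist_norm)
    moreover have "u \<bullet> (z + (r / norm e) *\<^sub>R e) = t" using z e by (simp add: inner_add_right)
    ultimately have "z + (r / norm e) *\<^sub>R e \<in> C" by (simp add: C_def)
    from support_function_ge[OF C this, of e]
    have 1: "z \<bullet> e + (r / norm e) * (e \<bullet> e) \<le> support_function C e" by (simp add: inner_add_left)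
    have "z \<in> C" using zK z by (simp add: C_def)
    from support_function_ge[OF C this, of "- e"]
    have 2: "- (z \<bullet> e) \<le> support_function C (- e)" by simp
    have "(r / norm e) * (e \<bullet> e) > 0" using r e by simp
    then have "0 < support_function C e + support_function C (- e)" using 1 2 by linarith
    then have "e \<bullet> s < support_function C e"
      unfolding s_def using e by (intro inner_steiner_point(2)[OF u C]) auto
    moreover obtain y where "y \<in> C" "support_function C e = y \<bullet> e"
      using support_function_attained[OF C] by blast
    ultimately show ?thesis by (auto simp: C_def inner_commute)
  qed
  then have "s \<in> interior K" by (intro interior_section_criterion[OF K(1) z us u]) auto
  then show ?thesis using us by (simp add: s_def C_def)
qed

lemma steiner_point_mem:
  fixes C :: "'a::euclidean_space set"
  assumes C: "convex C" "compact C" "C \<noteq> {}" and CH: "C \<subseteq> {x. u \<bullet> x = t}" and u: "norm u = 1"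
  shows "steiner_point {x. u \<bullet> x = t} C \<in> C"
proof (rule ccontr)
  define s where "s = steiner_point {x. u \<bullet> x = t} C"
  assume "steiner_point {x. u \<bullet> x = t} C \<notin> C"
  then obtain a b where ab: "a \<bullet> s < b" "\<And>y. y \<in> C \<Longrightarrow> b < a \<bullet> y"
    using separating_hyperplane_closed_point[of C s] C by (auto simp: s_def compact_imp_closed)
  have us: "u \<bullet> s = t" unfolding s_def by (rule steiner_point_on_hyperplane[OF u C(2,3)])
  \<comment> \<open>Minus the component of \<open>a\<close> along the hyperplane; the sign places
    \<open>C\<close> strictly below \<open>s\<close> in direction \<open>e\<close>.\<close>
  define e where "e = (a \<bullet> u) *\<^sub>R u - a"
  have uu: "u \<bullet> u = 1" using u by (simp add: norm_eq_1)
  have ue: "u \<bullet> e = 0" by (simp add: e_def inner_diff_right uu inner_commute)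
  have ey: "e \<bullet> y = (a \<bullet> u) * (u \<bullet> y) - a \<bullet> y" for y by (simp add: e_def inner_diff_left)
  obtain y where y: "y \<in> C" "support_function C e = y \<bullet> e"
    using support_function_attained[OF C(2,3)] by blast
  have "u \<bullet> y = t" using CH y by auto
  then have "e \<bullet> y < e \<bullet> s" using ab(1) ab(2)[OF y(1)] us by (simp add: ey)
  moreover from this have "e \<noteq> 0" by auto
  then have "e \<bullet> s \<le> support_function C e"
    unfolding s_def by (intro inner_steiner_point(1)[OF u C(2,3) ue])
  ultimately show False using y by (simp add: inner_commute)
qed

text \<open>The reflection exchanging the two normals fixes \<open>C\<close>, hence its Steiner point, pointwise.\<close>

lemma steiner_point_independent_of_hyperplane:
  fixes C :: "'a::euclidean_space set"
  assumes C: "convex C" "compact C" and p: "p \<in> C"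
    and Cv: "C \<subseteq> {x. v \<bullet> x = v \<bullet> p}" and Cw: "C \<subseteq> {x. w \<bullet> x = w \<bullet> p}"
    and v: "norm v = 1" and w: "norm w = 1"
  shows "steiner_point {x. v \<bullet> x = v \<bullet> p} C = steiner_point {x. w \<bullet> x = w \<bullet> p} C"
proof -
  have Cne: "C \<noteq> {}" using p by auto
  define D where "D = (\<lambda>x. x - p) ` C"
  define T where "T = reflection (v - w)"
  define h where "h = support_function D"
  have T: "orthogonal_transformation T" unfolding T_def by (rule orthogonal_transformation_reflection)
  have lin: "linear T" using T by (rule orthogonal_transformation_linear)
  have Tvw: "T v = w" unfolding T_def using v w by (intro reflection_swap) simp
  have fix_T: "T (x - p) = x - p" if "x \<in> C" for x
  proof -
    have "v \<bullet> x = v \<bullet> p" "w \<bullet> x = w \<bullet> p" using that Cv Cw by auto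
    then show ?thesis
      unfolding T_def by (intro reflection_orthogonal) (simp add: inner_diff_left inner_diff_right)
  qed
  have D: "compact D" "D \<noteq> {}" using C Cne by (auto simp: D_def compact_translation_subtract)
  have [measurable]: "h \<in> borel_measurable borel" unfolding h_def by (rule borel_measurable_support_function[OF D])
  \<comment> \<open>\<open>T\<close> is self-adjoint and fixes \<open>D\<close> pointwise.\<close>
  have hT: "h (T x) = h x" for x
  proof -
    have "y \<bullet> T x = y \<bullet> x" if "y \<in> D" for y
      using that fix_T by (auto simp: D_def) (metis T_def inner_reflection_left)
    then show ?thesis unfolding h_def support_function_def by simp
  qed
  define J where "J u = (LINT x|sphere_measure {x. u \<bullet> x = 0}. h x *\<^sub>R x)" for u
  let ?k = "unit_ball_vol (real (DIM('a) - 1))"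
  have s: "steiner_point {x. u \<bullet> x = u \<bullet> p} C = p + (1 / ?k) *\<^sub>R J u" if "norm u = 1" for u
    unfolding J_def h_def D_def by (rule steiner_point_hyperplane[OF that C(2) Cne refl])
  have "J w = (LINT x|sphere_measure {x. v \<bullet> x = 0}. h (T x) *\<^sub>R T x)"
    unfolding J_def using integral_sphere_measure_orthogonal[OF v T, of "\<lambda>x. h x *\<^sub>R x"] by (simp add: Tvw)
  also have "\<dots> = (LINT x|sphere_measure {x. v \<bullet> x = 0}. T (h x *\<^sub>R x))"
    by (simp add: hT linear_scale[OF lin])
  also have "\<dots> = T (J v)"
    unfolding J_def h_def
    by (intro integral_bounded_linear integrable_support_function[OF v D])
      (use lin in \<open>simp add: linear_conv_bounded_linear\<close>)
  finally have Jw: "J w = T (J v)" .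
  have "steiner_point {x. v \<bullet> x = v \<bullet> p} C \<in> C"
    by (rule steiner_point_mem[OF C Cne Cv v])
  \<comment> \<open>The Steiner point lies in \<open>C\<close>, so the vector to it from
    \<open>p\<close> is among those fixed by \<open>T\<close>.\<close>
  then have "T ((1 / ?k) *\<^sub>R J v) = (1 / ?k) *\<^sub>R J v" using fix_T s[OF v] by fastforce
  then show ?thesis using s[OF v] s[OF w] by (auto simp: Jw linear_scale[OF lin])
qed

theorem theorem1p13:
  fixes K :: "(real ^ 'n) set"
  assumes "convex_body K"
  shows
    "(\<exists>f :: ((real ^ 'n) \<times> real) set \<Rightarrow> (real ^ 'n) \<times> real.
        continuous_map real_projective_space (top_of_set (sphere 0 1)) f \<and>
        (\<forall>k::nat. k \<ge> 2 \<longrightarrow> admits_multiplicity real_projective_space f k \<longrightarrow>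
          (\<exists>H :: nat \<Rightarrow> (real ^ 'n) set.
             inj_on H {1..k} \<and>
             (\<forall>i\<in>{1..k}. affine_hyperplane (H i) \<and> H i \<inter> K \<noteq> {}) \<and>
             (\<forall>i\<in>{1..k}. \<forall>j\<in>{1..k}.
                center_of_mass (K \<inter> H i) = center_of_mass (K \<inter> H j)))))
     \<and>
     (\<exists>f :: ((real ^ 'n) \<times> real) set \<Rightarrow> (real ^ 'n) \<times> real.
        continuous_map real_projective_space (top_of_set (sphere 0 1)) f \<and>
        (\<forall>k::nat. k \<ge> 2 \<longrightarrow> admits_multiplicity real_projective_space f k \<longrightarrow>
          (\<exists>H :: nat \<Rightarrow> (real ^ 'n) set.
             inj_on H {1..k} \<and>
             (\<forall>i\<in>{1..k}. affine_hyperplane (H i) \<and> H i \<inter> K \<noteq> {}) \<and>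
             (\<forall>i\<in>{1..k}. \<forall>j\<in>{1..k}.
                steiner_point (H i) (K \<inter> H i) = steiner_point (H j) (K \<inter> H j)))))"
proof -
  have K: "convex K" "compact K" using assms by (auto simp: convex_body_def)
  have sections: "\<exists>z. z \<in> interior K \<and> u \<bullet> z = t" if "{x. u \<bullet> x = t} \<inter> interior K \<noteq> {}" for u t
    using that by auto
  show ?thesis
  proof (intro conjI)
    show "\<exists>f :: ((real ^ 'n) \<times> real) set \<Rightarrow> (real ^ 'n) \<times> real.
        continuous_map real_projective_space (top_of_set (sphere 0 1)) f \<and>
        (\<forall>k::nat. k \<ge> 2 \<longrightarrow> admits_multiplicity real_projective_space f k \<longrightarrow>
          (\<exists>H :: nat \<Rightarrow> (real ^ 'n) set.
             inj_on H {1..k} \<and>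
             (\<forall>i\<in>{1..k}. affine_hyperplane (H i) \<and> H i \<inter> K \<noteq> {}) \<and>
             (\<forall>i\<in>{1..k}. \<forall>j\<in>{1..k}.
                center_of_mass (K \<inter> H i) = center_of_mass (K \<inter> H j))))"
    proof (rule exists_projective_map[OF assms])
      fix u :: "real ^ 'n" and t assume u: "norm u = 1" "{x. u \<bullet> x = t} \<inter> interior K \<noteq> {}"
      obtain z where z: "z \<in> interior K" "u \<bullet> z = t" using sections[OF u(2)] by blast
      show "center_of_mass (K \<inter> {x. u \<bullet> x = t}) \<in> {x. u \<bullet> x = t} \<inter> interior K"
        by (rule center_of_mass_in_section[OF u(1) K z])
      fix un tn assume "\<And>n. norm (un n) = 1" "un \<longlonglongrightarrow> u" "tn \<longlonglongrightarrow> t"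
      then show "(\<lambda>n. center_of_mass (K \<inter> {x. un n \<bullet> x = tn n})) \<longlonglongrightarrow> center_of_mass (K \<inter> {x. u \<bullet> x = t})"
        by (rule tendsto_center_of_mass_section[OF K z u(1)])
    \<comment> \<open>The center of mass is a function of the section alone, so the condition on
      faces is immediate.\<close>
    qed simp
    show "\<exists>f :: ((real ^ 'n) \<times> real) set \<Rightarrow> (real ^ 'n) \<times> real.
        continuous_map real_projective_space (top_of_set (sphere 0 1)) f \<and>
        (\<forall>k::nat. k \<ge> 2 \<longrightarrow> admits_multiplicity real_projective_space f k \<longrightarrow>
          (\<exists>H :: nat \<Rightarrow> (real ^ 'n) set.
             inj_on H {1..k} \<and>
             (\<forall>i\<in>{1..k}. affine_hyperplane (H i) \<and> H i \<inter> K \<noteq> {}) \<and>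
             (\<forall>i\<in>{1..k}. \<forall>j\<in>{1..k}.
                steiner_point (H i) (K \<inter> H i) = steiner_point (H j) (K \<inter> H j))))"
    proof (rule exists_projective_map[OF assms])
      fix u :: "real ^ 'n" and t assume u: "norm u = 1" "{x. u \<bullet> x = t} \<inter> interior K \<noteq> {}"
      obtain z where z: "z \<in> interior K" "u \<bullet> z = t" using sections[OF u(2)] by blast
      show "steiner_point {x. u \<bullet> x = t} (K \<inter> {x. u \<bullet> x = t}) \<in> {x. u \<bullet> x = t} \<inter> interior K"
        by (rule steiner_point_in_section[OF K z u(1)])
      fix un tn assume "\<And>n. norm (un n) = 1" "un \<longlonglongrightarrow> u" "tn \<longlonglongrightarrow> t"
      then show "(\<lambda>n. steiner_point {x. un n \<bullet> x = tn n} (K \<inter> {x. un n \<bullet> x = tn n})) \<longlonglongrightarrow>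
          steiner_point {x. u \<bullet> x = t} (K \<inter> {x. u \<bullet> x = t})"
        by (rule tendsto_steiner_point_section[OF K z u(1)])
    next
      \<comment> \<open>The Steiner point refers to the ambient hyperplane, so equality of the
        sections does not by itself equate the values.\<close>
      fix p v w :: "real ^ 'n"
      assume p: "p \<in> K" and vw: "norm v = 1" "norm w = 1"
        and eq: "K \<inter> {x. v \<bullet> x = v \<bullet> p} = K \<inter> {x. w \<bullet> x = w \<bullet> p}"
      define C where "C = K \<inter> {x. v \<bullet> x = v \<bullet> p}"
      have "convex C" "compact C" "p \<in> C" "C \<subseteq> {x. v \<bullet> x = v \<bullet> p}"
        using K p by (auto simp: C_def convex_hyperplane convex_Int compact_Int_closed closed_hyperplane)
      moreover have "C \<subseteq> {x. w \<bullet> x = w \<bullet> p}" using eq by (auto simp: C_def)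
      ultimately have "steiner_point {x. v \<bullet> x = v \<bullet> p} C = steiner_point {x. w \<bullet> x = w \<bullet> p} C"
        using vw by (rule steiner_point_independent_of_hyperplane)
      then show "steiner_point {x. v \<bullet> x = v \<bullet> p} (K \<inter> {x. v \<bullet> x = v \<bullet> p}) =
          steiner_point {x. w \<bullet> x = w \<bullet> p} (K \<inter> {x. w \<bullet> x = w \<bullet> p})"
        using eq by (simp add: C_def)
    qed
  qed
qed

end
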